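(* Let $G$ be a reduced alternating decomposition graph. Then $g_T(G)=1$ if and only if $G$ is doubled path equivalent to $C_2^2$; that is, if and only if $G$ is a doubled cycle $C_{i}^2$ of even length $i$.
   Context: Graphs are finite and may have multiple edges. A link diagram $D$ is viewed as a $4$-valent graph on the sphere $S^2$ with over/under information at the vertices (crossings). An edge of $D$ is non-alternating if both of its ends are over-strands or both are under-strands at the crossings they meet; otherwise it is alternating. A diagram is alternating if all its edges are alternating. Alternating decomposition graph of $D$: for a connected diagram $D$, mark two distinct points on every non-alternating edge, and inside each face join by disjoint arcs those pairs of marked points that are adjacent along the boundary of the face but do not lie on the same edge of $D$; the arcs form disjoint simple closed curves $\gamma_1,\dots,\gamma_k$. If $D$ is connected and alternating, its alternating decomposition graph is a single vertex. If $D$ is connected and not alternating, the graph has vertices $v_1,\dots,v_k$ corresponding to the curves and one edge for each non-alternating edge of $D$, joining $v_i$ and $v_j$ where $\gamma_i,\gamma_j$ are the curves through the two marked points. For disconnected $D$ take the disjoint union over connected components. An alternating decomposition graph is a graph arising in this way from some link diagram. For a link diagram $D$, $g_T(D)=\frac12\bigl(2k(D)+c(D)-s_A(D)-s_B(D)\bigr)$ is the genus of its Turaev surface, where $k(D)$ is the number of connected components of $D$ as a graph, $c(D)$ the number of crossings, and $s_A(D),s_B(D)$ the numbers of curves in the all-$A$ and all-$B$ states. For an alternating decomposition graph $G$, $g_T(G):=g_T(D)$ for any diagram $D$ with alternating decomposition graph $G$ (this is independent of $D$). A graph is $k$-edge connected if it remains connected whenever fewer than $k$ edges are removed. An alternating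 decomposition graph $G$ is reduced if $G$ is a single vertex or every component of $G$ is $3$-edge connected; here an isolated vertex component is not counted as $3$-edge connected. The doubled cycle $C_i^2$ is obtained from the cycle $C_i$ of length $i$ by doubling every edge ($C_2^2$ has two vertices and four parallel edges). A doubled path of length $k$ in $G$ consists of distinct vertices $v_0,\dots,v_k$ such that for each $i=1,\dots,k$ there are two distinct edges $e_{i,1},e_{i,2}$ joining $v_{i-1}$ and $v_i$, and $\deg v_i=4$ for $1\le i\le k-1$. A doubled path contraction of $G$ replaces $G$ by $G/\{e_{i,1},e_{i,2}\}$ (identify $v_{i-1}$ and $v_i$ and delete $e_{i,1},e_{i,2}$) for some $i$ and some doubled path of length $k\ge 2$, so that the doubled path is shortened but not destroyed; the inverse operation is a doubled path extension. Two alternating decomposition graphs are doubled path equivalent if some finite sequence of doubled path contractions and extensions transforms one into the other (up to isomorphism); intermediate graphs need not be bipartite. *)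

theory Defs
  imports Complex_Main
begin

section \<open>Classes of an equivalence relation generated by a relation\<close>

definition class_of :: "'a set \<Rightarrow> ('a \<times> 'a) set \<Rightarrow> 'a \<Rightarrow> 'a set" where
  "class_of S r x = {y \<in> S. (x, y) \<in> (r \<union> r\<inverse>)\<^sup>*}"

definition classes :: "'a set \<Rightarrow> ('a \<times> 'a) set \<Rightarrow> 'a set set" where
  "classes S r = class_of S r ` S"


section \<open>Finite multigraphs\<close>

text \<open>Undirected multigraphs: \<open>ends e\<close> is the set of endpoints of the edge \<open>e\<close>; it is a
  singleton if \<open>e\<close> is a loop.\<close>

record ('v, 'e) mgraph =
  verts :: "'v set"
  edges :: "'e set"
  ends :: "'e \<Rightarrow> 'v set"

definition multigraph :: "('v, 'e) mgraph \<Rightarrow> bool" where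
  "multigraph G \<longleftrightarrow> finite (verts G) \<and> finite (edges G) \<and>
     (\<forall>e \<in> edges G. ends G e \<subseteq> verts G \<and> card (ends G e) \<in> {1, 2})"

definition mgraph_iso :: "('v, 'e) mgraph \<Rightarrow> ('w, 'f) mgraph \<Rightarrow> bool" (infix "\<cong>\<^sub>m" 50) where
  "G \<cong>\<^sub>m H \<longleftrightarrow> (\<exists>f g. bij_betw f (verts G) (verts H) \<and> bij_betw g (edges G) (edges H) \<and>
     (\<forall>e \<in> edges G. ends H (g e) = f ` ends G e))"

text \<open>Loops count twice.\<close>

definition degree :: "('v, 'e) mgraph \<Rightarrow> 'v \<Rightarrow> nat" where
  "degree G v = card {e \<in> edges G. v \<in> ends G e} + card {e \<in> edges G. ends G e = {v}}"

definition adjacency :: "('v, 'e) mgraph \<Rightarrow> ('v \<times> 'v) set" where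
  "adjacency G = {(u, v). \<exists>e \<in> edges G. ends G e = {u, v}}"

definition connected_mgraph :: "('v, 'e) mgraph \<Rightarrow> bool" where
  "connected_mgraph G \<longleftrightarrow> verts G \<noteq> {} \<and>
     (\<forall>u \<in> verts G. \<forall>v \<in> verts G. (u, v) \<in> (adjacency G)\<^sup>*)"

definition k_edge_connected :: "nat \<Rightarrow> ('v, 'e) mgraph \<Rightarrow> bool" where
  "k_edge_connected k G \<longleftrightarrow>
     (\<forall>F \<subseteq> edges G. card F < k \<longrightarrow> connected_mgraph (G\<lparr>edges := edges G - F\<rparr>))"

definition components :: "('v, 'e) mgraph \<Rightarrow> ('v, 'e) mgraph set" where
  "components G = (\<lambda>C. G\<lparr>verts := C, edges := {e \<in> edges G. ends G e \<subseteq> C}\<rparr>) `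
     classes (verts G) (adjacency G)"

definition single_vertex :: "('v, 'e) mgraph \<Rightarrow> bool" where
  "single_vertex G \<longleftrightarrow> (\<exists>v. verts G = {v}) \<and> edges G = {}"

definition reduced :: "('v, 'e) mgraph \<Rightarrow> bool" where
  "reduced G \<longleftrightarrow> single_vertex G \<or>
     (\<forall>C \<in> components G. k_edge_connected 3 C \<and> \<not> single_vertex C)"

text \<open>The edges of the doubled cycle are the pairs \<open>(j, b)\<close> with \<open>b < 2\<close>, the two copies of the edge
  from \<open>j\<close> to its cyclic successor. For \<open>i = 2\<close> these are four parallel edges.\<close>

definition doubled_cycle :: "nat \<Rightarrow> (nat, nat \<times> nat) mgraph" where
  "doubled_cycle i =
     \<lparr>verts = {..<i}, edges = {..<i} \<times> {..<2}, ends = (\<lambda>(j, b). {j, Suc j mod i})\<rparr>"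


section \<open>Doubled path equivalence\<close>

text \<open>A doubled path of length \<open>k = length es\<close> is given by the list \<open>vs\<close> of its \<open>k + 1\<close> vertices and
  the list \<open>es\<close> of its \<open>k\<close> pairs of parallel edges.\<close>

definition doubled_path :: "('v, 'e) mgraph \<Rightarrow> 'v list \<Rightarrow> ('e \<times> 'e) list \<Rightarrow> bool" where
  "doubled_path G vs es \<longleftrightarrow>
     length vs = Suc (length es) \<and> distinct vs \<and> set vs \<subseteq> verts G \<and>
     (\<forall>i < length es. fst (es ! i) \<in> edges G \<and> snd (es ! i) \<in> edges G \<and>
        fst (es ! i) \<noteq> snd (es ! i) \<and>
        ends G (fst (es ! i)) = {vs ! i, vs ! Suc i} \<and>
        ends G (snd (es ! i)) = {vs ! i, vs ! Suc i}) \<and>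
     (\<forall>i. 0 < i \<and> i < length es \<longrightarrow> degree G (vs ! i) = 4)"

text \<open>Identify \<open>u\<close> and \<open>w\<close> (the merged vertex is called \<open>u\<close>) and delete the edges in \<open>F\<close>.\<close>

definition contract :: "('v, 'e) mgraph \<Rightarrow> 'v \<Rightarrow> 'v \<Rightarrow> 'e set \<Rightarrow> ('v, 'e) mgraph" where
  "contract G u w F =
     (let q = (\<lambda>x. if x = w then u else x)
      in \<lparr>verts = q ` verts G, edges = edges G - F, ends = (\<lambda>e. q ` ends G e)\<rparr>)"

definition doubled_path_contraction :: "('v, 'e) mgraph \<Rightarrow> ('w, 'f) mgraph \<Rightarrow> bool" where
  "doubled_path_contraction G H \<longleftrightarrow>
     (\<exists>vs es i. doubled_path G vs es \<and> 2 \<le> length es \<and> i < length es \<and>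
        H \<cong>\<^sub>m contract G (vs ! i) (vs ! Suc i) {fst (es ! i), snd (es ! i)})"

definition doubled_path_step :: "(nat, nat) mgraph \<Rightarrow> (nat, nat) mgraph \<Rightarrow> bool" where
  "doubled_path_step G H \<longleftrightarrow> multigraph G \<and> multigraph H \<and>
     (doubled_path_contraction G H \<or> doubled_path_contraction H G)"

text \<open>Every finite multigraph is isomorphic to one whose vertices and edges are natural numbers, so
  the intermediate graphs may be taken to be of that type whatever the types of \<open>G\<close> and \<open>H\<close> are.\<close>

definition doubled_path_equivalent :: "('v, 'e) mgraph \<Rightarrow> ('w, 'f) mgraph \<Rightarrow> bool" where
  "doubled_path_equivalent G H \<longleftrightarrow>
     (\<exists>G' H'. multigraph G' \<and> G \<cong>\<^sub>m G' \<and> doubled_path_step\<^sup>*\<^sup>* G' H' \<and> multigraph H' \<and> H' \<cong>\<^sub>m H)"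


section \<open>Link diagrams\<close>

text \<open>A link diagram is encoded as in a planar diagram code. The four half-edges (darts) at a crossing
  \<open>x\<close> are \<open>(x, 0), (x, 1), (x, 2), (x, 3)\<close> in counterclockwise order, where \<open>(x, 0)\<close> and \<open>(x, 2)\<close>
  form the under-strand and \<open>(x, 1)\<close> and \<open>(x, 3)\<close> the over-strand. The involution \<open>glue\<close> maps each
  dart to the other half of its edge. Crossingless simple closed curve components of the diagram
  are not seen by the darts and are counted separately by \<open>circles\<close>.

  A connected diagram on the sphere with at least one crossing is determined, up to orientation
  preserving homeomorphism of the sphere, by this data. For a disconnected diagram the relative
  position of the connected components is not recorded: all notions below are defined component by
  component (or by counting) and do not depend on it.\<close>

type_synonym 'c dart = "'c \<times> nat"

record 'c diagram =
  crossings :: "'c set"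
  glue :: "'c dart \<Rightarrow> 'c dart"
  circles :: nat

definition darts :: "'c diagram \<Rightarrow> 'c dart set" where
  "darts D = crossings D \<times> {..<4}"

definition next_ccw :: "'c dart \<Rightarrow> 'c dart" where
  "next_ccw d = (fst d, Suc (snd d) mod 4)"

definition over :: "'c dart \<Rightarrow> bool" where
  "over d \<longleftrightarrow> odd (snd d)"

definition edge_of :: "'c diagram \<Rightarrow> 'c dart \<Rightarrow> 'c dart set" where
  "edge_of D d = {d, glue D d}"

definition crossing_components :: "'c diagram \<Rightarrow> 'c dart set set" where
  "crossing_components D =
     classes (darts D) ((\<lambda>d. (d, glue D d)) ` darts D \<union> (\<lambda>d. (d, next_ccw d)) ` darts D)"

text \<open>Walking along the boundary of a face: follow the edge of \<open>d\<close> to its other end and leave that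
  crossing by the neighbouring dart. The faces of a connected component are the orbits.\<close>

definition face_step :: "'c diagram \<Rightarrow> 'c dart \<Rightarrow> 'c dart" where
  "face_step D d = next_ccw (glue D d)"

definition faces :: "'c diagram \<Rightarrow> 'c dart set \<Rightarrow> 'c dart set set" where
  "faces D C = classes C ((\<lambda>d. (d, face_step D d)) ` C)"

text \<open>The last condition says that every connected component is embedded in a sphere (Euler's formula).\<close>

definition link_diagram :: "'c diagram \<Rightarrow> bool" where
  "link_diagram D \<longleftrightarrow>
     finite (crossings D) \<and> (crossings D \<noteq> {} \<or> 0 < circles D) \<and>
     (\<forall>d \<in> darts D. glue D d \<in> darts D \<and> glue D d \<noteq> d \<and> glue D (glue D d) = d) \<and>
     (\<forall>C \<in> crossing_components D.
        int (card (fst ` C)) - int (card (edge_of D ` C)) + int (card (faces D C)) = 2)"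


section \<open>Turaev genus of a diagram\<close>

text \<open>The A-smoothing joins the two regions swept out when the over-strand is rotated
  counterclockwise, i.e. those between the darts 1, 2 and between the darts 3, 0; so it
  connects 0 with 1 and 2 with 3. The B-smoothing connects 1 with 2 and 3 with 0.\<close>

definition smooth_A :: "'c dart \<Rightarrow> 'c dart" where
  "smooth_A d = (fst d, if even (snd d) then snd d + 1 else snd d - 1)"

definition smooth_B :: "'c dart \<Rightarrow> 'c dart" where
  "smooth_B d = (fst d, if odd (snd d) then (snd d + 1) mod 4 else (snd d + 3) mod 4)"

definition state_curves :: "'c diagram \<Rightarrow> ('c dart \<Rightarrow> 'c dart) \<Rightarrow> nat" where
  "state_curves D s =
     card (classes (darts D) ((\<lambda>d. (d, glue D d)) ` darts D \<union> (\<lambda>d. (d, s d)) ` darts D)) + circles D"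

definition num_components :: "'c diagram \<Rightarrow> nat" where
  "num_components D = card (crossing_components D) + circles D"

definition turaev_genus :: "'c diagram \<Rightarrow> real" where
  "turaev_genus D = 1 / 2 * (2 * real (num_components D) + real (card (crossings D))
     - real (state_curves D smooth_A) - real (state_curves D smooth_B))"


section \<open>Alternating decomposition graphs\<close>

definition non_alternating :: "'c diagram \<Rightarrow> 'c dart \<Rightarrow> bool" where
  "non_alternating D d \<longleftrightarrow> (over d \<longleftrightarrow> over (glue D d))"

text \<open>Of the two marked points on a non-alternating edge, the one nearer to the crossing of the dart
  \<open>d\<close> is represented by \<open>d\<close>, so the marked points are the darts of the non-alternating edges.\<close>

definition marked_points :: "'c diagram \<Rightarrow> 'c dart set" where
  "marked_points D = {d \<in> darts D. non_alternating D d}"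

text \<open>The face walk traverses a non-alternating edge from the marked point \<open>d\<close> to the marked point
  \<open>glue D d\<close>; the marked point following the latter on the boundary of the face is the first marked
  point \<open>(face_step D ^^ n) d\<close> with \<open>n \<ge> 1\<close>. The two are joined by an arc
  unless they lie on the same edge.\<close>

definition arcs :: "'c diagram \<Rightarrow> ('c dart \<times> 'c dart) set" where
  "arcs D = {(glue D d, d') | d d'. d \<in> marked_points D \<and> d' \<in> marked_points D \<and>
     (\<exists>n \<ge> 1. d' = (face_step D ^^ n) d \<and>
        (\<forall>m. 1 \<le> m \<and> m < n \<longrightarrow> (face_step D ^^ m) d \<notin> marked_points D)) \<and>
     d' \<notin> edge_of D d}"

text \<open>A curve is represented by the set of marked points on it.\<close>

definition curve_through :: "'c diagram \<Rightarrow> 'c dart \<Rightarrow> 'c dart set" where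
  "curve_through D d = class_of (marked_points D) (arcs D) d"

text \<open>Arcs and edges stay inside a connected component of the diagram, so the disjoint union over the
  connected components is formed all at once. Its vertices are the curves, one vertex for every
  alternating connected component with crossings (represented by its set of darts), and one vertex for
  every crossingless component.\<close>

definition alt_decomp_graph :: "'c diagram \<Rightarrow> ('c dart set + nat, 'c dart set) mgraph" where
  "alt_decomp_graph D =
     \<lparr>verts = Inl ` (curve_through D ` marked_points D \<union>
                 {C \<in> crossing_components D. C \<inter> marked_points D = {}})
              \<union> Inr ` {..<circles D},
      edges = edge_of D ` marked_points D,
      ends = (\<lambda>e. (\<lambda>d. Inl (curve_through D d)) ` e)\<rparr>"

definition is_alt_decomp_graph_of :: "('v, 'e) mgraph \<Rightarrow> nat diagram \<Rightarrow> bool" where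
  "is_alt_decomp_graph_of G D \<longleftrightarrow> link_diagram D \<and> alt_decomp_graph D \<cong>\<^sub>m G"

definition is_alt_decomp_graph :: "('v, 'e) mgraph \<Rightarrow> bool" where
  "is_alt_decomp_graph G \<longleftrightarrow> (\<exists>D. is_alt_decomp_graph_of G D)"

text \<open>The diagram is chosen arbitrarily; the value is known not to depend on this choice.\<close>

definition adg_turaev_genus :: "('v, 'e) mgraph \<Rightarrow> real" where
  "adg_turaev_genus G = turaev_genus (SOME D. is_alt_decomp_graph_of G D)"

end

theory Submission
  imports Defs
begin

text \<open>The marked points with the gluing involution \<open>\<tau>\<close> and the permutation \<open>\<sigma>\<close> along the curves form a
  combinatorial map \<open>G\<close>, obtained from the diagram by contracting its alternating edges. Contraction
  preserves planarity and faces minus state curves, so twice the genus is \<open>F - A - B\<close>, where \<open>A\<close> and \<open>B\<close> count the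
  state curves of \<open>G\<close>: the zigzag paths that turn alternately left and right. If no two edges disconnect
  a component, all degrees are at least 4 and all zigzags have length at least 4, as a zigzag of length
  2 yields a 2-edge cut. Counting with Euler's formula gives genus at least the number of components, and
  genus 1 forces a connected 4-regular graph with all zigzags of length 4. Its faces have even length,
  so there is a bigon; a zigzag of length 4 propagates it to the opposite corner of each of its
  vertices, and the bigons line up to a doubled cycle. Conversely, a discharging argument shows
  that in every planar map of a doubled cycle the parallel edges bound bigons, which makes all zigzags
  have length 4; as their lengths add up, the cycle is even.\<close>

section \<open>Classes of generated equivalence relations\<close>

text \<open>The obstacle is topology: there is no surface, only permutations of darts. Euler's
  formula enters as an integer \<open>defect\<close> of two permutations, and the one topological
  fact is that it is never negative. Splitting a cycle by a transposition cannot raise it; so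
  contraction keeps a planar map planar, and splitting a vertex and a face at once must split a
  component. With k components, V vertices, F faces and s darts, planarity reads 4k + s = 2V + 2F.
  Degrees at least 4 give V \<le> s/4, and a zigzag of length at least 4 uses at least 8 darts, so A
  and B are at most s/8. Hence F - A - B \<ge> 2k + s/2 - s/4 - s/8 - s/8 = 2k, and genus 1 makes
  every estimate tight. Then F = 2 + s/4, too many faces for lengths of at least 4. Colours that
  alternate around vertices rule out odd lengths. In the converse n vertices carry corner weight at
  most 1 + 2/n each, n + 2 in all, shared by 2k + n faces of weight at least 1; so k = 1. There are
  4n darts and every zigzag takes 8 of them, so n is even.\<close>

definition eqc :: "('a \<times> 'a) set \<Rightarrow> ('a \<times> 'a) set" where
  "eqc r = (r \<union> r\<inverse>)\<^sup>*"

abbreviation graph_on :: "'a set \<Rightarrow> ('a \<Rightarrow> 'a) \<Rightarrow> ('a \<times> 'a) set" where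
  "graph_on S f \<equiv> (\<lambda>d. (d, f d)) ` S"

lemma card_image_eq_kernel:
  assumes "\<And>u v. u \<in> A \<Longrightarrow> v \<in> A \<Longrightarrow> f u = f v \<longleftrightarrow> g u = g v"
  shows "card (f ` A) = card (g ` A)"
proof -
  have "bij_betw (g \<circ> inv_into A f) (f ` A) (g ` A)"
    unfolding bij_betw_def
  proof
    show "inj_on (g \<circ> inv_into A f) (f ` A)"
      by (rule inj_onI) (metis assms comp_apply f_inv_into_f inv_into_into)
    show "(g \<circ> inv_into A f) ` f ` A = g ` A"
    proof
      show "(g \<circ> inv_into A f) ` f ` A \<subseteq> g ` A"
        by (auto intro!: inv_into_into imageI)
      show "g ` A \<subseteq> (g \<circ> inv_into A f) ` f ` A"
      proof
        fix z assume "z \<in> g ` A"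
        then obtain u where u: "u \<in> A" "z = g u" by blast
        then have "f (inv_into A f (f u)) = f u" "inv_into A f (f u) \<in> A"
          by (auto simp: f_inv_into_f inv_into_into)
        then have "z = (g \<circ> inv_into A f) (f u)"
          using assms u by (metis comp_apply)
        then show "z \<in> (g \<circ> inv_into A f) ` f ` A" using u by blast
      qed
    qed
  qed
  then show ?thesis by (rule bij_betw_same_card)
qed

lemma eqc_refl [simp]: "(x, x) \<in> eqc r"
  by (simp add: eqc_def)

lemma eqc_sym: "(x, y) \<in> eqc r \<Longrightarrow> (y, x) \<in> eqc r"
  using sym_rtrancl[OF sym_Un_converse[of r]] unfolding eqc_def by (rule symD)

lemma eqc_trans: "(x, y) \<in> eqc r \<Longrightarrow> (y, z) \<in> eqc r \<Longrightarrow> (x, z) \<in> eqc r"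
  unfolding eqc_def by (rule rtrancl_trans)

lemma eqc_edge: "(x, y) \<in> r \<Longrightarrow> (x, y) \<in> eqc r"
  by (simp add: eqc_def r_into_rtrancl)

lemma eqc_edge_rev: "(x, y) \<in> r \<Longrightarrow> (y, x) \<in> eqc r"
  by (rule eqc_sym) (rule eqc_edge)

lemma eqc_induct [consumes 1, case_names refl step]:
  assumes "(x, y) \<in> eqc r" and "P x"
    and "\<And>y z. (x, y) \<in> eqc r \<Longrightarrow> (y, z) \<in> r \<or> (z, y) \<in> r \<Longrightarrow> P y \<Longrightarrow> P z"
  shows "P y"
  using assms(1) unfolding eqc_def
  by (induction rule: rtrancl_induct) (use assms(2,3) in \<open>auto simp: eqc_def\<close>)

lemma eqc_map:
  assumes "(u, v) \<in> eqc r" and "\<And>a b. (a, b) \<in> r \<Longrightarrow> (g a, g b) \<in> eqc r'"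
  shows "(g u, g v) \<in> eqc r'"
  using assms(1)
proof (induction rule: eqc_induct)
  case (step y z)
  then have "(g y, g z) \<in> eqc r'" using assms(2) eqc_sym by metis
  with step.IH show ?case by (rule eqc_trans)
qed simp

lemma eqc_subset:
  assumes "(u, v) \<in> eqc r" and "\<And>a b. (a, b) \<in> r \<Longrightarrow> (a, b) \<in> eqc r'"
  shows "(u, v) \<in> eqc r'"
  using eqc_map[where g = "\<lambda>x. x", OF assms(1)] assms(2) by metis

lemma eqc_closed:
  assumes "(x, y) \<in> eqc r" and "\<And>a b. (a, b) \<in> r \<Longrightarrow> a \<in> Z \<longleftrightarrow> b \<in> Z"
  shows "x \<in> Z \<longleftrightarrow> y \<in> Z"
  using assms(1) by (induction rule: eqc_induct) (use assms(2) in auto)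

lemma mem_class_of: "y \<in> class_of S r x \<longleftrightarrow> y \<in> S \<and> (x, y) \<in> eqc r"
  by (simp add: class_of_def eqc_def)

lemma class_of_self: "x \<in> S \<Longrightarrow> x \<in> class_of S r x"
  by (simp add: mem_class_of)

lemma class_of_subset: "class_of S r x \<subseteq> S"
  by (auto simp: mem_class_of)

lemma class_of_eq_iff:
  assumes "x \<in> S" "y \<in> S"
  shows "class_of S r x = class_of S r y \<longleftrightarrow> (x, y) \<in> eqc r"
proof
  assume "class_of S r x = class_of S r y"
  moreover have "y \<in> class_of S r y" using assms by (simp add: mem_class_of)
  ultimately show "(x, y) \<in> eqc r" by (metis mem_class_of)
next
  assume "(x, y) \<in> eqc r"
  then show "class_of S r x = class_of S r y"
    using eqc_trans[of x y r] eqc_trans[OF eqc_sym[of x y r]] by (auto simp: mem_class_of)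
qed

lemma class_of_eqI: "x \<in> S \<Longrightarrow> y \<in> S \<Longrightarrow> (x, y) \<in> eqc r \<Longrightarrow> class_of S r x = class_of S r y"
  by (simp add: class_of_eq_iff)

lemma class_of_subset_closed:
  assumes "x \<in> Z" and "\<And>a b. (a, b) \<in> r \<Longrightarrow> a \<in> Z \<longleftrightarrow> b \<in> Z"
  shows "class_of S r x \<subseteq> Z"
  using eqc_closed[OF _ assms(2)] assms(1) by (auto simp: mem_class_of)

lemma classes_finite: "finite S \<Longrightarrow> finite (classes S r)"
  by (simp add: classes_def)

lemma classes_Union: "\<Union>(classes S r) = S"
  unfolding classes_def by (auto simp: mem_class_of intro: bexI[of _ _ S])

lemma classes_subset: "C \<in> classes S r \<Longrightarrow> C \<subseteq> S"
  by (metis Union_upper classes_Union)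

lemma classes_nonempty: "C \<in> classes S r \<Longrightarrow> C \<noteq> {}"
  unfolding classes_def using class_of_self by (metis empty_iff imageE)

lemma classesE:
  assumes "C \<in> classes S r"
  obtains x where "x \<in> S" "x \<in> C" "C = class_of S r x"
proof -
  from assms obtain x where "x \<in> S" "C = class_of S r x" unfolding classes_def by blast
  then show thesis using that class_of_self by metis
qed

lemma class_eq_of_mem:
  assumes "C \<in> classes S r" "x \<in> C"
  shows "C = class_of S r x"
proof -
  obtain z where "z \<in> S" "C = class_of S r z" using assms(1) unfolding classes_def by blast
  then show ?thesis using assms(2) class_of_eq_iff[of z S x r] by (simp add: mem_class_of)
qed

lemma classes_disjoint:
  assumes "C \<in> classes S r" "C' \<in> classes S r" "C \<noteq> C'"
  shows "C \<inter> C' = {}"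
  using assms class_eq_of_mem by (metis disjoint_iff)

lemma sum_classes:
  assumes "finite S"
  shows "(\<Sum>C\<in>classes S r. sum f C) = sum f S"
proof -
  have "sum f (\<Union>(classes S r)) = (\<Sum>C\<in>classes S r. sum f C)"
    by (rule sum.Union_disjoint[simplified comp_def])
      (use assms classes_disjoint classes_subset finite_subset in \<open>metis+\<close>)
  then show ?thesis by (simp add: classes_Union)
qed

lemma card_classes_sum:
  assumes "finite S"
  shows "(\<Sum>C\<in>classes S r. card C) = card S"
  using sum_classes[OF assms, of "\<lambda>_. 1::nat" r] by simp

lemma card_classes_le:
  assumes "finite S" and "\<And>C. C \<in> classes S r \<Longrightarrow> k \<le> card C"
  shows "k * card (classes S r) \<le> card S"
proof -
  have "(\<Sum>C\<in>classes S r. k) \<le> (\<Sum>C\<in>classes S r. card C)"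
    by (rule sum_mono) (use assms in auto)
  then show ?thesis using card_classes_sum[OF assms(1)] by (simp add: mult.commute)
qed

lemma card_classes_ge:
  assumes "finite S" and "\<And>C. C \<in> classes S r \<Longrightarrow> card C \<le> k"
  shows "card S \<le> k * card (classes S r)"
proof -
  have "(\<Sum>C\<in>classes S r. card C) \<le> (\<Sum>C\<in>classes S r. k)"
    by (rule sum_mono) (use assms in auto)
  then show ?thesis using card_classes_sum[OF assms(1)] by (simp add: mult.commute)
qed

lemma card_classes_eq:
  assumes "finite S" and "\<And>C. C \<in> classes S r \<Longrightarrow> k \<le> card C"
    and "card S \<le> k * card (classes S r)" and "C \<in> classes S r"
  shows "card C = k"
proof (rule ccontr)
  assume "card C \<noteq> k"
  then have "k < card C" using assms(2)[OF assms(4)] by simp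
  then have "(\<Sum>C\<in>classes S r. k) < (\<Sum>C\<in>classes S r. card C)"
    using assms by (intro sum_strict_mono_ex1) (auto simp: classes_finite)
  then show False using card_classes_sum[OF assms(1)] assms(3) by (simp add: mult.commute)
qed

lemma classes_cong:
  assumes "\<And>x y. x \<in> S \<Longrightarrow> y \<in> S \<Longrightarrow> (x, y) \<in> eqc r \<longleftrightarrow> (x, y) \<in> eqc r'"
  shows "classes S r = classes S r'"
  unfolding classes_def by (intro image_cong) (use assms in \<open>auto simp: mem_class_of\<close>)

lemma classes_eqI:
  assumes "\<And>a b. (a, b) \<in> r \<Longrightarrow> (a, b) \<in> eqc r'" and "\<And>a b. (a, b) \<in> r' \<Longrightarrow> (a, b) \<in> eqc r"
  shows "classes S r = classes S r'"
  by (rule classes_cong) (use eqc_subset assms in metis)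

text \<open>\<open>g\<close> moves each point of \<open>S\<close> within its class into
  \<open>M\<close> and turns chains for \<open>r\<close> into chains for \<open>r'\<close>, so every
  class of \<open>S\<close> meets \<open>M\<close> in exactly one class. It is used to delete points
  from cycles and curves.\<close>

lemma card_classes_retract:
  assumes "M \<subseteq> S"
    and r': "\<And>a b. (a, b) \<in> r' \<Longrightarrow> (a, b) \<in> eqc r"
    and g: "\<And>x. x \<in> S \<Longrightarrow> g x \<in> M \<and> (x, g x) \<in> eqc r" "\<And>x. x \<in> M \<Longrightarrow> g x = x"
    and r: "\<And>a b. (a, b) \<in> r \<Longrightarrow> (g a, g b) \<in> eqc r'"
  shows "card (classes S r) = card (classes M r')"
proof -
  have "class_of S r ` S = class_of S r ` M"
  proof
    show "class_of S r ` S \<subseteq> class_of S r ` M"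
    proof
      fix C assume "C \<in> class_of S r ` S"
      then obtain x where "x \<in> S" "C = class_of S r x" by blast
      moreover have "class_of S r x = class_of S r (g x)"
        using \<open>x \<in> S\<close> g(1)[of x] assms(1) by (intro class_of_eqI) auto
      ultimately show "C \<in> class_of S r ` M" using g by auto
    qed
  qed (use assms(1) in auto)
  moreover have "card (class_of S r ` M) = card (class_of M r' ` M)"
  proof (rule card_image_eq_kernel)
    fix u v assume uv: "u \<in> M" "v \<in> M"
    have "(u, v) \<in> eqc r \<longleftrightarrow> (u, v) \<in> eqc r'"
      using eqc_map[where g = g and r' = r' and r = r, OF _ r] eqc_subset[OF _ r'] g(2) uv by metis
    then show "class_of S r u = class_of S r v \<longleftrightarrow> class_of M r' u = class_of M r' v"
      using uv assms(1) by (simp add: class_of_eq_iff subset_iff)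
  qed
  ultimately show ?thesis by (simp add: classes_def)
qed

lemma class_of_restrict:
  assumes "A \<subseteq> S" and "\<And>a b. (a, b) \<in> r \<Longrightarrow> a \<in> A \<longleftrightarrow> b \<in> A" and "x \<in> A"
    and r': "r' = r \<inter> A \<times> A"
  shows "class_of S r x = class_of A r' x"
proof -
  have "y \<in> A \<and> (x, y) \<in> eqc r'" if "(x, y) \<in> eqc r" for y
    using that
  proof (induction rule: eqc_induct)
    case (step y z)
    then have "z \<in> A" using assms(2) by blast
    moreover have "(y, z) \<in> eqc r'" using step.hyps(2)
    proof
      assume "(y, z) \<in> r"
      then show ?thesis using step.IH \<open>z \<in> A\<close> by (intro eqc_edge) (simp add: r')
    next
      assume "(z, y) \<in> r"
      then show ?thesis using step.IH \<open>z \<in> A\<close> by (intro eqc_edge_rev) (simp add: r')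
    qed
    ultimately show ?case using step.IH eqc_trans by metis
  qed (simp add: assms(3))
  moreover have "(x, y) \<in> eqc r" if "(x, y) \<in> eqc r'" for y
    using that by (rule eqc_subset) (auto simp: r' eqc_edge)
  ultimately show ?thesis using assms(1) by (auto simp: mem_class_of)
qed

lemma card_classes_split:
  assumes "finite A" "finite B" "A \<inter> B = {}" and "r \<subseteq> A \<times> A" "r' \<subseteq> B \<times> B"
  shows "card (classes (A \<union> B) (r \<union> r')) = card (classes A r) + card (classes B r')"
proof -
  have 1: "class_of (A \<union> B) (r \<union> r') x = class_of A r x" if "x \<in> A" for x
    by (rule class_of_restrict) (use that assms in auto)
  have 2: "class_of (A \<union> B) (r \<union> r') x = class_of B r' x" if "x \<in> B" for x
    by (rule class_of_restrict) (use that assms in auto)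
  have "classes (A \<union> B) (r \<union> r') = classes A r \<union> classes B r'"
    unfolding classes_def image_Un using 1 2 by simp
  moreover have "classes A r \<inter> classes B r' = {}"
  proof (rule ccontr)
    assume "classes A r \<inter> classes B r' \<noteq> {}"
    then obtain C where "C \<in> classes A r" "C \<in> classes B r'" by blast
    then have "C \<subseteq> A" "C \<subseteq> B" "C \<noteq> {}" by (simp_all add: classes_subset classes_nonempty)
    then show False using assms(3) by blast
  qed
  ultimately show ?thesis
    using assms by (simp add: card_Un_disjoint classes_finite)
qed

text \<open>\<open>q\<close> replaces the points of the class of \<open>y\<close> by
  \<open>x\<close> and turns chains for the larger relation into chains for \<open>r\<close>. So
  away from the class of \<open>y\<close> both relations agree, and that class is the one that gets
  absorbed.\<close>

lemma card_classes_insert: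
  assumes "x \<in> S" "y \<in> S" "(x, y) \<notin> eqc r" "finite S"
  shows "card (classes S r) = Suc (card (classes S (insert (x, y) r)))"
proof -
  let ?r' = "insert (x, y) r"
  define q where "q u = (if (u, y) \<in> eqc r then x else u)" for u
  let ?A = "{u \<in> S. (u, y) \<notin> eqc r}"
  have sub: "(a, b) \<in> eqc ?r'" if "(a, b) \<in> eqc r" for a b
    using that by (rule eqc_subset) (auto simp: eqc_edge)
  have xy: "(x, y) \<in> eqc ?r'" by (simp add: eqc_edge)
  have q: "(u, q u) \<in> eqc ?r'" for u
  proof (cases "(u, y) \<in> eqc r")
    case True
    then show ?thesis using eqc_trans[OF sub eqc_sym[OF xy]] by (simp add: q_def)
  qed (simp add: q_def)
  have "(q a, q b) \<in> eqc r" if "(a, b) \<in> ?r'" for a b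
  proof (cases "a = x \<and> b = y")
    case False
    then have "(a, b) \<in> eqc r" using that by (auto simp: eqc_edge)
    moreover have "(a, y) \<in> eqc r \<longleftrightarrow> (b, y) \<in> eqc r"
      using eqc_trans[OF \<open>(a, b) \<in> eqc r\<close>] eqc_trans[OF eqc_sym[OF \<open>(a, b) \<in> eqc r\<close>]] by metis
    ultimately show ?thesis by (simp add: q_def)
  qed (use assms in \<open>auto simp: q_def\<close>)
  then have q2: "(q u, q v) \<in> eqc r" if "(u, v) \<in> eqc ?r'" for u v
    using eqc_map[OF that] by blast
  have "classes S ?r' = class_of S ?r' ` ?A"
  proof -
    have "class_of S ?r' u \<in> class_of S ?r' ` ?A" if "u \<in> S" for u
    proof -
      have "q u \<in> ?A" using that assms by (auto simp: q_def)
      moreover have "class_of S ?r' u = class_of S ?r' (q u)"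
        using \<open>q u \<in> ?A\<close> that q by (intro class_of_eqI) auto
      ultimately show ?thesis by blast
    qed
    then have "class_of S ?r' ` S \<subseteq> class_of S ?r' ` ?A" by blast
    moreover have "class_of S ?r' ` ?A \<subseteq> class_of S ?r' ` S" by auto
    ultimately show ?thesis unfolding classes_def by (rule subset_antisym)
  qed
  moreover have "card (class_of S ?r' ` ?A) = card (class_of S r ` ?A)"
  proof (rule card_image_eq_kernel)
    fix u v assume uv: "u \<in> ?A" "v \<in> ?A"
    have "(u, v) \<in> eqc ?r' \<longleftrightarrow> (u, v) \<in> eqc r"
      using q2[of u v] sub[of u v] uv by (auto simp: q_def)
    then show "class_of S ?r' u = class_of S ?r' v \<longleftrightarrow> class_of S r u = class_of S r v"
      using uv by (simp add: class_of_eq_iff)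
  qed
  moreover have "classes S r = insert (class_of S r y) (class_of S r ` ?A)"
  proof -
    have "class_of S r u \<in> insert (class_of S r y) (class_of S r ` ?A)" if "u \<in> S" for u
    proof (cases "u \<in> ?A")
      case False
      then have "class_of S r u = class_of S r y" using that assms(2) by (intro class_of_eqI) auto
      then show ?thesis by simp
    qed simp
    then have "class_of S r ` S \<subseteq> insert (class_of S r y) (class_of S r ` ?A)" by blast
    moreover have "insert (class_of S r y) (class_of S r ` ?A) \<subseteq> class_of S r ` S"
      using assms(2) by auto
    ultimately show ?thesis unfolding classes_def by (rule subset_antisym)
  qed
  moreover have "class_of S r y \<notin> class_of S r ` ?A"
  proof
    assume "class_of S r y \<in> class_of S r ` ?A"
    then obtain u where "u \<in> ?A" "class_of S r y = class_of S r u" by blast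
    then have "(y, u) \<in> eqc r" using assms(2) by (simp add: class_of_eq_iff)
    then show False using \<open>u \<in> ?A\<close> eqc_sym[of y u r] by simp
  qed
  ultimately show ?thesis using assms by simp
qed

section \<open>Cycles of permutations of a finite set\<close>

abbreviation ncyc :: "'a set \<Rightarrow> ('a \<Rightarrow> 'a) \<Rightarrow> nat" where
  "ncyc S p \<equiv> card (classes S (graph_on S p))"

lemma graph_on_cong: "(\<And>x. x \<in> S \<Longrightarrow> f x = g x) \<Longrightarrow> graph_on S f = graph_on S g"
  by auto

text \<open>By finiteness \<open>p\<close> maps an invariant set onto itself, so invariance passes
  to the inverse. This lets forward-closed sets bound the classes, which are generated in both
  directions.\<close>

lemma bij_closed:
  assumes "finite S" "bij_betw p S S" "Z \<subseteq> S" "p ` Z \<subseteq> Z" "a \<in> S"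
  shows "p a \<in> Z \<longleftrightarrow> a \<in> Z"
proof
  assume "p a \<in> Z"
  have inj: "inj_on p S" using assms(2) by (simp add: bij_betw_def)
  have "card (p ` Z) = card Z" by (rule card_image[OF inj_on_subset[OF inj assms(3)]])
  then have "p ` Z = Z" by (rule card_subset_eq[OF finite_subset[OF assms(3,1)] assms(4)])
  then have "p a \<in> p ` Z" using \<open>p a \<in> Z\<close> by simp
  then obtain z where "z \<in> Z" "p z = p a" by auto
  moreover have "z \<in> S" using \<open>z \<in> Z\<close> assms(3) by blast
  ultimately show "a \<in> Z" using inj_onD[OF inj \<open>p z = p a\<close> \<open>z \<in> S\<close> assms(5)] by simp
next
  assume "a \<in> Z"
  then show "p a \<in> Z" using assms(4) by blast
qed

lemma funpow_mem: "bij_betw p S S \<Longrightarrow> x \<in> S \<Longrightarrow> (p ^^ k) x \<in> S"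
  by (induction k) (auto simp: bij_betwE)

lemma class_of_perm_subset:
  assumes "finite S" "bij_betw p S S" "Z \<subseteq> S" "p ` Z \<subseteq> Z" "x \<in> Z"
  shows "class_of S (graph_on S p) x \<subseteq> Z"
  by (rule class_of_subset_closed) (use assms bij_closed[OF assms(1-4)] in auto)

lemma class_of_perm:
  assumes "finite S" "bij_betw p S S" "x \<in> S"
  shows "class_of S (graph_on S p) x = {(p ^^ k) x |k. True}"
proof
  show "class_of S (graph_on S p) x \<subseteq> {(p ^^ k) x |k. True}"
  proof (rule class_of_perm_subset[OF assms(1,2)])
    show "{(p ^^ k) x |k. True} \<subseteq> S" using funpow_mem[OF assms(2,3)] by auto
    show "p ` {(p ^^ k) x |k. True} \<subseteq> {(p ^^ k) x |k. True}"
    proof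
      fix y assume "y \<in> p ` {(p ^^ k) x |k. True}"
      then obtain k where "y = p ((p ^^ k) x)" by blast
      then have "y = (p ^^ Suc k) x" by simp
      then show "y \<in> {(p ^^ k) x |k. True}" by blast
    qed
    show "x \<in> {(p ^^ k) x |k. True}" by (auto intro: exI[of _ 0])
  qed
next
  have "(x, (p ^^ k) x) \<in> eqc (graph_on S p)" for k
  proof (induction k)
    case (Suc k)
    have "((p ^^ k) x, (p ^^ Suc k) x) \<in> graph_on S p" using funpow_mem[OF assms(2,3), of k] by simp
    then show ?case by (rule eqc_trans[OF Suc eqc_edge])
  qed simp
  then show "{(p ^^ k) x |k. True} \<subseteq> class_of S (graph_on S p) x"
    using funpow_mem[OF assms(2,3)] by (auto simp: mem_class_of)
qed

lemma perm_return:
  assumes "finite S" "bij_betw p S S" "x \<in> S"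
  obtains k where "k \<ge> 1" "(p ^^ k) x = x"
proof -
  have px: "p x \<in> S" using assms(2,3) by (rule bij_betw_apply)
  have "(p x, x) \<in> eqc (graph_on S p)" by (rule eqc_edge_rev) (use assms in simp)
  then have "x \<in> class_of S (graph_on S p) (p x)" using assms(3) by (simp add: mem_class_of)
  then obtain k where "x = (p ^^ k) (p x)" unfolding class_of_perm[OF assms(1,2) px] by blast
  then have "(p ^^ Suc k) x = x" by (simp add: funpow_swap1)
  then show thesis using that[of "Suc k"] by simp
qed

text \<open>The permutation \<open>p\<close> preceded by the transposition of \<open>x\<close> and
  \<open>y\<close>. It merges the cycles of \<open>x\<close> and \<open>y\<close> if they differ and
  cuts a common one into two.\<close>

definition swap_at :: "('a \<Rightarrow> 'a) \<Rightarrow> 'a \<Rightarrow> 'a \<Rightarrow> 'a \<Rightarrow> 'a" where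
  "swap_at p x y = p(x := p y, y := p x)"

lemma swap_at_swap_at: "swap_at (swap_at p x y) x y = p"
  by (auto simp: swap_at_def)

text \<open>Translates a swap in the vertex permutation into one in the face permutation, at the
  preimages under the edge permutation.\<close>

lemma swap_at_comp:
  assumes "inj_on b S" "x \<in> S" "y \<in> S" "z \<in> S"
  shows "swap_at a (b x) (b y) (b z) = swap_at (\<lambda>z. a (b z)) x y z"
  using assms by (simp add: swap_at_def inj_on_eq_iff)

lemma bij_swap_at:
  assumes "bij_betw p S S" "x \<in> S" "y \<in> S"
  shows "bij_betw (swap_at p x y) S S"
proof -
  have "inj_on (swap_at p x y) S"
    using assms unfolding bij_betw_def inj_on_def swap_at_def by auto
  moreover have "swap_at p x y ` S = S"
  proof -
    have "p ` S \<subseteq> swap_at p x y ` S"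
    proof
      fix z assume "z \<in> p ` S"
      then obtain u where "u \<in> S" "z = p u" by blast
      then have "z = swap_at p x y (if u = x then y else if u = y then x else u)"
        by (auto simp: swap_at_def)
      then show "z \<in> swap_at p x y ` S" using assms \<open>u \<in> S\<close> by (metis image_eqI)
    qed
    moreover have "swap_at p x y ` S \<subseteq> p ` S" using assms by (auto simp: swap_at_def)
    ultimately show ?thesis using assms(1) by (simp add: bij_betw_def)
  qed
  ultimately show ?thesis by (simp add: bij_betw_def)
qed

text \<open>From \<open>x\<close> the swapped permutation jumps to \<open>p y\<close> and then
  follows the old cycle of \<open>y\<close> all the way round to \<open>y\<close>; \<open>x\<close>
  does not lie on that cycle, so nothing diverts it earlier.\<close>

lemma eqc_swap_at_merge:
  assumes "finite S" "bij_betw p S S" "x \<in> S" "y \<in> S" "(x, y) \<notin> eqc (graph_on S p)"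
  shows "(x, y) \<in> eqc (graph_on S (swap_at p x y))"
    and "classes S (graph_on S (swap_at p x y)) = classes S (insert (x, y) (graph_on S p))"
proof -
  let ?q = "swap_at p x y"
  obtain k0 where "k0 \<ge> 1" "(p ^^ k0) y = y" using perm_return[OF assms(1,2,4)] .
  define k where "k = (LEAST k. k \<ge> 1 \<and> (p ^^ k) y = y)"
  have k: "k \<ge> 1" "(p ^^ k) y = y"
    using LeastI[of "\<lambda>k. k \<ge> 1 \<and> (p ^^ k) y = y" k0] \<open>k0 \<ge> 1\<close> \<open>(p ^^ k0) y = y\<close>
    by (auto simp: k_def)
  have least: "(p ^^ j) y \<noteq> y" if "1 \<le> j" "j < k" for j
    using not_less_Least[of j "\<lambda>k. k \<ge> 1 \<and> (p ^^ k) y = y"] that by (auto simp: k_def)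
  have nx: "(p ^^ j) y \<noteq> x" for j
  proof
    assume "(p ^^ j) y = x"
    then have "x \<in> class_of S (graph_on S p) y" using class_of_perm[OF assms(1,2,4)] by blast
    then show False using assms(5) eqc_sym[of y x] by (simp add: mem_class_of)
  qed
  have edge: "(z, ?q z) \<in> eqc (graph_on S ?q)" if "z \<in> S" for z using that by (auto intro!: eqc_edge)
  have "(x, (p ^^ Suc j) y) \<in> eqc (graph_on S ?q)" if "Suc j \<le> k" for j
    using that
  proof (induction j)
    case 0
    then show ?case using edge[OF assms(3)] by (cases "x = y") (auto simp: swap_at_def)
  next
    case (Suc j)
    then have "?q ((p ^^ Suc j) y) = (p ^^ Suc (Suc j)) y"
      using nx[of "Suc j"] least[of "Suc j"] by (simp add: swap_at_def)
    then have "((p ^^ Suc j) y, (p ^^ Suc (Suc j)) y) \<in> eqc (graph_on S ?q)"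
      using edge[OF funpow_mem[OF assms(2,4)], of "Suc j"] by simp
    moreover have "(x, (p ^^ Suc j) y) \<in> eqc (graph_on S ?q)" using Suc by simp
    ultimately show ?case by (rule eqc_trans[rotated])
  qed
  from this[of "k - 1"] show xy: "(x, y) \<in> eqc (graph_on S ?q)" using k by simp
  let ?r = "insert (x, y) (graph_on S p)"
  have xy': "(x, y) \<in> eqc ?r" by (simp add: eqc_edge)
  have edge': "(z, p z) \<in> eqc ?r" if "z \<in> S" for z using that by (auto intro!: eqc_edge)
  show "classes S (graph_on S ?q) = classes S ?r"
  proof (rule classes_eqI)
    fix a b assume "(a, b) \<in> graph_on S ?q"
    then have "a \<in> S" "b = ?q a" by auto
    moreover have "(x, p y) \<in> eqc ?r" "(y, p x) \<in> eqc ?r"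
      using eqc_trans[OF xy' edge'[OF assms(4)]] eqc_trans[OF eqc_sym[OF xy'] edge'[OF assms(3)]] .
    ultimately show "(a, b) \<in> eqc ?r"
      using edge'[of a] by (auto simp: swap_at_def split: if_splits)
  next
    fix a b assume "(a, b) \<in> ?r"
    then consider "a = x" "b = y" | "a \<in> S" "b = p a" by auto
    then show "(a, b) \<in> eqc (graph_on S ?q)"
    proof cases
      case 2
      have "?q y = p x" "?q x = p y" by (auto simp: swap_at_def)
      then have "(x, p x) \<in> eqc (graph_on S ?q)" "(y, p y) \<in> eqc (graph_on S ?q)"
        using eqc_trans[OF xy edge[OF assms(4)]] eqc_trans[OF eqc_sym[OF xy] edge[OF assms(3)]] by simp_all
      then show ?thesis using 2 edge[of a] by (cases "a = x \<or> a = y") (auto simp: swap_at_def)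
    qed (use xy in auto)
  qed
qed

lemma ncyc_swap_at_merge:
  assumes "finite S" "bij_betw p S S" "x \<in> S" "y \<in> S" "(x, y) \<notin> eqc (graph_on S p)"
  shows "ncyc S p = Suc (ncyc S (swap_at p x y))"
  using eqc_swap_at_merge(2)[OF assms] card_classes_insert[OF assms(3-5,1)] by simp

lemma not_eqc_swap_at_split:
  assumes "finite S" "bij_betw p S S" "x \<in> S" "y \<in> S" "x \<noteq> y" "(x, y) \<in> eqc (graph_on S p)"
  shows "(x, y) \<notin> eqc (graph_on S (swap_at p x y))"
proof
  let ?q = "swap_at p x y"
  assume xy: "(x, y) \<in> eqc (graph_on S ?q)"
  have "x \<in> class_of S (graph_on S p) y" using assms(3) eqc_sym[OF assms(6)] by (simp add: mem_class_of)
  then obtain k0 where k0: "x = (p ^^ k0) y" using class_of_perm[OF assms(1,2,4)] by blast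
  define k where "k = (LEAST k. (p ^^ k) y = x)"
  have k: "(p ^^ k) y = x" unfolding k_def using k0 by (intro LeastI) simp
  have least: "(p ^^ j) y \<noteq> x" if "j < k" for j using that not_less_Least by (auto simp: k_def)
  have "k \<noteq> 0" using k assms(5) by (metis funpow_0)
  \<comment> \<open>The stretch of the common cycle from \<open>p y\<close> up to \<open>x\<close>.
    The swapped permutation sends \<open>x\<close> back to \<open>p y\<close>, so the stretch is
    closed under it, and it misses \<open>y\<close>.\<close>
  define Z where "Z = {(p ^^ j) y |j. 1 \<le> j \<and> j \<le> k}"
  have "y \<notin> Z"
  proof
    assume "y \<in> Z"
    then obtain j where j: "1 \<le> j" "j \<le> k" "(p ^^ j) y = y" unfolding Z_def by force
    have "(p ^^ (k - j)) y = (p ^^ (k - j)) ((p ^^ j) y)" using j by simp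
    also have "\<dots> = (p ^^ (k - j + j)) y" by (simp only: funpow_add comp_apply)
    also have "\<dots> = x" using j k by simp
    finally show False using least[of "k - j"] j by auto
  qed
  moreover have "class_of S (graph_on S ?q) x \<subseteq> Z"
  proof (rule class_of_perm_subset[OF assms(1) bij_swap_at[OF assms(2-4)]])
    show "Z \<subseteq> S" using funpow_mem[OF assms(2,4)] by (auto simp: Z_def)
    show "x \<in> Z" using k \<open>k \<noteq> 0\<close> unfolding Z_def by force
    show "?q ` Z \<subseteq> Z"
    proof
      fix w assume "w \<in> ?q ` Z"
      then obtain j where j: "1 \<le> j" "j \<le> k" "w = ?q ((p ^^ j) y)" unfolding Z_def by blast
      show "w \<in> Z"
      proof (cases "j = k")
        case True
        then have "w = (p ^^ 1) y" using j k assms(5) by (simp add: swap_at_def)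
        then show ?thesis using \<open>k \<noteq> 0\<close> unfolding Z_def by (auto intro!: exI[of _ 1])
      next
        case False
        have "(p ^^ j) y \<noteq> y" using \<open>y \<notin> Z\<close> j unfolding Z_def by force
        then have "w = (p ^^ Suc j) y" using j False least[of j] by (simp add: swap_at_def)
        then show ?thesis using j False unfolding Z_def by (auto intro!: exI[of _ "Suc j"])
      qed
    qed
  qed
  ultimately show False using xy assms by (auto simp: mem_class_of)
qed

lemma ncyc_swap_at_split:
  assumes "finite S" "bij_betw p S S" "x \<in> S" "y \<in> S" "x \<noteq> y" "(x, y) \<in> eqc (graph_on S p)"
  shows "ncyc S (swap_at p x y) = Suc (ncyc S p)"
  using ncyc_swap_at_merge[OF assms(1) bij_swap_at[OF assms(2-4)] assms(3,4) not_eqc_swap_at_split[OF assms]]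
  by (simp add: swap_at_swap_at)

lemma ncyc_swap_at_le:
  assumes "finite S" "bij_betw p S S" "x \<in> S" "y \<in> S"
  shows "ncyc S p \<le> Suc (ncyc S (swap_at p x y))"
proof (cases "x = y")
  case False
  then show ?thesis using ncyc_swap_at_merge[OF assms] ncyc_swap_at_split[OF assms] by fastforce
qed (simp add: swap_at_def)

section \<open>The genus defect of a pair of permutations\<close>

text \<open>Twice the total genus of the combinatorial map with vertex permutation \<open>a\<close>, edge permutation \<open>b\<close> and
  face permutation \<open>a \<circ> b\<close>.\<close>

definition defect :: "'a set \<Rightarrow> ('a \<Rightarrow> 'a) \<Rightarrow> ('a \<Rightarrow> 'a) \<Rightarrow> int" where
  "defect S a b = 2 * int (card (classes S (graph_on S a \<union> graph_on S b))) + int (card S)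
     - int (ncyc S a) - int (ncyc S b) - int (ncyc S (\<lambda>x. a (b x)))"

lemma defect_cong:
  assumes "\<And>x. x \<in> S \<Longrightarrow> a x = a' x" "\<And>x. x \<in> S \<Longrightarrow> b x = b' x" "b ` S \<subseteq> S"
  shows "defect S a b = defect S a' b'"
proof -
  have "graph_on S a = graph_on S a'" "graph_on S b = graph_on S b'"
    "graph_on S (\<lambda>x. a (b x)) = graph_on S (\<lambda>x. a' (b' x))"
    by (rule graph_on_cong; use assms in auto)+
  then show ?thesis by (simp add: defect_def)
qed

text \<open>The swap adds one cycle of \<open>a\<close> and changes the number of cycles of the
  composite by one. If the component survives, the defect changes by at most -1 + 1. If it breaks,
  twice the component count grows by 2, but the composite must then gain a cycle too, so the defect
  is unchanged.\<close>

lemma swap_at_step: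
  assumes "finite S" "bij_betw a S S" "bij_betw b S S" "x \<in> S" "y \<in> S" "x \<noteq> y"
    "(x, y) \<in> eqc (graph_on S a)"
  defines "rel \<equiv> graph_on S a \<union> graph_on S b"
    and "rel' \<equiv> graph_on S (swap_at a x y) \<union> graph_on S b"
  shows "(x, y) \<in> eqc rel' \<Longrightarrow> classes S rel' = classes S rel"
    and "(x, y) \<notin> eqc rel' \<Longrightarrow> card (classes S rel') = Suc (card (classes S rel))"
    and "defect S (swap_at a x y) b \<le> defect S a b"
proof -
  let ?q = "swap_at a x y"
  have ed: "(z, a z) \<in> eqc (insert (x, y) rel')" if "z \<in> S" for z
  proof -
    have xy: "(x, y) \<in> eqc (insert (x, y) rel')" by (simp add: eqc_edge)
    have q: "(z, ?q z) \<in> eqc (insert (x, y) rel')" if "z \<in> S" for z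
      using that by (auto intro!: eqc_edge simp: rel'_def)
    have "?q y = a x" "?q x = a y" by (auto simp: swap_at_def)
    then have "(x, a x) \<in> eqc (insert (x, y) rel')" "(y, a y) \<in> eqc (insert (x, y) rel')"
      using eqc_trans[OF xy q[OF assms(5)]] eqc_trans[OF eqc_sym[OF xy] q[OF assms(4)]] by simp_all
    then show ?thesis using q[OF that] by (cases "z = x \<or> z = y") (auto simp: swap_at_def)
  qed
  have xya: "(x, y) \<in> eqc rel"
    using assms(7) by (rule eqc_subset) (auto simp: rel_def eqc_edge)
  have ed2: "(z, ?q z) \<in> eqc rel" if "z \<in> S" for z
  proof -
    have q: "(z, a z) \<in> eqc rel" if "z \<in> S" for z
      using that by (auto intro!: eqc_edge simp: rel_def)
    have "(x, a y) \<in> eqc rel" "(y, a x) \<in> eqc rel"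
      using eqc_trans[OF xya q[OF assms(5)]] eqc_trans[OF eqc_sym[OF xya] q[OF assms(4)]] .
    then show ?thesis using q[OF that] by (auto simp: swap_at_def)
  qed
  have eq: "classes S (insert (x, y) rel') = classes S rel"
  proof (rule classes_eqI)
    fix u v assume "(u, v) \<in> insert (x, y) rel'"
    then consider "u = x" "v = y" | "u \<in> S" "v = ?q u" | "u \<in> S" "v = b u" by (auto simp: rel'_def)
    then show "(u, v) \<in> eqc rel"
      by cases (use xya ed2 in \<open>auto simp: rel_def intro!: eqc_edge\<close>)
  next
    fix u v assume "(u, v) \<in> rel"
    then consider "u \<in> S" "v = a u" | "u \<in> S" "v = b u" by (auto simp: rel_def)
    then show "(u, v) \<in> eqc (insert (x, y) rel')"
      by cases (use ed in \<open>auto simp: rel'_def intro!: eqc_edge\<close>)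
  qed
  show 1: "classes S rel' = classes S rel" if "(x, y) \<in> eqc rel'"
    unfolding eq[symmetric] by (rule classes_eqI) (use that in \<open>auto simp: eqc_edge\<close>)
  show 2: "card (classes S rel') = Suc (card (classes S rel))" if "(x, y) \<notin> eqc rel'"
    using card_classes_insert[OF assms(4,5) that assms(1)] eq by simp
  obtain x' y' where xy': "x' \<in> S" "y' \<in> S" "b x' = x" "b y' = y"
    using assms(3-5) by (metis bij_betw_def imageE)
  define c where "c = (\<lambda>z. a (b z))"
  have bc: "bij_betw c S S" using bij_betw_trans[OF assms(3,2)] by (simp add: c_def comp_def)
  have inj: "inj_on b S" using assms(3) by (simp add: bij_betw_def)
  have cq: "graph_on S (\<lambda>z. ?q (b z)) = graph_on S (swap_at c x' y')"
    by (rule graph_on_cong) (use swap_at_comp[OF inj xy'(1,2)] xy'(3,4) in \<open>simp add: c_def\<close>)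
  have A: "ncyc S ?q = Suc (ncyc S a)" by (rule ncyc_swap_at_split) (use assms in auto)
  show "defect S ?q b \<le> defect S a b"
  proof (cases "(x, y) \<in> eqc rel'")
    case True
    have "ncyc S c \<le> Suc (ncyc S (swap_at c x' y'))"
      by (rule ncyc_swap_at_le) (use assms bc xy' in auto)
    then show ?thesis using 1[OF True] A unfolding defect_def cq rel_def rel'_def c_def by simp
  next
    case False
    \<comment> \<open>Cycles of the new composite stay inside components, and \<open>x'\<close>,
      \<open>y'\<close> now lie in different ones; so swapping back merges two cycles.\<close>
    have "(x', y') \<notin> eqc (graph_on S (swap_at c x' y'))"
    proof
      assume "(x', y') \<in> eqc (graph_on S (swap_at c x' y'))"
      then have "(x', y') \<in> eqc rel'"
        unfolding cq[symmetric]
      proof (rule eqc_subset)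
        fix u v assume "(u, v) \<in> graph_on S (\<lambda>z. ?q (b z))"
        then have "u \<in> S" "b u \<in> S" "v = ?q (b u)" using assms(3) bij_betwE by auto
        then have "(u, b u) \<in> eqc rel'" "(b u, v) \<in> eqc rel'"
          unfolding rel'_def by (auto intro!: eqc_edge)
        then show "(u, v) \<in> eqc rel'" by (rule eqc_trans)
      qed
      moreover have "(x', x) \<in> eqc rel'" "(y', y) \<in> eqc rel'"
        unfolding rel'_def using xy' by (auto intro!: eqc_edge)
      ultimately have "(x, y) \<in> eqc rel'"
        using eqc_trans[OF eqc_sym[of x' x rel'] eqc_trans] by metis
      then show False using False by simp
    qed
    then have "ncyc S (swap_at c x' y') = Suc (ncyc S c)"
      using ncyc_swap_at_merge[OF assms(1) bij_swap_at[OF bc xy'(1,2)] xy'(1,2)]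
      by (simp add: swap_at_swap_at)
    then show ?thesis using 2[OF False] A unfolding defect_def cq rel_def rel'_def c_def by simp
  qed
qed

text \<open>With \<open>a\<close> trivial, components, cycles of \<open>b\<close> and cycles of the
  composite are the same sets, and \<open>a\<close> has one cycle per point.\<close>

lemma defect_id:
  assumes "finite S" "\<And>x. x \<in> S \<Longrightarrow> a x = x" "b ` S \<subseteq> S"
  shows "defect S a b = 0"
proof -
  have "classes S (graph_on S a \<union> graph_on S b) = classes S (graph_on S b)"
    by (rule classes_eqI) (use assms in \<open>auto simp: eqc_edge\<close>)
  moreover have "graph_on S (\<lambda>x. a (b x)) = graph_on S b"
    by (rule graph_on_cong) (use assms in auto)
  moreover have "ncyc S a = card S"
  proof -
    have "class_of S (graph_on S a) x = {x}" if "x \<in> S" for x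
      using class_of_subset_closed[of x "{x}" "graph_on S a" S] class_of_self[OF that] assms by force
    then have "classes S (graph_on S a) = (\<lambda>x. {x}) ` S" by (auto simp: classes_def)
    then show ?thesis by (simp add: card_image)
  qed
  ultimately show ?thesis by (simp add: defect_def)
qed

text \<open>Splitting off fixed points one at a time never raises the defect and ends at the
  identity, where it is 0.\<close>

lemma defect_nonneg:
  assumes "finite S" "bij_betw a S S" "bij_betw b S S"
  shows "0 \<le> defect S a b"
  using assms(2)
proof (induction "card {z \<in> S. a z \<noteq> z}" arbitrary: a rule: less_induct)
  case less
  show ?case
  proof (cases "\<forall>z \<in> S. a z = z")
    case True
    then have "defect S a b = 0" using assms by (intro defect_id) (auto simp: bij_betw_def)
    then show ?thesis by simp
  next
    case False
    then obtain z where z: "z \<in> S" "a z \<noteq> z" by blast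
    let ?y = "a z"
    let ?q = "swap_at a z ?y"
    have y: "?y \<in> S" "a ?y \<noteq> ?y"
      using z less.prems bij_betwE apply blast
      using z less.prems bij_betwE bij_betw_imp_inj_on inj_on_eq_iff by metis
    have bq: "bij_betw ?q S S" using bij_swap_at[OF less.prems z(1) y(1)] .
    \<comment> \<open>The swap turns \<open>a z\<close> into a fixed point and moves no point that
      was fixed before.\<close>
    have "{w \<in> S. ?q w \<noteq> w} \<subset> {w \<in> S. a w \<noteq> w}"
      using z y by (auto simp: swap_at_def)
    then have "card {w \<in> S. ?q w \<noteq> w} < card {w \<in> S. a w \<noteq> w}"
      using assms(1) by (intro psubset_card_mono) auto
    from less.hyps[OF this bq] have "0 \<le> defect S ?q b" .
    also have "\<dots> \<le> defect S a b"
      by (rule swap_at_step(3)) (use assms less.prems z y in \<open>auto intro!: eqc_edge\<close>)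
    finally show ?thesis .
  qed
qed

text \<open>If \<open>swap_at\<close> splits both a vertex and a face, then Euler's formula forces it to split a component.\<close>

lemma swap_at_disconnects:
  assumes "finite S" "bij_betw a S S" "bij_betw b S S" "x \<in> S" "y \<in> S" "x \<noteq> y"
    and "(x, y) \<in> eqc (graph_on S a)" and "defect S a b = 0"
    and "x' \<in> S" "y' \<in> S" "b x' = x" "b y' = y" "(x', y') \<in> eqc (graph_on S (\<lambda>z. a (b z)))"
  shows "(x, y) \<notin> eqc (graph_on S (swap_at a x y) \<union> graph_on S b)"
proof
  let ?q = "swap_at a x y"
  define c where "c = (\<lambda>z. a (b z))"
  assume "(x, y) \<in> eqc (graph_on S ?q \<union> graph_on S b)"
  note K = swap_at_step(1)[OF assms(1-7) this]
  have bc: "bij_betw c S S" using bij_betw_trans[OF assms(3,2)] by (simp add: c_def comp_def)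
  have inj: "inj_on b S" using assms(3) by (simp add: bij_betw_def)
  have cq: "graph_on S (\<lambda>z. ?q (b z)) = graph_on S (swap_at c x' y')"
    by (rule graph_on_cong) (use swap_at_comp[OF inj assms(9,10)] assms(11,12) in \<open>simp add: c_def\<close>)
  have "ncyc S ?q = Suc (ncyc S a)" by (rule ncyc_swap_at_split) (use assms in auto)
  moreover have "ncyc S (swap_at c x' y') = Suc (ncyc S c)"
    by (rule ncyc_swap_at_split) (use assms bc in \<open>auto simp: c_def\<close>)
  \<comment> \<open>One more cycle of \<open>a\<close> and one more of the composite, with no new
    component to pay for them.\<close>
  ultimately have "defect S ?q b = defect S a b - 2"
    using K unfolding defect_def cq c_def by simp
  then show False using defect_nonneg[OF assms(1) bij_swap_at[OF assms(2,4,5)] assms(3)] assms(8) by simp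
qed

section \<open>Deleting a point from a permutation\<close>

definition bypass :: "'a \<Rightarrow> ('a \<Rightarrow> 'a) \<Rightarrow> 'a \<Rightarrow> 'a" where
  "bypass z p y = (if y = z then z else if p y = z then p z else p y)"

lemma bypass_eq_swap_at:
  assumes "bij_betw p S S" "w \<in> S" "p w = z" "w \<noteq> z" "y \<in> S"
  shows "bypass z p y = swap_at p w z y"
  using assms unfolding bypass_def swap_at_def bij_betw_def inj_on_def by auto

lemma bij_bypass:
  assumes "bij_betw p S S" "z \<in> S"
  shows "bij_betw (bypass z p) S S"
proof -
  obtain w where w: "w \<in> S" "p w = z" using assms by (metis bij_betw_def imageE)
  show ?thesis
  proof (cases "w = z")
    case True
    then have "bypass z p y = p y" if "y \<in> S" for y using w by (auto simp: bypass_def)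
    then show ?thesis using assms(1) bij_betw_cong by metis
  next
    case False
    then have "bij_betw (swap_at p w z) S S" using assms w by (intro bij_swap_at)
    then show ?thesis using bypass_eq_swap_at[OF assms(1) w False] bij_betw_cong by metis
  qed
qed

lemma defect_bypass_le:
  assumes "finite S" "bij_betw a S S" "bij_betw b S S" "z \<in> S"
  shows "defect S (bypass z a) b \<le> defect S a b"
proof -
  obtain w where w: "w \<in> S" "a w = z" using assms by (metis bij_betw_def imageE)
  have b: "b ` S \<subseteq> S" using assms by (simp add: bij_betw_def)
  show ?thesis
  proof (cases "w = z")
    case True
    then have "defect S (bypass z a) b = defect S a b" using w b
      by (intro defect_cong) (auto simp: bypass_def)
    then show ?thesis by simp
  next
    case False
    have "defect S (bypass z a) b = defect S (swap_at a w z) b"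
      by (rule defect_cong) (use b bypass_eq_swap_at[OF assms(2) w False] in auto)
    also have "\<dots> \<le> defect S a b"
      by (rule swap_at_step(3)) (use assms w False in \<open>auto intro!: eqc_edge\<close>)
    finally show ?thesis .
  qed
qed

lemma defect_split:
  assumes "finite A" "finite B" "A \<inter> B = {}"
    and "a ` A \<subseteq> A" "a ` B \<subseteq> B" "b ` A \<subseteq> A" "b ` B \<subseteq> B"
  shows "defect (A \<union> B) a b = defect A a b + defect B a b"
proof -
  have 1: "ncyc (A \<union> B) f = ncyc A f + ncyc B f" if "f ` A \<subseteq> A" "f ` B \<subseteq> B" for f
    unfolding image_Un by (rule card_classes_split) (use assms that in auto)
  have "card (classes (A \<union> B) ((graph_on A a \<union> graph_on A b) \<union> (graph_on B a \<union> graph_on B b)))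
    = card (classes A (graph_on A a \<union> graph_on A b)) + card (classes B (graph_on B a \<union> graph_on B b))"
    by (rule card_classes_split) (use assms in auto)
  moreover have "graph_on (A \<union> B) a \<union> graph_on (A \<union> B) b =
     (graph_on A a \<union> graph_on A b) \<union> (graph_on B a \<union> graph_on B b)" by auto
  moreover have "ncyc (A \<union> B) (\<lambda>x. a (b x)) = ncyc A (\<lambda>x. a (b x)) + ncyc B (\<lambda>x. a (b x))"
  proof (rule 1)
    show "(\<lambda>x. a (b x)) ` A \<subseteq> A" using assms(4,6) by auto
    show "(\<lambda>x. a (b x)) ` B \<subseteq> B" using assms(5,7) by auto
  qed
  ultimately show ?thesis
    using 1[of a] 1[of b] assms card_Un_disjoint[OF assms(1-3)] unfolding defect_def by simp
qed

text \<open>A cycle is lost only if \<open>z\<close> was one by itself; otherwise \<open>z\<close>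
  retracts onto its successor.\<close>

lemma ncyc_bypass:
  assumes "finite S" "bij_betw p S S" "z \<in> S"
  shows "ncyc S p = ncyc (S - {z}) (bypass z p) + (if p z = z then 1 else 0)"
proof (cases "p z = z")
  case True
  have inj: "inj_on p S" using assms(2) by (simp add: bij_betw_def)
  have *: "p y \<noteq> z" if "y \<in> S - {z}" for y using that inj_onD[OF inj, of y z] True assms(3) by auto
  then have sub: "p ` (S - {z}) \<subseteq> S - {z}" using assms(2) by (auto simp: bij_betw_def)
  have S: "(S - {z}) \<union> {z} = S" using assms by auto
  have "ncyc ((S - {z}) \<union> {z}) p = ncyc (S - {z}) p + ncyc {z} p"
    unfolding image_Un by (rule card_classes_split) (use assms sub True in auto)
  moreover have "graph_on (S - {z}) p = graph_on (S - {z}) (bypass z p)"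
    by (rule graph_on_cong) (use * in \<open>auto simp: bypass_def\<close>)
  ultimately show ?thesis using True unfolding S by (simp add: classes_def)
next
  case False
  let ?g = "\<lambda>y. if y = z then p z else y"
  have ed: "(y, p y) \<in> eqc (graph_on S p)" if "y \<in> S" for y using that by (auto intro!: eqc_edge)
  have "ncyc S p = ncyc (S - {z}) (bypass z p)"
  proof (rule card_classes_retract[where g = ?g])
    fix a b assume "(a, b) \<in> graph_on (S - {z}) (bypass z p)"
    then have "a \<in> S" "b = (if p a = z then p z else p a)" by (auto simp: bypass_def)
    then show "(a, b) \<in> eqc (graph_on S p)"
      using ed[of a] ed[of z] assms(3) eqc_trans[of a z "graph_on S p" "p z"] by (auto split: if_splits)
  next
    fix x assume "x \<in> S" then show "?g x \<in> S - {z} \<and> (x, ?g x) \<in> eqc (graph_on S p)"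
      using ed[of x] False bij_betwE[OF assms(2)] by auto
  next
    fix a b assume "(a, b) \<in> graph_on S p"
    then have ab: "a \<in> S" "b = p a" by auto
    show "(?g a, ?g b) \<in> eqc (graph_on (S - {z}) (bypass z p))"
    proof (cases "a = z")
      case False
      then have "?g b = bypass z p a" using ab by (auto simp: bypass_def)
      then show ?thesis using False ab by (auto intro!: eqc_edge)
    qed (use ab False in simp)
  qed auto
  then show ?thesis using False by simp
qed

section \<open>Two-coloured combinatorial maps\<close>

text \<open>The classes are closed curves that alternate between steps of \<open>t\<close> and of
  \<open>s\<close>. Removing \<open>x\<close> and \<open>t x\<close> and joining their
  \<open>s\<close>-partners shortens a curve; the only curve that vanishes is one made of this pair
  alone.\<close>

lemma contract_involutions:
  assumes "finite S"
    and t: "\<And>y. y \<in> S \<Longrightarrow> t y \<in> S" "\<And>y. y \<in> S \<Longrightarrow> t (t y) = y" "\<And>y. y \<in> S \<Longrightarrow> t y \<noteq> y"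
    and s: "\<And>y. y \<in> S \<Longrightarrow> s y \<in> S" "\<And>y. y \<in> S \<Longrightarrow> s (s y) = y" "\<And>y. y \<in> S \<Longrightarrow> s y \<noteq> y"
    and x: "x \<in> S"
    and s': "\<And>y. y \<in> S - {x, t x} \<Longrightarrow> s' y = (if s y = x \<or> s y = t x then s (t (s y)) else s y)"
  defines "S' \<equiv> S - {x, t x}"
  shows "card (classes S (graph_on S t \<union> graph_on S s)) =
     card (classes S' (graph_on S' t \<union> graph_on S' s')) + (if s x = t x then 1 else 0)"
proof -
  let ?r = "graph_on S t \<union> graph_on S s" and ?r' = "graph_on S' t \<union> graph_on S' s'"
  have et: "(y, t y) \<in> eqc ?r" if "y \<in> S" for y using that by (intro eqc_edge) auto
  have es: "(y, s y) \<in> eqc ?r" if "y \<in> S" for y using that by (intro eqc_edge) auto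
  have et': "(y, t y) \<in> eqc ?r'" if "y \<in> S'" for y using that by (intro eqc_edge) auto
  have es': "(y, s' y) \<in> eqc ?r'" if "y \<in> S'" for y using that by (intro eqc_edge) auto
  have S': "y \<in> S' \<longleftrightarrow> y \<in> S \<and> y \<noteq> x \<and> y \<noteq> t x" for y by (auto simp: S'_def)
  have sx: "s y = z \<longleftrightarrow> y = s z" if "y \<in> S" "z \<in> S" for y z using s that by metis
  have tx: "t y = z \<longleftrightarrow> y = t z" if "y \<in> S" "z \<in> S" for y z using t that by metis
  have tS': "t y \<in> S'" if "y \<in> S'" for y using that t x tx unfolding S' by metis
  show ?thesis
  proof (cases "s x = t x")
    case True
    have stx: "s (t x) = x" using True s(2)[OF x] by simp
    have sS': "s y \<in> S' \<and> s' y = s y" if "y \<in> S'" for y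
    proof -
      have "s y \<noteq> x" "s y \<noteq> t x" using that sx[of y x] sx[of y "t x"] x t(1)[OF x] True stx S' by auto
      then show ?thesis using s' that s(1) S' S'_def by auto
    qed
    have "card (classes (S' \<union> {x, t x}) (?r' \<union> (graph_on {x, t x} t \<union> graph_on {x, t x} s))) =
       card (classes S' ?r') + card (classes {x, t x} (graph_on {x, t x} t \<union> graph_on {x, t x} s))"
    proof (rule card_classes_split)
      show "?r' \<subseteq> S' \<times> S'" using tS' sS' by auto
      show "graph_on {x, t x} t \<union> graph_on {x, t x} s \<subseteq> {x, t x} \<times> {x, t x}"
        using t(2)[OF x] True stx by auto
    qed (use assms(1) in \<open>auto simp: S'_def\<close>)
    moreover have "S' \<union> {x, t x} = S" using x t(1)[OF x] by (auto simp: S'_def)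
    moreover have "?r' \<union> (graph_on {x, t x} t \<union> graph_on {x, t x} s) = ?r"
    proof -
      have "graph_on S' s' = graph_on S' s" using sS' by (intro graph_on_cong) simp
      moreover have gS: "graph_on S f = graph_on S' f \<union> graph_on {x, t x} f" for f
        unfolding image_Un[symmetric] \<open>S' \<union> {x, t x} = S\<close> ..
      ultimately show ?thesis unfolding gS[of t] gS[of s] by (simp only: Un_ac)
    qed
    moreover have "card (classes {x, t x} (graph_on {x, t x} t \<union> graph_on {x, t x} s)) = 1"
    proof -
      let ?c = "class_of {x, t x} (graph_on {x, t x} t \<union> graph_on {x, t x} s)"
      have "?c x = ?c (t x)" by (rule class_of_eqI) (auto intro!: eqc_edge)
      then show ?thesis by (simp add: classes_def)
    qed
    ultimately show ?thesis using True by simp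
  next
    case False
    have sxS: "s x \<in> S'" "s (t x) \<in> S'"
      using s x t(1)[OF x] False sx[of x x] sx[of "t x" x] unfolding S' by auto
    have "card (classes S ?r) = card (classes S' ?r')"
    proof (rule card_classes_retract[where g = "\<lambda>y. if y = x \<or> y = t x then s y else y"])
      show "S' \<subseteq> S" by (auto simp: S'_def)
    next
      fix a b assume "(a, b) \<in> ?r'"
      then consider "a \<in> S'" "b = t a" | "a \<in> S'" "b = s' a" by auto
      then show "(a, b) \<in> eqc ?r"
      proof cases
        case 2
        then have a: "a \<in> S" "s a \<in> S" "t (s a) \<in> S" using S' s(1) t(1) by auto
        have "(a, s (t (s a))) \<in> eqc ?r"
          using eqc_trans[OF es[OF a(1)] eqc_trans[OF et[OF a(2)] es[OF a(3)]]] .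
        then show ?thesis using 2 es[OF a(1)] s' S'_def by auto
      qed (use et S' in auto)
    next
      fix y assume "y \<in> S"
      then show "(if y = x \<or> y = t x then s y else y) \<in> S' \<and> (y, if y = x \<or> y = t x then s y else y) \<in> eqc ?r"
        using sxS es[of y] S' by auto
    next
      fix y assume "y \<in> S'"
      then show "(if y = x \<or> y = t x then s y else y) = y" using S' by auto
    next
      let ?g = "\<lambda>y. if y = x \<or> y = t x then s y else y"
      have ssx: "(s x, s (t x)) \<in> eqc ?r'"
      proof -
        have "s' (s x) = s (t x)" using s' sxS s(2)[OF x] unfolding S'_def by auto
        then show ?thesis using es'[OF sxS(1)] by simp
      qed
      fix a b assume "(a, b) \<in> ?r"
      then consider "a \<in> S" "b = t a" | "a \<in> S" "b = s a" by auto
      then show "(?g a, ?g b) \<in> eqc ?r'"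
      proof cases
        case 1
        show ?thesis
        proof (cases "a \<in> S'")
          case True
          then show ?thesis using et'[OF True] tS'[OF True] 1 S' by auto
        next
          case False
          then have "a = x \<and> b = t x \<or> a = t x \<and> b = x" using \<open>a \<in> S\<close> \<open>b = t a\<close> t(2)[OF x] S' by auto
          then show ?thesis using ssx eqc_sym[OF ssx] by auto
        qed
      next
        case 2
        show ?thesis
        proof (cases "a \<in> S'")
          case True
          then have a: "a \<in> S" "a \<noteq> x" "a \<noteq> t x" using S' by auto
          show ?thesis
          proof (cases "s a = x \<or> s a = t x")
            case True
            then show ?thesis using 2 a s(2)[OF a(1)] by auto
          next
            case False
            then show ?thesis using 2 a es'[OF True] s' S'_def by auto
          qed
        next
          case False
          then have "a = x \<or> a = t x" using 2 S' by auto
          then have "s a \<in> S'" using sxS by auto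
          then show ?thesis using \<open>a = x \<or> a = t x\<close> 2 S' by auto
        qed
      qed
    qed
    then show ?thesis using False by simp
  qed
qed

text \<open>For a colouring \<open>c\<close> that alternates along the cycles of \<open>N\<close> this is an involution pairing every dart
  with one of its two neighbours; in a diagram it is a smoothing of all crossings.\<close>

definition zigzag :: "'a set \<Rightarrow> ('a \<Rightarrow> 'a) \<Rightarrow> ('a \<Rightarrow> bool) \<Rightarrow> 'a \<Rightarrow> 'a" where
  "zigzag S N c x = (if c x then N x else inv_into S N x)"

text \<open>Counts the closed curves that alternate between edges and a smoothing. For a diagram,
  the colouring \<open>over\<close> gives the B-state curves and its negation the A-state curves,
  apart from crossingless circles.\<close>

definition nstates :: "'a set \<Rightarrow> ('a \<Rightarrow> 'a) \<Rightarrow> ('a \<Rightarrow> 'a) \<Rightarrow> ('a \<Rightarrow> bool) \<Rightarrow> nat" where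
  "nstates S N \<tau> c = card (classes S (graph_on S \<tau> \<union> graph_on S (zigzag S N c)))"

text \<open>Twice the Turaev genus, by Euler's formula.\<close>

definition state_defect :: "'a set \<Rightarrow> ('a \<Rightarrow> 'a) \<Rightarrow> ('a \<Rightarrow> 'a) \<Rightarrow> ('a \<Rightarrow> bool) \<Rightarrow> int" where
  "state_defect S N \<tau> c = int (ncyc S (\<lambda>x. N (\<tau> x)))
     - int (nstates S N \<tau> (\<lambda>x. \<not> c x)) - int (nstates S N \<tau> c)"

text \<open>The common form of a diagram, with \<open>next_ccw\<close> as rotation and
  \<open>over\<close> as colour, and of the map on its marked points. Colours alternate around every
  vertex; an edge is alternating if they also change along it.\<close>

locale colored_map =
  fixes S :: "'a set" and N \<tau> :: "'a \<Rightarrow> 'a" and col :: "'a \<Rightarrow> bool"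
  assumes finite_S: "finite S"
    and bij_N: "bij_betw N S S"
    and tau_mem [simp]: "x \<in> S \<Longrightarrow> \<tau> x \<in> S"
    and tau_tau [simp]: "x \<in> S \<Longrightarrow> \<tau> (\<tau> x) = x"
    and tau_neq [simp]: "x \<in> S \<Longrightarrow> \<tau> x \<noteq> x"
    and col_N [simp]: "x \<in> S \<Longrightarrow> col (N x) = (\<not> col x)"
begin

abbreviation Ninv :: "'a \<Rightarrow> 'a" where "Ninv \<equiv> inv_into S N"

lemma N_mem [simp]: "x \<in> S \<Longrightarrow> N x \<in> S"
  using bij_N by (rule bij_betw_apply)

lemma Ninv_mem [simp]: "x \<in> S \<Longrightarrow> Ninv x \<in> S"
  using bij_betw_inv_into[OF bij_N] by (rule bij_betw_apply)

lemma N_Ninv [simp]: "x \<in> S \<Longrightarrow> N (Ninv x) = x"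
  using bij_N by (rule bij_betw_inv_into_right)

lemma Ninv_N [simp]: "x \<in> S \<Longrightarrow> Ninv (N x) = x"
  using bij_N by (rule bij_betw_inv_into_left)

lemma col_Ninv [simp]: "x \<in> S \<Longrightarrow> col (Ninv x) = (\<not> col x)"
  using col_N[of "Ninv x"] by simp

lemma N_eq_iff: "x \<in> S \<Longrightarrow> y \<in> S \<Longrightarrow> N x = N y \<longleftrightarrow> x = y"
  by (metis Ninv_N)

lemma tau_eq_iff: "x \<in> S \<Longrightarrow> y \<in> S \<Longrightarrow> \<tau> x = \<tau> y \<longleftrightarrow> x = y"
  by (metis tau_tau)

lemma bij_tau: "bij_betw \<tau> S S"
  by (rule bij_betw_byWitness[where f' = \<tau>]) auto

lemma bij_face: "bij_betw (\<lambda>x. N (\<tau> x)) S S"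
  using bij_betw_trans[OF bij_tau bij_N] by (simp add: comp_def)

lemma zigzag_mem [simp]: "x \<in> S \<Longrightarrow> zigzag S N c x \<in> S"
  by (simp add: zigzag_def)

lemma zigzag_zigzag [simp]: "x \<in> S \<Longrightarrow> zigzag S N col (zigzag S N col x) = x"
  by (simp add: zigzag_def)

lemma col_zigzag [simp]: "x \<in> S \<Longrightarrow> col (zigzag S N col x) = (\<not> col x)"
  by (simp add: zigzag_def)

lemma zigzag_neq: "x \<in> S \<Longrightarrow> zigzag S N col x \<noteq> x"
  using col_zigzag by metis

text \<open>Exchanges the two kinds of state curves, so that each bound has to be proved for one
  kind only.\<close>

lemma negate: "colored_map S N \<tau> (\<lambda>x. \<not> col x)"
  by unfold_locales (auto simp: finite_S bij_N)

end

text \<open>The rotation after contracting the edge of \<open>x\<close>: on meeting one end of the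
  edge it jumps across and goes on at the other end. Along an alternating edge the jump changes the
  colour, which offsets the extra step, and colours still alternate.\<close>

definition contract_map :: "('a \<Rightarrow> 'a) \<Rightarrow> ('a \<Rightarrow> 'a) \<Rightarrow> 'a \<Rightarrow> 'a \<Rightarrow> 'a" where
  "contract_map N \<tau> x y = (if N y = x \<or> N y = \<tau> x then N (\<tau> (N y)) else N y)"

locale contractible = colored_map +
  fixes x
  assumes x: "x \<in> S" and alt: "col (\<tau> x) \<noteq> col x"
begin

abbreviation "S' \<equiv> S - {x, \<tau> x}"
abbreviation "N' \<equiv> contract_map N \<tau> x"

lemma tau_S' [simp]: "y \<in> S' \<Longrightarrow> \<tau> y \<in> S'"
  using x tau_eq_iff[of y x] tau_eq_iff[of y "\<tau> x"] by auto

text \<open>Together with the injectivity of \<open>N\<close> this shows that a single jump across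
  the edge always suffices.\<close>

lemma N_tau_ne: "N x \<noteq> x" "N (\<tau> x) \<noteq> \<tau> x"
  using col_N[OF x] col_N[OF tau_mem[OF x]] by auto

lemma N'_mem: "y \<in> S' \<Longrightarrow> N' y \<in> S'"
  using x N_eq_iff[of y x] N_eq_iff[of y "\<tau> x"] N_tau_ne unfolding contract_map_def by auto

lemma col_N': "y \<in> S' \<Longrightarrow> col (N' y) = (\<not> col y)"
  using x alt unfolding contract_map_def by (auto dest: sym)

lemma inj_N': "inj_on N' S'"
proof (rule inj_onI)
  fix y z assume yz: "y \<in> S'" "z \<in> S'" and eq: "N' y = N' z"
  \<comment> \<open>The dart to which \<open>N\<close> is finally applied.\<close>
  define w where "w y = (if N y = x \<or> N y = \<tau> x then \<tau> (N y) else y)" for y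
  have w: "N' u = N (w u)" "w u \<in> S" "w u \<in> {x, \<tau> x} \<longleftrightarrow> N u \<in> {x, \<tau> x}" if "u \<in> S'" for u
    using that x by (auto simp: w_def contract_map_def)
  have "w y = w z" using eq w(1,2) yz N_eq_iff by simp
  moreover from this have "N y \<in> {x, \<tau> x} \<longleftrightarrow> N z \<in> {x, \<tau> x}" using w(3) yz by metis
  ultimately have "y = z \<or> \<tau> (N y) = \<tau> (N z)" by (auto simp: w_def split: if_splits)
  then show "y = z" using yz tau_eq_iff[of "N y" "N z"] N_eq_iff[of y z] by auto
qed

lemma bij_N': "bij_betw N' S' S'"
  unfolding bij_betw_def using inj_N' N'_mem finite_S
  by (meson endo_inj_surj finite_Diff image_subsetI)

lemma contracted: "colored_map S' N' \<tau> col"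
  by unfold_locales (use finite_S bij_N' col_N' tau_S' in auto)

lemma inv_N':
  assumes "y \<in> S'"
  shows "inv_into S' N' y = (if Ninv y = x \<or> Ninv y = \<tau> x then Ninv (\<tau> (Ninv y)) else Ninv y)"
    (is "_ = ?z")
proof -
  have y: "y \<in> S" "y \<noteq> x" "y \<noteq> \<tau> x" using assms by auto
  have skip: "Ninv (\<tau> u) \<in> S' \<and> N' (Ninv (\<tau> u)) = y" if "Ninv y = u" "u = x \<or> u = \<tau> x" for u
  proof -
    have u: "u \<in> S" "\<tau> u = x \<or> \<tau> u = \<tau> x" "N u = y" using that x y N_Ninv[OF y(1)] by auto
    have N: "N (Ninv (\<tau> u)) = \<tau> u" using u by simp
    have "Ninv (\<tau> u) \<noteq> u" using N u(2,3) y by auto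
    moreover have "Ninv (\<tau> u) \<noteq> \<tau> u" using N u(1) col_N[OF tau_mem[OF u(1)]] by metis
    moreover have "{x, \<tau> x} = {u, \<tau> u}" using that(2) x by auto
    ultimately have "Ninv (\<tau> u) \<noteq> x" "Ninv (\<tau> u) \<noteq> \<tau> x" by blast+
    then show ?thesis using N u by (auto simp: contract_map_def)
  qed
  have "?z \<in> S' \<and> N' ?z = y"
  proof (cases "Ninv y = x \<or> Ninv y = \<tau> x")
    case True
    then show ?thesis using skip[OF refl] by simp
  next
    case False
    then show ?thesis using y by (simp add: contract_map_def)
  qed
  moreover have "inv_into S' N' y = z" if "z \<in> S' \<and> N' z = y" for z
    using inv_into_f_f[OF inj_N', of z] that by simp
  ultimately show ?thesis by blast
qed

text \<open>The two ends of the edge have opposite colours, so after the jump the zigzag continues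
  in the same direction of rotation. This is the reconnection required by
  \<open>contract_involutions\<close>.\<close>

lemma zigzag_contract:
  assumes "y \<in> S'"
  shows "zigzag S' N' col y = (if zigzag S N col y = x \<or> zigzag S N col y = \<tau> x
     then zigzag S N col (\<tau> (zigzag S N col y)) else zigzag S N col y)"
proof (cases "col y")
  case True
  have "col (\<tau> (N y))" if "N y = x \<or> N y = \<tau> x"
    using that True assms alt x by (metis DiffE col_N tau_tau)
  then show ?thesis using True by (auto simp: zigzag_def contract_map_def)
next
  case False
  have "\<not> col (\<tau> (Ninv y))" if "Ninv y = x \<or> Ninv y = \<tau> x"
    using that False assms alt x by (metis DiffE col_Ninv tau_tau)
  then show ?thesis using False by (auto simp: zigzag_def inv_N'[OF assms])
qed

lemma nstates_contract:
  "nstates S N \<tau> col = nstates S' N' \<tau> col + (if zigzag S N col x = \<tau> x then 1 else 0)"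
  unfolding nstates_def
  by (rule contract_involutions) (use finite_S x zigzag_contract zigzag_neq in auto)

lemma negate_contractible: "contractible S N \<tau> (\<lambda>x. \<not> col x) x"
  using negate x alt unfolding contractible_def contractible_axioms_def by simp

text \<open>The face boundaries only lose the two sides \<open>x\<close> and \<open>\<tau> x\<close>
  of the contracted edge.\<close>

lemma bypass_face:
  assumes "y \<in> S'"
  shows "bypass (\<tau> x) (bypass x (\<lambda>x. N (\<tau> x))) y = N' (\<tau> y)"
proof -
  have "N (\<tau> x) \<noteq> \<tau> x" "N (\<tau> (\<tau> x)) \<noteq> x" using N_tau_ne x by auto
  then show ?thesis using assms x by (auto simp: bypass_def contract_map_def)
qed

text \<open>A face disappears exactly if it is a monogon bounded by one side of the edge. The two
  sides cannot form a face together, because \<open>N (\<tau> x) = \<tau> x\<close> is excluded by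
  the colours.\<close>

lemma face_contract: "ncyc S (\<lambda>x. N (\<tau> x)) = ncyc S' (\<lambda>x. N' (\<tau> x))
    + (if N (\<tau> x) = x then 1 else 0) + (if N x = \<tau> x then 1 else 0)"
proof -
  let ?f = "\<lambda>x. N (\<tau> x)"
  let ?g = "bypass x ?f"
  have bg: "bij_betw ?g S S" by (rule bij_bypass[OF bij_face x])
  have gx: "?g x = x" by (simp add: bypass_def)
  have "bij_betw ?g (S - {x}) (S - {x})"
    using bij_betw_DiffI[OF bg, of "{x}" "{x}"] gx x by simp
  then have "ncyc (S - {x}) ?g = ncyc (S - {x} - {\<tau> x}) (bypass (\<tau> x) ?g) + (if ?g (\<tau> x) = \<tau> x then 1 else 0)"
    by (rule ncyc_bypass[rotated]) (use finite_S x in auto)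
  moreover have "ncyc S ?f = ncyc (S - {x}) ?g + (if ?f x = x then 1 else 0)"
    by (rule ncyc_bypass[OF finite_S bij_face x])
  moreover have "S - {x} - {\<tau> x} = S'" by auto
  moreover have "graph_on S' (bypass (\<tau> x) ?g) = graph_on S' (\<lambda>x. N' (\<tau> x))"
    by (rule graph_on_cong) (rule bypass_face)
  moreover have "?g (\<tau> x) = \<tau> x \<longleftrightarrow> N x = \<tau> x"
    using x N_tau_ne by (auto simp: bypass_def)
  ultimately show ?thesis by simp
qed

text \<open>Each monogon that is lost is also a lost state curve: its corner,
  \<open>N (\<tau> x) = x\<close> or \<open>N x = \<tau> x\<close>, is used by exactly one of the
  two smoothings. So both counts drop together.\<close>

lemma state_defect_contract: "state_defect S N \<tau> col = state_defect S' N' \<tau> col"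
proof -
  interpret neg: contractible S N \<tau> "\<lambda>x. \<not> col x" x by (rule negate_contractible)
  have "Ninv x = \<tau> x \<longleftrightarrow> N (\<tau> x) = x" using x N_Ninv Ninv_N tau_mem by metis
  then show ?thesis
    using face_contract nstates_contract neg.nstates_contract
    unfolding state_defect_def by (auto simp: zigzag_def)
qed

text \<open>The defect is taken with the face permutation in first place because contraction acts
  there by cutting out points, which never raises it. The points \<open>x\<close> and
  \<open>\<tau> x\<close>, fixed by then, split off with defect 0.\<close>

lemma defect_contract: "defect S' (\<lambda>x. N' (\<tau> x)) \<tau> \<le> defect S (\<lambda>x. N (\<tau> x)) \<tau>"
proof -
  let ?f = "\<lambda>x. N (\<tau> x)"
  let ?g = "bypass x ?f"
  let ?h = "bypass (\<tau> x) ?g"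
  have bg: "bij_betw ?g S S" by (rule bij_bypass[OF bij_face x])
  have hx: "?h x = x" "?h (\<tau> x) = \<tau> x" using x tau_neq[OF x] by (auto simp: bypass_def)
  have hS': "?h y \<in> S'" if "y \<in> S'" for y
    using N'_mem[OF tau_S'[OF that]] bypass_face[OF that] by simp
  have "defect S' (\<lambda>x. N' (\<tau> x)) \<tau> = defect S' ?h \<tau>"
    by (rule defect_cong) (use tau_S' in \<open>auto simp: bypass_face\<close>)
  moreover have "defect {x, \<tau> x} ?h \<tau> = 0"
    by (rule defect_id) (use x hx in auto)
  moreover have "defect (S' \<union> {x, \<tau> x}) ?h \<tau> = defect S' ?h \<tau> + defect {x, \<tau> x} ?h \<tau>"
    by (rule defect_split) (use x finite_S hS' tau_S' hx in auto)
  moreover have "S' \<union> {x, \<tau> x} = S" using x by auto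
  moreover have "defect S ?h \<tau> \<le> defect S ?g \<tau>"
    by (rule defect_bypass_le) (use finite_S bg bij_tau x in auto)
  moreover have "defect S ?g \<tau> \<le> defect S ?f \<tau>"
    by (rule defect_bypass_le) (use finite_S bij_face bij_tau x in auto)
  ultimately show ?thesis by simp
qed

end

text \<open>The first point of \<open>M\<close> met after at least one application of
  \<open>f\<close>. The inductive form fits contraction, which fuses steps of the walk.\<close>

inductive first_return :: "('a \<Rightarrow> 'a) \<Rightarrow> 'a set \<Rightarrow> 'a \<Rightarrow> 'a \<Rightarrow> bool" for f M where
  stop: "f d \<in> M \<Longrightarrow> first_return f M d (f d)"
| go: "f d \<notin> M \<Longrightarrow> first_return f M (f d) d' \<Longrightarrow> first_return f M d d'"

text \<open>One step of the contracted face walk is one step or two of the original walk, and the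
  skipped dart is an end of the contracted edge, outside \<open>M\<close>.\<close>

lemma (in contractible) first_return_contract:
  assumes "first_return (\<lambda>x. N' (\<tau> x)) M d d'" "d \<in> S'" "M \<subseteq> S'"
  shows "first_return (\<lambda>x. N (\<tau> x)) M d d'"
proof -
  have step: "N' (\<tau> y) = N (\<tau> y) \<or> N (\<tau> y) \<notin> M \<and> N' (\<tau> y) = N (\<tau> (N (\<tau> y)))" for y
    using assms(3) by (auto simp: contract_map_def)
  show ?thesis
    using assms(1)
  proof induction
    case (stop d)
    then show ?case using step[of d] first_return.intros[of "\<lambda>x. N (\<tau> x)"] by metis
  next
    case (go d d')
    then show ?case using step[of d] first_return.intros[of "\<lambda>x. N (\<tau> x)"] by metis
  qed
qed

text \<open>Alternating edges are contracted one at a time. \<tau> and the colours never change, so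
  the non-alternating darts \<open>M\<close> are the same throughout. The first-return clause is
  what identifies \<sigma> with the arcs of a diagram.\<close>

lemma contract_alternating:
  assumes "colored_map S N \<tau> col"
  defines "M \<equiv> {x \<in> S. col (\<tau> x) = col x}"
  shows "\<exists>\<sigma>. colored_map M \<sigma> \<tau> col \<and> defect M (\<lambda>x. \<sigma> (\<tau> x)) \<tau> \<le> defect S (\<lambda>x. N (\<tau> x)) \<tau> \<and>
    state_defect M \<sigma> \<tau> col = state_defect S N \<tau> col \<and>
    (\<forall>d \<in> M. first_return (\<lambda>x. N (\<tau> x)) M d (\<sigma> (\<tau> d)))"
  unfolding M_def using assms(1)
proof (induction "card S" arbitrary: S N rule: less_induct)
  case (less S N)
  let ?M = "{x \<in> S. col (\<tau> x) = col x}"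
  interpret colored_map S N \<tau> col by (rule less.prems)
  show ?case
  proof (cases "?M = S")
    case True
    have "\<forall>d \<in> S. first_return (\<lambda>x. N (\<tau> x)) S d (N (\<tau> d))"
      using first_return.stop[of "\<lambda>x. N (\<tau> x)"] by simp
    then show ?thesis using less.prems True by auto
  next
    case False
    then obtain x where x0: "x \<in> S" "col (\<tau> x) \<noteq> col x" by blast
    interpret contractible S N \<tau> col x by unfold_locales (use x0 in auto)
    have M: "{y \<in> S'. col (\<tau> y) = col y} = ?M" using x0 by auto
    have "card S' < card S" using x0(1) finite_S by (intro psubset_card_mono) auto
    from less.hyps[OF this contracted, unfolded M] obtain \<sigma> where \<sigma>: "colored_map ?M \<sigma> \<tau> col"
      "defect ?M (\<lambda>x. \<sigma> (\<tau> x)) \<tau> \<le> defect S' (\<lambda>x. N' (\<tau> x)) \<tau>"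
      "state_defect ?M \<sigma> \<tau> col = state_defect S' N' \<tau> col"
      "\<forall>d \<in> ?M. first_return (\<lambda>x. N' (\<tau> x)) ?M d (\<sigma> (\<tau> d))"
      by blast
    have "?M \<subseteq> S'" using x0 by auto
    then have "\<forall>d \<in> ?M. first_return (\<lambda>x. N (\<tau> x)) ?M d (\<sigma> (\<tau> d))"
      using \<sigma>(4) first_return_contract[of ?M] by blast
    then show ?thesis
      using \<sigma> defect_contract state_defect_contract by (intro exI[of _ \<sigma>]) auto
  qed
qed

section \<open>From link diagrams to maps on the marked points\<close>

context colored_map
begin

lemma class_tau: "x \<in> S \<Longrightarrow> class_of S (graph_on S \<tau>) x = {x, \<tau> x}"
proof
  assume x: "x \<in> S"
  show "class_of S (graph_on S \<tau>) x \<subseteq> {x, \<tau> x}"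
    by (rule class_of_perm_subset[OF finite_S bij_tau]) (use x in auto)
  show "{x, \<tau> x} \<subseteq> class_of S (graph_on S \<tau>) x"
    using x by (auto simp: mem_class_of intro!: eqc_edge)
qed

lemma ncyc_tau: "2 * ncyc S \<tau> = card S"
proof -
  have "card C = 2" if "C \<in> classes S (graph_on S \<tau>)" for C
  proof -
    have "\<exists>x \<in> S. C = {x, \<tau> x}" using that
    proof (rule classesE)
      fix x assume "x \<in> S" "C = class_of S (graph_on S \<tau>) x"
      then show ?thesis using class_tau by blast
    qed
    then obtain x where "x \<in> S" "C = {x, \<tau> x}" by blast
    then show ?thesis using tau_neq[of x] by (metis card_2_iff)
  qed
  then show ?thesis
    using card_classes_le[OF finite_S, of "graph_on S \<tau>" 2] card_classes_ge[OF finite_S, of "graph_on S \<tau>" 2]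
    by simp
qed

lemma face_faces: "graph_on S (\<lambda>x. N (\<tau> (\<tau> x))) = graph_on S N"
  by (rule graph_on_cong) simp

lemma classes_face_tau: "classes S (graph_on S (\<lambda>x. N (\<tau> x)) \<union> graph_on S \<tau>)
    = classes S (graph_on S N \<union> graph_on S \<tau>)" (is "classes S ?r = classes S ?r'")
proof (rule classes_eqI)
  have t: "(x, \<tau> x) \<in> eqc ?r" "(x, \<tau> x) \<in> eqc ?r'" if "x \<in> S" for x
    using that by (auto intro!: eqc_edge)
  have n: "(x, N (\<tau> x)) \<in> eqc ?r" "(x, N x) \<in> eqc ?r'" if "x \<in> S" for x
    using that by (auto intro!: eqc_edge)
  {
    fix a b assume "(a, b) \<in> ?r"
    then consider "a \<in> S" "b = N (\<tau> a)" | "a \<in> S" "b = \<tau> a" by auto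
    then show "(a, b) \<in> eqc ?r'"
      by cases (use t eqc_trans[OF t(2) n(2)] in auto)
  next
    fix a b assume "(a, b) \<in> ?r'"
    then consider "a \<in> S" "b = N a" | "a \<in> S" "b = \<tau> a" by auto
    then show "(a, b) \<in> eqc ?r"
      by cases (use t eqc_trans[OF t(1) n(1), of a] in auto)
  }
qed

lemma defect_map: "2 * defect S (\<lambda>x. N (\<tau> x)) \<tau> =
    4 * int (card (classes S (graph_on S N \<union> graph_on S \<tau>))) + int (card S)
    - 2 * int (ncyc S N) - 2 * int (ncyc S (\<lambda>x. N (\<tau> x)))"
  unfolding defect_def classes_face_tau face_faces using ncyc_tau by simp

end

lemma first_return_funpow:
  assumes "first_return f M d d'"
  shows "\<exists>n \<ge> 1. d' = (f ^^ n) d \<and> (\<forall>m. 1 \<le> m \<and> m < n \<longrightarrow> (f ^^ m) d \<notin> M)"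
  using assms
proof induction
  case (stop d)
  then show ?case by (intro exI[of _ 1]) auto
next
  case (go d d')
  then obtain n where n: "n \<ge> 1" "d' = (f ^^ n) (f d)"
    "\<And>m. 1 \<le> m \<Longrightarrow> m < n \<Longrightarrow> (f ^^ m) (f d) \<notin> M" by blast
  have "(f ^^ m) d \<notin> M" if "1 \<le> m" "m < Suc n" for m
  proof (cases "m = 1")
    case False
    then have "m = Suc (m - 1)" "1 \<le> m - 1" "m - 1 < n" using that by auto
    then obtain k where "m = Suc k" "1 \<le> k" "k < n" by metis
    then show ?thesis using n(3)[of k] by (simp add: funpow_swap1)
  qed (use go in simp)
  then show ?case using n(2) by (intro exI[of _ "Suc n"]) (auto simp: funpow_swap1)
qed

section \<open>Darts, crossings and faces of a diagram\<close>

lemma mem_darts: "d \<in> darts D \<longleftrightarrow> fst d \<in> crossings D \<and> snd d < 4"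
  by (cases d) (simp add: darts_def)

lemma four_cases: "(n::nat) < 4 \<Longrightarrow> n = 0 \<or> n = 1 \<or> n = 2 \<or> n = 3"
  by linarith

lemma bij_next_ccw: "bij_betw next_ccw (darts D) (darts D)"
proof (rule bij_betw_byWitness[where f' = "\<lambda>d. (fst d, (snd d + 3) mod 4)"])
  show "\<forall>d \<in> darts D. (fst (next_ccw d), (snd (next_ccw d) + 3) mod 4) = d"
    by (auto simp: mem_darts next_ccw_def dest!: four_cases)
  show "\<forall>d \<in> darts D. next_ccw (fst d, (snd d + 3) mod 4) = d"
    by (auto simp: mem_darts next_ccw_def dest!: four_cases)
qed (auto simp: mem_darts next_ccw_def)

lemma over_next_ccw: "d \<in> darts D \<Longrightarrow> over (next_ccw d) = (\<not> over d)"
  by (auto simp: mem_darts next_ccw_def over_def dest!: four_cases)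

lemma finite_darts: "finite (crossings D) \<Longrightarrow> finite (darts D)"
  by (simp add: darts_def)

locale diagram =
  fixes D :: "'c diagram"
  assumes D: "link_diagram D"

sublocale diagram \<subseteq> colored_map "darts D" next_ccw "glue D" over
proof
  show "finite (darts D)" using D by (simp add: link_diagram_def finite_darts)
qed (use D in \<open>simp_all add: link_diagram_def bij_next_ccw over_next_ccw\<close>)

context diagram
begin

lemma class_next_ccw:
  assumes "d \<in> darts D"
  shows "class_of (darts D) (graph_on (darts D) next_ccw) d = {fst d} \<times> {..<4}"
proof
  show "class_of (darts D) (graph_on (darts D) next_ccw) d \<subseteq> {fst d} \<times> {..<4}"
    by (rule class_of_perm_subset[OF finite_S bij_N]) (use assms in \<open>auto simp: mem_darts next_ccw_def mem_Times_iff\<close>)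
  let ?x = "fst d"
  let ?r = "graph_on (darts D) next_ccw"
  have e: "((?x, j), (?x, Suc j mod 4)) \<in> eqc ?r" if "j < 4" for j
  proof -
    have "(?x, j) \<in> darts D" using assms that by (simp add: mem_darts)
    then have "((?x, j), next_ccw (?x, j)) \<in> eqc ?r" by (intro eqc_edge) simp
    then show ?thesis by (simp add: next_ccw_def)
  qed
  have 1: "((?x, 0), (?x, 1)) \<in> eqc ?r" using e[of 0] by simp
  have 2: "((?x, 0), (?x, 2)) \<in> eqc ?r" using eqc_trans[OF 1 e[of 1]] by (simp add: numeral_2_eq_2)
  have 3: "((?x, 0), (?x, 3)) \<in> eqc ?r" using eqc_trans[OF 2 e[of 2]] by simp
  have 0: "((?x, 0), (?x, j)) \<in> eqc ?r" if "j < 4" for j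
    using four_cases[OF that] 1 2 3 by auto
  have "(d, (?x, j)) \<in> eqc ?r" if "j < 4" for j
    using eqc_trans[OF eqc_sym[OF 0[of "snd d"]] 0[OF that]] assms by (simp add: mem_darts)
  then show "{?x} \<times> {..<4} \<subseteq> class_of (darts D) ?r d"
    using assms by (auto simp: mem_class_of mem_darts)
qed

lemma ncyc_next_ccw: "ncyc (darts D) next_ccw = card (crossings D)"
proof -
  have "card C = 4" if "C \<in> classes (darts D) (graph_on (darts D) next_ccw)" for C
    using that by (rule classesE) (simp add: class_next_ccw)
  moreover have "card (darts D) = 4 * card (crossings D)" by (simp add: darts_def card_cartesian_product)
  ultimately show ?thesis
    using card_classes_le[OF finite_S, of "graph_on (darts D) next_ccw" 4]
      card_classes_ge[OF finite_S, of "graph_on (darts D) next_ccw" 4] by simp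
qed

lemma crossing_component_closed:
  assumes "C \<in> crossing_components D"
  shows "C \<subseteq> darts D" and "d \<in> darts D \<Longrightarrow> glue D d \<in> C \<longleftrightarrow> d \<in> C"
    and "d \<in> darts D \<Longrightarrow> next_ccw d \<in> C \<longleftrightarrow> d \<in> C"
proof -
  let ?r = "graph_on (darts D) (glue D) \<union> graph_on (darts D) next_ccw"
  have C: "C \<in> classes (darts D) ?r" using assms by (simp add: crossing_components_def)
  then show "C \<subseteq> darts D" by (rule classes_subset)
  from C obtain x where x: "x \<in> darts D" "C = class_of (darts D) ?r x" by (rule classesE)
  have "y \<in> C \<longleftrightarrow> z \<in> C" if "y \<in> darts D" "z \<in> darts D" "(y, z) \<in> eqc ?r" for y z
    using that eqc_trans[OF _ that(3)] eqc_trans[OF _ eqc_sym[OF that(3)]] unfolding x(2) mem_class_of by blast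
  from this[of d "glue D d"] this[of d "next_ccw d"]
  show "d \<in> darts D \<Longrightarrow> glue D d \<in> C \<longleftrightarrow> d \<in> C" "d \<in> darts D \<Longrightarrow> next_ccw d \<in> C \<longleftrightarrow> d \<in> C"
    by (simp_all add: eqc_edge)
qed

lemma card_crossings_component:
  assumes "C \<in> crossing_components D"
  shows "4 * card (fst ` C) = card C" and "2 * card (edge_of D ` C) = card C"
proof -
  note C = crossing_component_closed[OF assms]
  have "C = fst ` C \<times> {..<4}"
  proof
    show "C \<subseteq> fst ` C \<times> {..<4}" using C(1) by (force simp: mem_darts)
    show "fst ` C \<times> {..<4} \<subseteq> C"
    proof
      fix d assume "d \<in> fst ` C \<times> {..<4::nat}"
      then obtain c where c: "c \<in> C" "fst d = fst c" "snd d < 4" by auto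
      have "class_of (darts D) (graph_on (darts D) next_ccw) c \<subseteq> C"
        by (rule class_of_subset_closed) (use c C in auto)
      moreover have "d \<in> {fst c} \<times> {..<4}" using c by (cases d) auto
      ultimately show "d \<in> C" using class_next_ccw[of c] c C(1) by blast
    qed
  qed
  then have "card C = card (fst ` C \<times> {..<4::nat})" by simp
  then show "4 * card (fst ` C) = card C" by (simp add: card_cartesian_product)
  have fC: "finite C" using C(1) finite_S by (rule finite_subset)
  interpret C: colored_map C next_ccw "glue D" over
  proof
    show "bij_betw next_ccw C C"
    proof -
      have "inj_on next_ccw C" using bij_N C(1) inj_on_subset by (auto simp: bij_betw_def)
      moreover have "next_ccw ` C \<subseteq> C" using C by auto
      ultimately show ?thesis using endo_inj_surj[OF fC] by (simp add: bij_betw_def)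
    qed
  qed (use C fC tau_tau tau_neq over_next_ccw in auto)
  have "edge_of D ` C = classes C (graph_on C (glue D))"
    unfolding classes_def edge_of_def using C.class_tau by (intro image_cong) auto
  then show "2 * card (edge_of D ` C) = card C" using C.ncyc_tau by simp
qed

text \<open>\<open>faces\<close> is defined inside each component. Face walks never leave a
  component, so these orbits together are the orbits on the set of all darts.\<close>

lemma sum_faces: "(\<Sum>C \<in> crossing_components D. card (faces D C)) = ncyc (darts D) (\<lambda>d. next_ccw (glue D d))"
proof -
  let ?f = "\<lambda>d. next_ccw (glue D d)"
  let ?r = "graph_on (darts D) ?f"
  have cl: "(a \<in> C \<longleftrightarrow> b \<in> C)" if "(a, b) \<in> ?r" "C \<in> crossing_components D" for a b C
  proof -
    have "a \<in> darts D" "b = next_ccw (glue D a)" using that(1) by auto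
    then show ?thesis using crossing_component_closed(2,3)[OF that(2)] tau_mem[of a] by metis
  qed
  have faces: "faces D C = class_of (darts D) ?r ` C" if C: "C \<in> crossing_components D" for C
    unfolding faces_def classes_def face_step_def
  proof (rule image_cong[OF refl])
    fix x assume "x \<in> C"
    show "class_of C (graph_on C ?f) x = class_of (darts D) ?r x"
    proof (rule class_of_restrict[symmetric])
      show "graph_on C ?f = ?r \<inter> C \<times> C"
      proof
        show "graph_on C ?f \<subseteq> ?r \<inter> C \<times> C"
        proof
          fix p assume "p \<in> graph_on C ?f"
          then obtain y where y: "y \<in> C" "p = (y, ?f y)" by blast
          then have "(y, ?f y) \<in> ?r" using crossing_component_closed(1)[OF C] by blast
          then show "p \<in> ?r \<inter> C \<times> C" using y cl[OF _ C] by blast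
        qed
      qed auto
    qed (use cl[OF _ C] \<open>x \<in> C\<close> crossing_component_closed(1)[OF C] in auto)
  qed
  have fin: "finite (crossing_components D)" by (simp add: crossing_components_def classes_finite finite_S)
  have "card (\<Union>C \<in> crossing_components D. class_of (darts D) ?r ` C)
      = (\<Sum>C \<in> crossing_components D. card (class_of (darts D) ?r ` C))"
  proof (rule card_UN_disjoint[OF fin])
    show "\<forall>C \<in> crossing_components D. finite (class_of (darts D) ?r ` C)"
      using crossing_component_closed(1) finite_S finite_subset by blast
    show "\<forall>C \<in> crossing_components D. \<forall>C' \<in> crossing_components D. C \<noteq> C' \<longrightarrow>
      class_of (darts D) ?r ` C \<inter> class_of (darts D) ?r ` C' = {}"
    proof (intro ballI impI)
      fix C C' assume CC': "C \<in> crossing_components D" "C' \<in> crossing_components D" "C \<noteq> C'"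
      then have disj: "C \<inter> C' = {}" unfolding crossing_components_def by (rule classes_disjoint)
      show "class_of (darts D) ?r ` C \<inter> class_of (darts D) ?r ` C' = {}"
      proof (rule ccontr)
        assume "class_of (darts D) ?r ` C \<inter> class_of (darts D) ?r ` C' \<noteq> {}"
        then obtain x y where xy: "x \<in> C" "y \<in> C'" "class_of (darts D) ?r x = class_of (darts D) ?r y" by auto
        have "class_of (darts D) ?r x \<subseteq> C"
          by (rule class_of_subset_closed[OF xy(1)]) (rule cl[OF _ CC'(1)])
        moreover have "y \<in> class_of (darts D) ?r y"
          using xy crossing_component_closed(1)[OF CC'(2)] by (intro class_of_self) auto
        ultimately show False using xy disj by auto
      qed
    qed
  qed
  moreover have "(\<Union>C \<in> crossing_components D. class_of (darts D) ?r ` C) = classes (darts D) ?r"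
  proof -
    have "\<Union>(crossing_components D) = darts D" unfolding crossing_components_def by (rule classes_Union)
    then show ?thesis unfolding classes_def[of _ ?r] by (metis image_Union)
  qed
  ultimately show ?thesis using faces by simp
qed

text \<open>A component with m darts has m/4 crossings and m/2 edges, so Euler's formula gives it 2
  + m/4 faces.\<close>

lemma card_faces: "ncyc (darts D) (\<lambda>d. next_ccw (glue D d)) =
    2 * card (crossing_components D) + card (crossings D)"
proof -
  have "4 * card (faces D C) = 8 + card C" if "C \<in> crossing_components D" for C
  proof -
    have "int (card (fst ` C)) - int (card (edge_of D ` C)) + int (card (faces D C)) = 2"
      using D that by (simp add: link_diagram_def)
    then show ?thesis using card_crossings_component[OF that] by linarith
  qed
  then have "(\<Sum>C \<in> crossing_components D. 4 * card (faces D C)) = (\<Sum>C \<in> crossing_components D. 8 + card C)"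
    by (rule sum.cong[OF refl])
  also have "\<dots> = 8 * card (crossing_components D) + card (darts D)"
    using card_classes_sum[OF finite_S] unfolding sum.distrib crossing_components_def by simp
  finally have "4 * (\<Sum>C \<in> crossing_components D. card (faces D C)) = 8 * card (crossing_components D) + card (darts D)"
    by (simp add: sum_distrib_left)
  moreover have "card (darts D) = 4 * card (crossings D)" by (simp add: darts_def card_cartesian_product)
  ultimately show ?thesis using sum_faces by simp
qed

lemma defect_diagram: "defect (darts D) (\<lambda>d. next_ccw (glue D d)) (glue D) = 0"
proof -
  have "classes (darts D) (graph_on (darts D) next_ccw \<union> graph_on (darts D) (glue D)) = crossing_components D"
    unfolding crossing_components_def by (simp add: Un_commute)
  moreover have "card (darts D) = 4 * card (crossings D)" by (simp add: darts_def card_cartesian_product)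
  ultimately show ?thesis using defect_map ncyc_next_ccw card_faces by simp
qed

lemma inv_next_ccw:
  assumes "d \<in> darts D"
  shows "Ninv d = (fst d, (snd d + 3) mod 4)"
proof (rule inv_into_f_eq)
  show "inj_on next_ccw (darts D)" using bij_N by (simp add: bij_betw_def)
qed (use assms in \<open>auto simp: mem_darts next_ccw_def prod_eq_iff dest!: four_cases\<close>)

text \<open>The B-smoothing joins an over-dart to its successor (1 to 2, 3 to 0), the A-smoothing an
  under-dart (0 to 1, 2 to 3).\<close>

lemma graph_zigzag: "graph_on (darts D) (zigzag (darts D) next_ccw over) = graph_on (darts D) smooth_B"
  "graph_on (darts D) (zigzag (darts D) next_ccw (\<lambda>d. \<not> over d)) = graph_on (darts D) smooth_A"
proof -
  have "zigzag (darts D) next_ccw over d = smooth_B d \<and>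
      zigzag (darts D) next_ccw (\<lambda>d. \<not> over d) d = smooth_A d" if "d \<in> darts D" for d
    using inv_next_ccw[OF that] that
    by (auto simp: mem_darts zigzag_def smooth_A_def smooth_B_def over_def next_ccw_def dest!: four_cases)
  then show "graph_on (darts D) (zigzag (darts D) next_ccw over) = graph_on (darts D) smooth_B"
    "graph_on (darts D) (zigzag (darts D) next_ccw (\<lambda>d. \<not> over d)) = graph_on (darts D) smooth_A"
    by (auto intro!: graph_on_cong)
qed

text \<open>By \<open>card_faces\<close> the term 2k + c is the number of faces plus two for each
  crossingless circle; these cancel against the one circle in each of the two states.\<close>

lemma turaev_genus_state_defect: "turaev_genus D = of_int (state_defect (darts D) next_ccw (glue D) over) / 2"
  unfolding turaev_genus_def state_defect_def nstates_def graph_zigzag card_faces state_curves_def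
    num_components_def by simp

lemma marked_points_eq: "marked_points D = {d \<in> darts D. over (glue D d) = over d}"
  by (auto simp: marked_points_def non_alternating_def)

text \<open>Both sides describe the first marked point met by the face walk, and the least positive
  number of steps is unique.\<close>

lemma arcs_eq:
  assumes "colored_map (marked_points D) \<sigma> (glue D) over"
    and fr: "\<And>d. d \<in> marked_points D \<Longrightarrow> first_return (\<lambda>d. next_ccw (glue D d)) (marked_points D) d (\<sigma> (glue D d))"
  shows "arcs D = graph_on (marked_points D) \<sigma>"
proof -
  let ?M = "marked_points D"
  let ?f = "\<lambda>d. next_ccw (glue D d)"
  interpret M: colored_map ?M \<sigma> "glue D" over by fact
  have f: "face_step D = ?f" by (simp add: face_step_def fun_eq_iff)
  show ?thesis
  proof
    show "arcs D \<subseteq> graph_on ?M \<sigma>"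
    proof
      fix p assume "p \<in> arcs D"
      then obtain d d' n where p: "p = (glue D d, d')" "d \<in> ?M" "d' \<in> ?M" "n \<ge> 1" "d' = (?f ^^ n) d"
        "\<And>m. 1 \<le> m \<Longrightarrow> m < n \<Longrightarrow> (?f ^^ m) d \<notin> ?M"
        unfolding arcs_def f by blast
      obtain k where k: "k \<ge> 1" "\<sigma> (glue D d) = (?f ^^ k) d" "\<And>m. 1 \<le> m \<Longrightarrow> m < k \<Longrightarrow> (?f ^^ m) d \<notin> ?M"
        using first_return_funpow[OF fr[OF p(2)]] by blast
      have "\<not> k < n" using p(6)[of k] k(1,2) p(2) M.N_mem[of "glue D d"] by auto
      moreover have "\<not> n < k" using k(3)[of n] p by auto
      ultimately have "d' = \<sigma> (glue D d)" using k(2) p(5) by auto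
      then show "p \<in> graph_on ?M \<sigma>" using p by simp
    qed
    show "graph_on ?M \<sigma> \<subseteq> arcs D"
    proof
      fix p assume "p \<in> graph_on ?M \<sigma>"
      then obtain e where e: "e \<in> ?M" "p = (e, \<sigma> e)" by blast
      let ?d = "glue D e"
      have d: "?d \<in> ?M" "glue D ?d = e" using e by auto
      \<comment> \<open>\<sigma> changes the colour while both ends of a non-alternating edge share
        one, so the arc leads to another edge.\<close>
      have "over (\<sigma> e) \<noteq> over e" "over ?d = over e" using e by (auto simp: marked_points_eq)
      then have "\<sigma> e \<notin> edge_of D ?d" using d unfolding edge_of_def by auto
      moreover have "\<exists>n \<ge> 1. \<sigma> e = (?f ^^ n) ?d \<and> (\<forall>m. 1 \<le> m \<and> m < n \<longrightarrow> (?f ^^ m) ?d \<notin> ?M)"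
        using first_return_funpow[OF fr[OF d(1)]] d(2) by simp
      moreover have "p = (glue D ?d, \<sigma> e)" "\<sigma> e \<in> ?M" using e d(2) by simp_all
      ultimately show "p \<in> arcs D" unfolding arcs_def f using d(1) by blast
    qed
  qed
qed

text \<open>The defect of the contracted map is squeezed to 0: it is non-negative and at most that
  of the diagram.\<close>

lemma marked_map:
  obtains \<sigma> where "colored_map (marked_points D) \<sigma> (glue D) over"
    and "\<And>d. d \<in> marked_points D \<Longrightarrow> over (glue D d) = over d"
    and "defect (marked_points D) (\<lambda>d. \<sigma> (glue D d)) (glue D) = 0"
    and "turaev_genus D = of_int (state_defect (marked_points D) \<sigma> (glue D) over) / 2"
    and "\<And>d. curve_through D d = class_of (marked_points D) (graph_on (marked_points D) \<sigma>) d"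
proof -
  let ?M = "marked_points D"
  obtain \<sigma> where \<sigma>: "colored_map ?M \<sigma> (glue D) over"
    "defect ?M (\<lambda>d. \<sigma> (glue D d)) (glue D) \<le> defect (darts D) (\<lambda>d. next_ccw (glue D d)) (glue D)"
    "state_defect ?M \<sigma> (glue D) over = state_defect (darts D) next_ccw (glue D) over"
    "\<forall>d \<in> ?M. first_return (\<lambda>d. next_ccw (glue D d)) ?M d (\<sigma> (glue D d))"
    using contract_alternating[OF colored_map_axioms] unfolding marked_points_eq by blast
  interpret M: colored_map ?M \<sigma> "glue D" over by (rule \<sigma>(1))
  have "0 \<le> defect ?M (\<lambda>d. \<sigma> (glue D d)) (glue D)"
    by (rule defect_nonneg[OF M.finite_S M.bij_face M.bij_tau])
  moreover have "curve_through D d = class_of ?M (graph_on ?M \<sigma>) d" for d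
    unfolding curve_through_def using arcs_eq[OF \<sigma>(1)] \<sigma>(4) by simp
  ultimately show thesis
    using that[OF \<sigma>(1)] \<sigma>(2,3) defect_diagram turaev_genus_state_defect by (simp add: marked_points_eq)
qed

end

section \<open>Genus bounds for reduced planar maps\<close>

lemma classes_rep: "C \<in> classes S r \<Longrightarrow> \<exists>x \<in> S. C = class_of S r x"
  by (auto simp: classes_def)

lemma class_of_step:
  assumes "y \<in> class_of S r x" "(y, z) \<in> r \<or> (z, y) \<in> r" "z \<in> S"
  shows "z \<in> class_of S r x"
  using assms eqc_trans[OF _ eqc_edge[of y z r]] eqc_trans[OF _ eqc_edge_rev[of z y r]]
  by (auto simp: mem_class_of)

text \<open>Colours make all cycles even and length 2 is excluded, so each cycle has at least 4
  points. Equality in the count leaves no longer cycle.\<close>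

lemma four_le_card_cycle:
  assumes "finite S" "bij_betw f S S" and col: "\<And>x. x \<in> S \<Longrightarrow> col (f x) = (\<not> col x)"
    and ne: "\<And>x. x \<in> S \<Longrightarrow> f (f x) \<noteq> x"
  shows "4 * ncyc S f \<le> card S"
    and "card S \<le> 4 * ncyc S f \<Longrightarrow> x \<in> S \<Longrightarrow> class_of S (graph_on S f) x = {x, f x, f (f x), f (f (f x))}"
    and "card S \<le> 4 * ncyc S f \<Longrightarrow> x \<in> S \<Longrightarrow> f (f (f (f x))) = x"
proof -
  have mem: "f x \<in> S" if "x \<in> S" for x using assms(2) that by (rule bij_betw_apply)
  have inj: "f x = f y \<longleftrightarrow> x = y" if "x \<in> S" "y \<in> S" for x y
    using assms(2) that by (meson bij_betw_imp_inj_on inj_on_eq_iff)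
  let ?c = "\<lambda>x. {x, f x, f (f x), f (f (f x))}"
  have card: "card (?c x) = 4" if x: "x \<in> S" for x
  proof -
    have m: "f x \<in> S" "f (f x) \<in> S" "f (f (f x)) \<in> S" using x mem by simp_all
    have c: "col (f x) = (\<not> col x)" "col (f (f x)) = col x" "col (f (f (f x))) = (\<not> col x)"
      using x m col by simp_all
    have "f (f x) \<noteq> x" "f (f (f x)) \<noteq> f x" using x m ne by simp_all
    moreover have "f x \<noteq> x" "f (f (f x)) \<noteq> x" "f (f x) \<noteq> f x" "f (f (f x)) \<noteq> f (f x)" using c by auto
    ultimately have "distinct [x, f x, f (f x), f (f (f x))]" by auto
    then show ?thesis using distinct_card by fastforce
  qed
  have sub: "?c x \<subseteq> class_of S (graph_on S f) x" if x: "x \<in> S" for x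
  proof -
    have m: "f x \<in> S" "f (f x) \<in> S" "f (f (f x)) \<in> S" using x mem by simp_all
    have st: "f y \<in> class_of S (graph_on S f) x" if "y \<in> class_of S (graph_on S f) x" for y
      using that class_of_subset[of S "graph_on S f" x] mem by (intro class_of_step[OF that]) auto
    have "x \<in> class_of S (graph_on S f) x" using x by (rule class_of_self)
    then show ?thesis using st by simp
  qed
  have ge: "4 \<le> card C" if "C \<in> classes S (graph_on S f)" for C
  proof -
    from classes_rep[OF that] obtain x where "x \<in> S" "C = class_of S (graph_on S f) x" by blast
    moreover have "finite C" using classes_subset[OF that] assms(1) finite_subset by blast
    ultimately show ?thesis using card_mono[of C "?c x"] card[of x] sub[of x] by simp
  qed
  then show "4 * ncyc S f \<le> card S" using assms(1) by (rule card_classes_le[rotated])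
  assume le: "card S \<le> 4 * ncyc S f" and x: "x \<in> S"
  let ?C = "class_of S (graph_on S f) x"
  have C: "?C \<in> classes S (graph_on S f)" using x by (simp add: classes_def)
  have "card ?C = 4" by (rule card_classes_eq[OF assms(1) ge le C])
  moreover have "finite ?C" using class_of_subset assms(1) by (rule finite_subset)
  ultimately show Cx: "?C = ?c x" using card_subset_eq[OF _ sub[OF x]] card[OF x] by simp
  have m: "f x \<in> S" "f (f x) \<in> S" "f (f (f x)) \<in> S" "f (f (f (f x))) \<in> S" using x mem by simp_all
  have "f (f (f (f x))) \<in> ?C" by (rule class_of_step[of "f (f (f x))"]) (use Cx m in auto)
  then have "f (f (f (f x))) \<in> ?c x" unfolding Cx .
  moreover have "f (f (f (f x))) \<noteq> f x" "f (f (f (f x))) \<noteq> f (f (f x))"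
    using x m col by metis+
  moreover have "f (f (f (f x))) \<noteq> f (f x)" using inj x m ne[OF m(2)] by simp
  ultimately show "f (f (f (f x))) = x" by auto
qed

text \<open>The last assumption says that the vertices of the map cannot be separated by one or two edges.\<close>

locale reduced_map = colored_map +
  assumes nonalt [simp]: "x \<in> S \<Longrightarrow> col (\<tau> x) = col x"
    and planar: "defect S (\<lambda>x. N (\<tau> x)) \<tau> = 0"
    and cut: "X \<subseteq> S \<Longrightarrow> N ` X \<subseteq> X \<Longrightarrow> card {x \<in> X. \<tau> x \<notin> X} \<notin> {1, 2}"
begin

lemma negate_reduced: "reduced_map S N \<tau> (\<lambda>x. \<not> col x)"
proof -
  interpret neg: colored_map S N \<tau> "\<lambda>x. \<not> col x" by (rule negate)
  show ?thesis by unfold_locales (use planar cut in auto)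
qed

abbreviation face :: "'a \<Rightarrow> 'a" where "face x \<equiv> N (\<tau> x)"
abbreviation zz :: "'a \<Rightarrow> 'a" where "zz \<equiv> zigzag S N col"
abbreviation ncomp :: nat where "ncomp \<equiv> card (classes S (graph_on S N \<union> graph_on S \<tau>))"

lemma euler: "4 * ncomp + card S = 2 * ncyc S N + 2 * ncyc S face"
  using defect_map planar by simp

text \<open>A vertex of degree two would be cut off by its two edges; they do not form a loop
  because the two darts differ in colour.\<close>

lemma N_N_neq: "x \<in> S \<Longrightarrow> N (N x) \<noteq> x"
proof
  assume x: "x \<in> S" and eq: "N (N x) = x"
  let ?X = "{x, N x}"
  have c: "col (N x) = (\<not> col x)" "col (\<tau> x) = col x" "col (\<tau> (N x)) = (\<not> col x)" using x by simp_all
  have "\<tau> x \<noteq> x" "\<tau> (N x) \<noteq> N x" using x by simp_all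
  moreover have "\<tau> x \<noteq> N x" "\<tau> (N x) \<noteq> x" "N x \<noteq> x" using c by auto
  ultimately have "{y \<in> ?X. \<tau> y \<notin> ?X} = ?X" by auto
  moreover have "card ?X = 2" using \<open>N x \<noteq> x\<close> by (metis card_2_iff)
  moreover have "?X \<subseteq> S" "N ` ?X \<subseteq> ?X" using x eq by auto
  ultimately show False using cut[of ?X] by simp
qed

lemma vertex_cycle:
  shows "4 * ncyc S N \<le> card S"
    and "card S \<le> 4 * ncyc S N \<Longrightarrow> x \<in> S \<Longrightarrow> class_of S (graph_on S N) x = {x, N x, N (N x), N (N (N x))}"
    and "card S \<le> 4 * ncyc S N \<Longrightarrow> x \<in> S \<Longrightarrow> N (N (N (N x))) = x"
  by (rule four_le_card_cycle[where col = col]; simp add: finite_S bij_N N_N_neq)+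

text \<open>A state curve of length two would run along two parallel edges that form a 2-edge cut: detaching them
  from one of their endpoints splits a vertex and a face, hence a component.\<close>

lemma no_short_zigzag_aux:
  assumes "a \<in> S" "\<tau> (N (\<tau> a)) = N a"
  shows False
proof -
  define b where "b = N a"
  define p where "p = Ninv a"
  have S: "a \<in> S" "b \<in> S" "p \<in> S" "\<tau> a \<in> S" "\<tau> b \<in> S" "\<tau> p \<in> S" using assms by (auto simp: b_def p_def)
  have Np: "N p = a" using assms by (simp add: p_def)
  have tb: "N (\<tau> a) = \<tau> b" using assms S unfolding b_def by (metis N_mem tau_tau)
  have c: "col b = (\<not> col a)" "col (\<tau> a) = col a" "col (\<tau> b) = (\<not> col a)" using S by (simp_all add: b_def)
  have pb: "p \<noteq> b" using N_N_neq[OF S(1)] Np by (auto simp: b_def)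
  have ab: "a \<noteq> b" using c by auto
  \<comment> \<open>Detaches \<open>a\<close> and \<open>b\<close>: the predecessor \<open>p\<close>
    of \<open>a\<close> now continues after \<open>b\<close>, and \<open>a\<close>, \<open>b\<close>
    form a vertex of degree two.\<close>
  let ?q = "swap_at N p b"
  let ?r = "graph_on S ?q \<union> graph_on S \<tau>"
  have "(p, b) \<notin> eqc ?r"
  \<comment> \<open>The face walk runs from \<open>\<tau> p\<close> through \<open>a\<close> to
    \<open>\<tau> b\<close>, so the same swap also cuts a face.\<close>
  proof (rule swap_at_disconnects[OF finite_S bij_N bij_tau S(3,2) pb, where x' = "\<tau> p" and y' = "\<tau> b"])
    have "(p, a) \<in> eqc (graph_on S N)" "(a, b) \<in> eqc (graph_on S N)"
      using S Np by (auto intro!: eqc_edge simp: b_def)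
    then show "(p, b) \<in> eqc (graph_on S N)" by (rule eqc_trans)
    have "(\<tau> p, a) \<in> eqc (graph_on S face)" "(a, \<tau> b) \<in> eqc (graph_on S face)"
      using S Np tb by (force intro!: eqc_edge)+
    then show "(\<tau> p, \<tau> b) \<in> eqc (graph_on S face)" by (rule eqc_trans)
    show "defect S N \<tau> = 0"
    proof -
      have "graph_on S (\<lambda>x. N (\<tau> (\<tau> x))) = graph_on S N" by (rule face_faces)
      then show ?thesis using planar classes_face_tau unfolding defect_def by simp
    qed
  qed (use S in auto)
  define X where "X = class_of S ?r b"
  have pX: "p \<notin> X" using \<open>(p, b) \<notin> eqc ?r\<close> eqc_sym[of b p ?r] by (auto simp: X_def mem_class_of)
  have XS: "X \<subseteq> S" unfolding X_def by (rule class_of_subset)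
  have bq: "bij_betw ?q S S" by (rule bij_swap_at[OF bij_N S(3,2)])
  have Xq: "?q z \<in> X" if "z \<in> X" for z
    unfolding X_def by (rule class_of_step[of z]) (use that XS bij_betw_apply[OF bq] in \<open>auto simp: X_def\<close>)
  have Xt: "\<tau> z \<in> X" if "z \<in> X" for z
    unfolding X_def by (rule class_of_step[of z]) (use that XS in \<open>auto simp: X_def\<close>)
  have bX: "b \<in> X" unfolding X_def using S(2) by (rule class_of_self)
  then have aX: "a \<in> X" using Xq[OF bX] Np by (simp add: swap_at_def)
  \<comment> \<open>Without the detached vertex the component is a union of vertices of the original
    map, left only by the edges of \<open>a\<close> and \<open>b\<close>.\<close>
  let ?Y = "X - {a, b}"
  have "N ` ?Y \<subseteq> ?Y"
  proof
    fix w assume "w \<in> N ` ?Y"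
    then obtain z where z: "z \<in> X" "z \<noteq> a" "z \<noteq> b" "w = N z" by blast
    have zS: "z \<in> S" "z \<noteq> p" using z XS pX by auto
    have "w \<in> X" using Xq[OF z(1)] z zS by (simp add: swap_at_def)
    moreover have "w \<noteq> b" using z zS S N_eq_iff[of z a] by (simp add: b_def)
    moreover have "w \<noteq> a" using z zS S N_eq_iff[of z p] Np by simp
    ultimately show "w \<in> ?Y" by simp
  qed
  moreover have "{z \<in> ?Y. \<tau> z \<notin> ?Y} = {\<tau> a, \<tau> b}"
  proof
    show "{z \<in> ?Y. \<tau> z \<notin> ?Y} \<subseteq> {\<tau> a, \<tau> b}"
    proof
      fix z assume z: "z \<in> {z \<in> ?Y. \<tau> z \<notin> ?Y}"
      then have "\<tau> z = a \<or> \<tau> z = b" using Xt[of z] by auto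
      moreover have "\<tau> (\<tau> z) = z" using z XS by auto
      ultimately show "z \<in> {\<tau> a, \<tau> b}" by auto
    qed
    have "\<tau> a \<noteq> a" "\<tau> b \<noteq> b" "\<tau> a \<noteq> b" "\<tau> b \<noteq> a" using S c by auto
    then show "{\<tau> a, \<tau> b} \<subseteq> {z \<in> ?Y. \<tau> z \<notin> ?Y}" using Xt[OF aX] Xt[OF bX] S by auto
  qed
  moreover have "card {\<tau> a, \<tau> b} = 2" using tau_eq_iff[OF S(1,2)] ab by (metis card_2_iff)
  ultimately show False using cut[of ?Y] XS by auto
qed

lemma no_short_zigzag:
  assumes "x \<in> S"
  shows "zz (\<tau> (zz (\<tau> x))) \<noteq> x"
proof -
  have *: "zz (\<tau> (zz (\<tau> y))) \<noteq> y" if y: "y \<in> S" "col y" for y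
  proof
    assume eq: "zz (\<tau> (zz (\<tau> y))) = y"
    have 1: "zz (\<tau> y) = N (\<tau> y)" using y by (simp add: zigzag_def)
    have "Ninv (\<tau> (N (\<tau> y))) = y" using eq y unfolding 1 by (simp add: zigzag_def)
    then have "\<tau> (N (\<tau> y)) = N y" using y N_Ninv[of "\<tau> (N (\<tau> y))"] by simp
    then show False using no_short_zigzag_aux y by blast
  qed
  show ?thesis
  proof (cases "col x")
    case False
    \<comment> \<open>Starting one edge later on the same curve gives the other colour.\<close>
    have "zz (\<tau> (zz (\<tau> (zz (\<tau> x))))) \<noteq> zz (\<tau> x)" by (rule *) (use assms False in auto)
    then show ?thesis by auto
  qed (use * assms in blast)
qed

text \<open>Colours separate consecutive edges of the curve; \<open>no_short_zigzag\<close> and the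
  absence of fixed points of \<tau> separate those two apart. So a state curve has at least four
  edges, and with exactly eight darts it closes after the fourth.\<close>

lemma zigzag_chain:
  assumes "x \<in> S"
  defines "x2 \<equiv> zz (\<tau> x)"
  defines "x4 \<equiv> zz (\<tau> x2)"
  defines "x6 \<equiv> zz (\<tau> x4)"
  defines "C \<equiv> class_of S (graph_on S \<tau> \<union> graph_on S zz) x"
  shows "{x, \<tau> x, x2, \<tau> x2, x4, \<tau> x4, x6, \<tau> x6} \<subseteq> C"
    and "card {x, \<tau> x, x2, \<tau> x2, x4, \<tau> x4, x6, \<tau> x6} = 8"
    and "card C = 8 \<Longrightarrow> zz (\<tau> x6) = x"
proof -
  have S: "x \<in> S" "x2 \<in> S" "x4 \<in> S" "x6 \<in> S" using assms by auto
  have stt: "\<tau> y \<in> C" if "y \<in> C" for y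
    unfolding C_def by (rule class_of_step[of y]) (use that class_of_subset in \<open>force simp: C_def\<close>)+
  have stz: "zz y \<in> C" if "y \<in> C" for y
    unfolding C_def by (rule class_of_step[of y]) (use that class_of_subset in \<open>force simp: C_def\<close>)+
  have "x \<in> C" unfolding C_def using assms(1) by (rule class_of_self)
  then show sub: "{x, \<tau> x, x2, \<tau> x2, x4, \<tau> x4, x6, \<tau> x6} \<subseteq> C"
    unfolding x6_def x4_def x2_def using stt stz by simp
  have c: "col x2 = (\<not> col x)" "col x4 = col x" "col x6 = (\<not> col x)"
    using S by (simp_all add: x2_def x4_def x6_def)
  have ct: "col (\<tau> x) = col x" "col (\<tau> x2) = (\<not> col x)" "col (\<tau> x4) = col x" "col (\<tau> x6) = (\<not> col x)"
    using S c by simp_all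
  have z: "zz x2 = \<tau> x" "zz x4 = \<tau> x2" "zz x6 = \<tau> x4"
    "zz (\<tau> x) = x2" "zz (\<tau> x2) = x4" "zz (\<tau> x4) = x6"
    using S by (simp_all add: x2_def x4_def x6_def)
  have ne: "\<tau> x \<noteq> x" "\<tau> x2 \<noteq> x2" "\<tau> x4 \<noteq> x4" "\<tau> x6 \<noteq> x6" using S by simp_all
  \<comment> \<open>The facts are numbered by positions on the curve: \<open>x\<close> is 0,
    \<open>\<tau> x\<close> is 1, \<open>x2\<close> is 2, and so on up to \<open>\<tau> x6\<close>,
    which is 7.\<close>
  have 40: "x4 \<noteq> x" using no_short_zigzag[OF S(1)] by (simp add: x2_def x4_def)
  have 62: "x6 \<noteq> x2" using no_short_zigzag[OF S(2)] by (simp add: x4_def x6_def)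
  have 51: "\<tau> x4 \<noteq> \<tau> x" "\<tau> x6 \<noteq> \<tau> x2" using 40 62 S tau_eq_iff by simp_all
  have 41: "x4 \<noteq> \<tau> x" using z(2,4) ne(2) by metis
  have 63: "x6 \<noteq> \<tau> x2" using z(3,5) ne(3) by metis
  have 50: "\<tau> x4 \<noteq> x" "\<tau> x6 \<noteq> x2" using 41 63 S tau_tau by metis+
  have "distinct [x, \<tau> x, x4, \<tau> x4, x2, \<tau> x2, x6, \<tau> x6]"
    using ne 40 62 51 41 63 50 c ct by auto
  then have "card (set [x, \<tau> x, x4, \<tau> x4, x2, \<tau> x2, x6, \<tau> x6]) = 8"
    by (simp only: distinct_card) simp
  moreover have "set [x, \<tau> x, x4, \<tau> x4, x2, \<tau> x2, x6, \<tau> x6] = {x, \<tau> x, x2, \<tau> x2, x4, \<tau> x4, x6, \<tau> x6}"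
    by auto
  ultimately show card: "card {x, \<tau> x, x2, \<tau> x2, x4, \<tau> x4, x6, \<tau> x6} = 8" by simp
  assume "card C = 8"
  moreover have "finite C" unfolding C_def using class_of_subset finite_S by (rule finite_subset)
  ultimately have C: "C = {x, \<tau> x, x2, \<tau> x2, x4, \<tau> x4, x6, \<tau> x6}"
    using card_subset_eq[OF _ sub] card by simp
  have "zz (\<tau> x6) \<in> C" using stz C by blast
  moreover have "col (zz (\<tau> x6)) = col x" using c(3) S by simp
  moreover have "zz (zz (\<tau> x6)) = \<tau> x6" using S by simp
  then have "zz (\<tau> x6) \<noteq> \<tau> x" "zz (\<tau> x6) \<noteq> x4" "zz (\<tau> x6) \<noteq> \<tau> x4"
    using z(4) 50(2) z(2) 51(2) z(6) ne(4) by metis+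
  ultimately show "zz (\<tau> x6) = x" using C c ct by auto
qed

lemma zigzag_class_ge:
  assumes "C \<in> classes S (graph_on S \<tau> \<union> graph_on S zz)"
  shows "8 \<le> card C"
proof -
  obtain x where x: "x \<in> S" "C = class_of S (graph_on S \<tau> \<union> graph_on S zz) x"
    using classes_rep[OF assms] by blast
  have "finite C" using classes_subset[OF assms] finite_S by (rule finite_subset)
  then show ?thesis using card_mono[OF _ zigzag_chain(1)[OF x(1)]] zigzag_chain(2)[OF x(1)] x(2) by simp
qed

lemma nstates_le: "8 * nstates S N \<tau> col \<le> card S"
  unfolding nstates_def by (rule card_classes_le[OF finite_S zigzag_class_ge])

lemma nstates_le': "8 * nstates S N \<tau> (\<lambda>x. \<not> col x) \<le> card S"
proof -
  interpret neg: reduced_map S N \<tau> "\<lambda>x. \<not> col x" by (rule negate_reduced)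
  show ?thesis by (rule neg.nstates_le)
qed

lemma state_defect_ge: "2 * int ncomp \<le> state_defect S N \<tau> col"
  using euler vertex_cycle(1) nstates_le nstates_le' unfolding state_defect_def by linarith

lemma ncomp_pos: "S \<noteq> {} \<Longrightarrow> 0 < ncomp"
  using classes_finite[OF finite_S] by (auto simp: card_gt_0_iff classes_def)

lemma state_defect_2:
  assumes "state_defect S N \<tau> col = 2"
  shows "ncomp = 1" "card S = 4 * ncyc S N" "card S = 8 * nstates S N \<tau> col"
    "card S = 8 * nstates S N \<tau> (\<lambda>x. \<not> col x)"
proof -
  have "S \<noteq> {}"
  proof
    assume "S = {}"
    then show False using assms by (simp add: state_defect_def nstates_def classes_def)
  qed
  from ncomp_pos[OF this] show "ncomp = 1" using state_defect_ge assms by linarith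
  then show "card S = 4 * ncyc S N" "card S = 8 * nstates S N \<tau> col"
    "card S = 8 * nstates S N \<tau> (\<lambda>x. \<not> col x)"
    using assms euler vertex_cycle(1) nstates_le nstates_le' unfolding state_defect_def by linarith+
qed

text \<open>The state curve through \<open>x\<close> passes the edges of \<open>x\<close>,
  \<open>face x\<close>, \<open>b = N (N x)\<close> and \<open>face b\<close>. Closing after four
  edges gives \<open>\<tau> (face b) = N x\<close>, which is the bigon at the opposite
  corner.\<close>

lemma bigon_opposite_aux:
  assumes "card S \<le> 8 * nstates S N \<tau> col" and N4: "\<And>y. y \<in> S \<Longrightarrow> N (N (N (N y))) = y"
    and x: "x \<in> S" "col x" "face (face x) = x"
  shows "face (face (N (N x))) = N (N x)"
proof -
  define b where "b = N (N x)"
  have b: "b \<in> S" "col b" using x by (simp_all add: b_def)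
  have 2: "zz (\<tau> x) = face x" using x by (simp add: zigzag_def)
  have "\<tau> (face x) = N b"
    using N_eq_iff[of "\<tau> (face x)" "N b"] x b N4[OF x(1)] by (simp add: b_def)
  then have 4: "zz (\<tau> (face x)) = b" using x b by (simp add: zigzag_def)
  have 6: "zz (\<tau> b) = face b" using b by (simp add: zigzag_def)
  have C: "class_of S (graph_on S \<tau> \<union> graph_on S zz) x \<in> classes S (graph_on S \<tau> \<union> graph_on S zz)"
    using x by (simp add: classes_def)
  have "card (class_of S (graph_on S \<tau> \<union> graph_on S zz) x) = 8"
    by (rule card_classes_eq[OF finite_S zigzag_class_ge assms(1)[unfolded nstates_def] C])
  from zigzag_chain(3)[OF x(1) this] have "zz (\<tau> (face b)) = x" by (simp add: 2 4 6)
  then have "Ninv (\<tau> (face b)) = x" using b by (simp add: zigzag_def)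
  then have "\<tau> (face b) = N x" using b N_Ninv[of "\<tau> (face b)"] by simp
  then show ?thesis by (simp add: b_def)
qed

lemma bigon_opposite:
  assumes "state_defect S N \<tau> col = 2" and x: "x \<in> S" "face (face x) = x"
  shows "face (face (N (N x))) = N (N x)"
proof -
  interpret neg: reduced_map S N \<tau> "\<lambda>x. \<not> col x" by (rule negate_reduced)
  note d = state_defect_2[OF assms(1)]
  have N4: "N (N (N (N y))) = y" if "y \<in> S" for y using vertex_cycle(3)[OF _ that] d(2) by simp
  show ?thesis
    using bigon_opposite_aux[OF _ N4] neg.bigon_opposite_aux[OF _ N4] d x by (cases "col x") simp_all
qed

lemma bigon_exists:
  assumes "state_defect S N \<tau> col = 2"
  shows "\<exists>x \<in> S. face (face x) = x"
proof (rule ccontr)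
  assume "\<not> ?thesis"
  then have "4 * ncyc S face \<le> card S"
    by (intro four_le_card_cycle(1)[where col = col]) (auto simp: finite_S bij_face)
  then show False using state_defect_2[OF assms] euler by linarith
qed

end

section \<open>Doubled cycles and doubled path equivalence\<close>

lemma mgraph_iso_refl: "G \<cong>\<^sub>m G"
  unfolding mgraph_iso_def by (intro exI[of _ id]) auto

lemma mgraph_iso_trans:
  assumes "G \<cong>\<^sub>m H" "H \<cong>\<^sub>m K"
  shows "G \<cong>\<^sub>m K"
proof -
  obtain f g where fg: "bij_betw f (verts G) (verts H)" "bij_betw g (edges G) (edges H)"
    "\<forall>e \<in> edges G. ends H (g e) = f ` ends G e" using assms(1) unfolding mgraph_iso_def by blast
  obtain f' g' where fg': "bij_betw f' (verts H) (verts K)" "bij_betw g' (edges H) (edges K)"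
    "\<forall>e \<in> edges H. ends K (g' e) = f' ` ends H e" using assms(2) unfolding mgraph_iso_def by blast
  have "ends K ((g' \<circ> g) e) = (f' \<circ> f) ` ends G e" if "e \<in> edges G" for e
    using that fg(3) fg'(3) bij_betw_apply[OF fg(2) that] by (simp add: image_comp)
  then show ?thesis unfolding mgraph_iso_def
    using bij_betw_trans[OF fg(1) fg'(1)] bij_betw_trans[OF fg(2) fg'(2)] by blast
qed

lemma mgraph_iso_sym:
  assumes "\<And>e. e \<in> edges G \<Longrightarrow> ends G e \<subseteq> verts G" "G \<cong>\<^sub>m H"
  shows "H \<cong>\<^sub>m G"
proof -
  obtain f g where fg: "bij_betw f (verts G) (verts H)" "bij_betw g (edges G) (edges H)"
    "\<forall>e \<in> edges G. ends H (g e) = f ` ends G e" using assms(2) unfolding mgraph_iso_def by blast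
  let ?f = "inv_into (verts G) f" and ?g = "inv_into (edges G) g"
  have "ends G (?g e) = ?f ` ends H e" if "e \<in> edges H" for e
  proof -
    have e: "?g e \<in> edges G" "g (?g e) = e"
      using that fg(2) bij_betw_apply[OF bij_betw_inv_into[OF fg(2)] that] bij_betw_inv_into_right by auto
    have "ends H e = f ` ends G (?g e)" using e fg(3) by metis
    moreover have "?f (f x) = x" if "x \<in> ends G (?g e)" for x
      using that assms(1)[OF e(1)] bij_betw_inv_into_left[OF fg(1)] by auto
    ultimately show ?thesis by (simp add: image_image)
  qed
  then show ?thesis unfolding mgraph_iso_def
    using bij_betw_inv_into[OF fg(1)] bij_betw_inv_into[OF fg(2)] by blast
qed

text \<open>\<open>s\<close> is a cyclic permutation of the index set \<open>I\<close>; the edges from \<open>h i\<close> to its successor \<open>h (s i)\<close> are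
  \<open>a i\<close> and \<open>b i\<close>.\<close>

locale cyclic_doubling =
  fixes I :: "'i set" and s :: "'i \<Rightarrow> 'i" and h :: "'i \<Rightarrow> 'v" and a b :: "'i \<Rightarrow> 'e"
    and G :: "('v, 'e) mgraph"
  assumes finite_I: "finite I" and card_I: "2 \<le> card I" and bij_s: "bij_betw s I I"
    and cyclic: "Z \<subseteq> I \<Longrightarrow> Z \<noteq> {} \<Longrightarrow> s ` Z \<subseteq> Z \<Longrightarrow> Z = I"
    and bij_h: "bij_betw h I (verts G)"
    and edges: "edges G = a ` I \<union> b ` I" and card_edges: "card (edges G) = 2 * card I"
    and ends_a: "i \<in> I \<Longrightarrow> ends G (a i) = {h i, h (s i)}"
    and ends_b: "i \<in> I \<Longrightarrow> ends G (b i) = {h i, h (s i)}"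
begin

lemma s_mem [simp]: "i \<in> I \<Longrightarrow> s i \<in> I"
  using bij_s by (rule bij_betw_apply)

lemma s_eq_iff: "i \<in> I \<Longrightarrow> j \<in> I \<Longrightarrow> s i = s j \<longleftrightarrow> i = j"
  using bij_s by (meson bij_betw_imp_inj_on inj_on_eq_iff)

lemma h_mem: "i \<in> I \<Longrightarrow> h i \<in> verts G"
  using bij_h by (rule bij_betw_apply)

lemma h_eq_iff: "i \<in> I \<Longrightarrow> j \<in> I \<Longrightarrow> h i = h j \<longleftrightarrow> i = j"
  using bij_h by (meson bij_betw_imp_inj_on inj_on_eq_iff)

lemma s_neq: "i \<in> I \<Longrightarrow> s i \<noteq> i"
  using cyclic[of "{i}"] card_I by auto

lemma s_s_neq:
  assumes "i \<in> I" "3 \<le> card I"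
  shows "s (s i) \<noteq> i"
proof
  assume "s (s i) = i"
  then have "{i, s i} = I" using assms(1) by (intro cyclic) auto
  then show False using assms(2) card_insert_le_m1[of 2 "{s i}" i] by (auto simp: card_insert_if split: if_splits)
qed

lemma card_verts: "card (verts G) = card I"
  using bij_betw_same_card[OF bij_h] by simp

text \<open>The number \<open>2 * card I\<close> of edges leaves no room for coincidences.\<close>

lemma inj_ab: "inj_on a I" "inj_on b I" "a ` I \<inter> b ` I = {}"
proof -
  have "card (a ` I) \<le> card I" "card (b ` I) \<le> card I" using finite_I card_image_le by blast+
  moreover have "card (a ` I) + card (b ` I) = 2 * card I + card (a ` I \<inter> b ` I)"
    using card_Un_Int[of "a ` I" "b ` I"] finite_I card_edges edges by simp
  ultimately have "card (a ` I) = card I" "card (b ` I) = card I" "card (a ` I \<inter> b ` I) = 0" by linarith+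
  then show "inj_on a I" "inj_on b I" "a ` I \<inter> b ` I = {}"
    by (simp_all add: finite_I eq_card_imp_inj_on)
qed

lemma ab_eq_iff: "i \<in> I \<Longrightarrow> j \<in> I \<Longrightarrow> a i = a j \<longleftrightarrow> i = j" "i \<in> I \<Longrightarrow> j \<in> I \<Longrightarrow> b i = b j \<longleftrightarrow> i = j"
  "i \<in> I \<Longrightarrow> j \<in> I \<Longrightarrow> a i \<noteq> b j"
  using inj_on_eq_iff[OF inj_ab(1)] inj_on_eq_iff[OF inj_ab(2)] inj_ab(3) by auto

lemma ends_subset: "e \<in> edges G \<Longrightarrow> ends G e \<subseteq> verts G"
  using edges ends_a ends_b h_mem by auto

lemma finite_edges: "finite (edges G)"
  using edges finite_I by simp

lemma edge_cases:
  assumes "e \<in> edges G"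
  obtains i where "i \<in> I" "e = a i \<or> e = b i" "ends G e = {h i, h (s i)}"
  using assms edges ends_a ends_b by auto

lemma is_multigraph: "multigraph G"
proof -
  have "finite (verts G)" using bij_betw_finite[OF bij_h] finite_I by simp
  moreover have "card (ends G e) \<in> {1, 2}" if "e \<in> edges G" for e
    using edge_cases[OF that] by (metis card_1_singleton_iff card_2_iff insert_absorb2 insert_iff One_nat_def)
  ultimately show ?thesis unfolding multigraph_def using finite_edges ends_subset by blast
qed

text \<open>An orbit of \<open>s\<close> is invariant, hence all of \<open>I\<close>, and its first
  return time is the length of the cycle.\<close>

lemma iso_doubled_cycle: "doubled_cycle (card I) \<cong>\<^sub>m G"
proof -
  have "I \<noteq> {}" using card_I by auto
  then obtain i where i: "i \<in> I" by blast
  obtain k0 where k0: "k0 \<ge> 1" "(s ^^ k0) i = i" using perm_return[OF finite_I bij_s i] .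
  define m where "m = (LEAST k. k \<ge> 1 \<and> (s ^^ k) i = i)"
  have m: "m \<ge> 1" "(s ^^ m) i = i"
    using LeastI[of "\<lambda>k. k \<ge> 1 \<and> (s ^^ k) i = i" k0] k0 by (auto simp: m_def)
  have least: "(s ^^ j) i \<noteq> i" if "1 \<le> j" "j < m" for j
    using not_less_Least[of j "\<lambda>k. k \<ge> 1 \<and> (s ^^ k) i = i"] that by (auto simp: m_def)
  let ?o = "\<lambda>k. (s ^^ k) i"
  have oI: "?o k \<in> I" for k using funpow_mem[OF bij_s i] .
  have modm: "?o (k mod m) = ?o k" for k using funpow_mod_eq[OF m(2)] .
  have "?o ` {..<m} = I"
  proof (rule cyclic)
    show "s ` ?o ` {..<m} \<subseteq> ?o ` {..<m}"
    proof
      fix y assume "y \<in> s ` ?o ` {..<m}"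
      then obtain k where "y = ?o (Suc k)" by auto
      then have "y = ?o (Suc k mod m)" using modm by simp
      then show "y \<in> ?o ` {..<m}" using m by auto
    qed
  next
    have "0 \<in> {..<m}" using m by simp
    then show "?o ` {..<m} \<noteq> {}" by blast
  qed (use oI in auto)
  moreover have "inj_on ?o {..<m}"
  proof (rule linorder_inj_onI)
    fix j k assume jk: "j < k" "j \<in> {..<m}" "k \<in> {..<m}"
    show "?o j \<noteq> ?o k"
    proof
      assume eq: "?o j = ?o k"
      have "?o (m - k + k) = ?o (m - k + j)" unfolding funpow_add comp_apply using eq by simp
      then have "?o (m - k + j) = i" using jk m by simp
      moreover have "1 \<le> m - k + j" "m - k + j < m" using jk by auto
      ultimately show False using least by blast
    qed
  qed auto
  ultimately have bo: "bij_betw ?o {..<m} I" by (simp add: bij_betw_def)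
  have mI: "card I = m" using bij_betw_same_card[OF bo] by simp
  let ?g = "\<lambda>(k, c). if c = (0::nat) then a (?o k) else b (?o k)"
  let ?E = "{..<m} \<times> {..<2::nat}"
  have "?g ` ?E = edges G"
  proof
    show "?g ` ?E \<subseteq> edges G" using oI by (auto simp: edges)
    show "edges G \<subseteq> ?g ` ?E"
    proof
      fix e assume "e \<in> edges G"
      then obtain j where "j \<in> I" "e = a j \<or> e = b j" by (rule edge_cases)
      then obtain k where "k < m" "e = a (?o k) \<or> e = b (?o k)" using \<open>?o ` {..<m} = I\<close> by blast
      then have "e = ?g (k, 0) \<or> e = ?g (k, 1)" "(k, 0) \<in> ?E" "(k, 1) \<in> ?E" by auto
      then show "e \<in> ?g ` ?E" by blast
    qed
  qed
  moreover from this have "inj_on ?g ?E"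
    by (intro eq_card_imp_inj_on) (use card_edges mI in \<open>simp_all add: card_cartesian_product\<close>)
  ultimately have "bij_betw ?g ?E (edges G)" by (simp add: bij_betw_def)
  moreover have "bij_betw (h \<circ> ?o) {..<m} (verts G)" using bij_betw_trans[OF bo bij_h] .
  moreover have "ends G (?g (k, c)) = (h \<circ> ?o) ` {k, Suc k mod m}" if "k < m" for k c
    using ends_a[OF oI] ends_b[OF oI] modm[of "Suc k"] by simp
  ultimately show ?thesis unfolding mgraph_iso_def doubled_cycle_def mI
    by (intro exI[of _ "h \<circ> ?o"] exI[of _ ?g]) auto
qed

lemma iso_doubled_cycle': "G \<cong>\<^sub>m doubled_cycle (card I)"
  by (rule mgraph_iso_sym[OF _ iso_doubled_cycle]) (auto simp: doubled_cycle_def)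

lemma transport:
  assumes "G \<cong>\<^sub>m H"
  shows "\<exists>h a b. cyclic_doubling I s h a b H"
proof -
  obtain f g where fg: "bij_betw f (verts G) (verts H)" "bij_betw g (edges G) (edges H)"
    "\<forall>e \<in> edges G. ends H (g e) = f ` ends G e" using assms unfolding mgraph_iso_def by blast
  have "cyclic_doubling I s (f \<circ> h) (g \<circ> a) (g \<circ> b) H"
  proof
    show "bij_betw (f \<circ> h) I (verts H)" using bij_betw_trans[OF bij_h fg(1)] .
    have "g ` edges G = edges H" using fg(2) by (simp add: bij_betw_def)
    then show "edges H = (g \<circ> a) ` I \<union> (g \<circ> b) ` I" unfolding edges by (simp add: image_Un image_comp)
    show "card (edges H) = 2 * card I" using bij_betw_same_card[OF fg(2)] card_edges by simp
    fix i assume i: "i \<in> I"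
    then have "a i \<in> edges G" "b i \<in> edges G" by (simp_all add: edges)
    then show "ends H ((g \<circ> a) i) = {(f \<circ> h) i, (f \<circ> h) (s i)}"
      "ends H ((g \<circ> b) i) = {(f \<circ> h) i, (f \<circ> h) (s i)}"
      using fg(3) ends_a[OF i] ends_b[OF i] by auto
  qed (use finite_I card_I bij_s cyclic in auto)
  then show ?thesis by blast
qed

text \<open>The same cycle run backwards: each pair of edges is now indexed by its other endpoint,
  hence the composition with \<open>t\<close>. It serves to orient a given pair from
  \<open>u\<close> to \<open>w\<close>.\<close>

lemma reverse:
  defines "t \<equiv> inv_into I s"
  shows "cyclic_doubling I t h (a \<circ> t) (b \<circ> t) G"
proof
  have t: "t i \<in> I" "s (t i) = i" if "i \<in> I" for i
    using that bij_s bij_betw_apply[OF bij_betw_inv_into[OF bij_s]] bij_betw_inv_into_right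
    unfolding t_def by fastforce+
  show "bij_betw t I I" unfolding t_def using bij_s by (rule bij_betw_inv_into)
  then have tI: "t ` I = I" by (simp add: bij_betw_def)
  show "edges G = (a \<circ> t) ` I \<union> (b \<circ> t) ` I" unfolding edges image_comp[symmetric] tI ..
  show "Z = I" if Z: "Z \<subseteq> I" "Z \<noteq> {}" "t ` Z \<subseteq> Z" for Z
  proof (rule cyclic[OF Z(1,2)])
    show "s ` Z \<subseteq> Z"
    proof
      fix y assume "y \<in> s ` Z"
      then obtain z where z: "z \<in> Z" "y = s z" by blast
      then have "t y = z" using Z(1) bij_s bij_betw_inv_into_left unfolding t_def by fastforce
      then show "y \<in> Z"
        using bij_closed[OF finite_I \<open>bij_betw t I I\<close> Z(1,3), of y] z Z(1) by auto
    qed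
  qed
  fix i assume "i \<in> I"
  then show "ends G ((a \<circ> t) i) = {h i, h (t i)}" "ends G ((b \<circ> t) i) = {h i, h (t i)}"
    using ends_a[OF t(1)] ends_b[OF t(1)] t(2) by auto
qed (use finite_I card_I bij_h card_edges in auto)

lemma orient:
  assumes "p \<in> I" "{h p, h (s p)} = {u, w}"
  obtains s' a' b' p' where "cyclic_doubling I s' h a' b' G" "p' \<in> I" "h p' = u" "h (s' p') = w"
    "a' p' = a p" "b' p' = b p"
proof (cases "h p = u")
  case True
  moreover have "h (s p) = w" using True assms s_neq[of p] h_eq_iff[of p "s p"] by (auto simp: doubleton_eq_iff)
  ultimately show thesis using that cyclic_doubling_axioms assms(1) by blast
next
  case False
  let ?t = "inv_into I s"
  have "?t (s p) = p" using assms(1) bij_s bij_betw_inv_into_left by fastforce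
  moreover have "h (s p) = u" "h p = w" using False assms(2) by (auto simp: doubleton_eq_iff)
  ultimately show thesis using that[OF reverse, of "s p"] assms(1) by simp
qed

text \<open>The vertex \<open>s p\<close> is cut out of the cycle and the pair leaving it is
  inherited by \<open>p\<close>. With at least three vertices a doubled cycle of length at least 2
  remains.\<close>

lemma contract_pair:
  assumes "3 \<le> card I" "p \<in> I"
  defines "H \<equiv> contract G (h p) (h (s p)) {a p, b p}"
  shows "cyclic_doubling (I - {s p}) (bypass (s p) s) h (a(p := a (s p))) (b(p := b (s p))) H"
proof -
  let ?w = "s p"
  let ?s = "bypass ?w s"
  have w: "?w \<in> I" "?w \<noteq> p" "s ?w \<noteq> ?w" using assms s_neq by simp_all
  have sw: "s i = ?w \<longleftrightarrow> i = p" if "i \<in> I" for i using that assms(2) s_eq_iff by simp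
  have vH: "verts H = verts G - {h ?w}"
    using h_mem[OF assms(2)] h_eq_iff[OF w(1) assms(2)] w(2) unfolding H_def contract_def by auto
  have eH: "edges H = edges G - {a p, b p}" by (simp add: H_def contract_def Let_def)
  have endsH: "ends H e = (\<lambda>x. if x = h ?w then h p else x) ` ends G e" for e
    by (simp add: H_def contract_def Let_def)
  have cI: "card (I - {?w}) = card I - 1" using w finite_I by simp
  have "a p \<in> edges G" "b p \<in> edges G" "a p \<noteq> b p" using assms ab_eq_iff by (auto simp: edges)
  then have "card (edges H) = card (edges G) - 2"
    unfolding eH using finite_edges by (simp add: card_Diff_subset)
  show ?thesis
  proof
    show "finite (I - {?w})" using finite_I by simp
    show "2 \<le> card (I - {?w})" using cI assms(1) by simp
    have "?s ?w = ?w" by (simp add: bypass_def)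
    then show "bij_betw ?s (I - {?w}) (I - {?w})"
      using bij_betw_DiffI[OF bij_bypass[OF bij_s w(1)], of "{?w}" "{?w}"] w by simp
    show "bij_betw h (I - {?w}) (verts H)"
      unfolding vH using bij_betw_DiffI[OF bij_h, of "{?w}" "{h ?w}"] w h_mem by simp
    show "card (edges H) = 2 * card (I - {?w})"
      using \<open>card (edges H) = card (edges G) - 2\<close> card_edges cI by simp
    have im: "(f(p := f ?w)) ` (I - {?w}) = f ` (I - {p})" for f :: "_ \<Rightarrow> 'e"
      using w assms(2) by auto
    show "edges H = (a(p := a ?w)) ` (I - {?w}) \<union> (b(p := b ?w)) ` (I - {?w})"
      unfolding im eH edges using ab_eq_iff assms(2) by (auto dest: sym)
    fix i assume i: "i \<in> I - {?w}"
    have *: "ends H (f ((if i = p then ?w else i))) = {h i, h (?s i)}"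
      if f: "\<And>j. j \<in> I \<Longrightarrow> ends G (f j) = {h j, h (s j)}" for f
    proof (cases "i = p")
      case True
      then show ?thesis using f[OF w(1)] w assms(2) h_eq_iff by (simp add: endsH bypass_def insert_commute)
    next
      case False
      then show ?thesis using f[of i] w i h_eq_iff sw by (simp add: endsH bypass_def)
    qed
    show "ends H ((a(p := a ?w)) i) = {h i, h (?s i)}" using *[of a, OF ends_a] by (auto split: if_splits)
    show "ends H ((b(p := b ?w)) i) = {h i, h (?s i)}" using *[of b, OF ends_b] by (auto split: if_splits)
  next
    fix Z assume Z: "Z \<subseteq> I - {?w}" "Z \<noteq> {}" "?s ` Z \<subseteq> Z"
    \<comment> \<open>Puts the removed index back right after its predecessor, so that invariance
      under the shortened cycle becomes invariance under \<open>s\<close>.\<close>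
    let ?Z = "if p \<in> Z then insert ?w Z else Z"
    have "?Z = I"
    proof (rule cyclic)
      show "s ` ?Z \<subseteq> ?Z"
      proof
        fix y assume "y \<in> s ` ?Z"
        then obtain z where z: "z \<in> ?Z" "y = s z" by blast
        show "y \<in> ?Z"
        proof (cases "z = ?w")
          case True
          then have "p \<in> Z" using z Z by (auto split: if_splits)
          then have "?s p \<in> Z" using Z by blast
          then show ?thesis using True z w \<open>p \<in> Z\<close> by (simp add: bypass_def)
        next
          case False
          then have zZ: "z \<in> Z" "z \<in> I" using z Z by (auto split: if_splits)
          show ?thesis
          proof (cases "z = p")
            case False
            then have "?s z = y" using z zZ sw \<open>z \<noteq> ?w\<close> by (simp add: bypass_def)
            then have "y \<in> Z" using Z zZ by blast
            then show ?thesis by simp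
          qed (use z zZ in simp)
        qed
      qed
    qed (use Z w in auto)
    then show "Z = I - {?w}" using Z assms(2) by (auto split: if_splits)
  qed
qed

text \<open>From length 3 on, two adjacent vertices are joined by one pair only. In length 2 all
  four edges are parallel.\<close>

lemma parallel_pair:
  assumes "3 \<le> card I" and e: "e \<in> edges G" "e' \<in> edges G" "e \<noteq> e'"
    and "ends G e = {u, w}" "ends G e' = {u, w}"
  obtains p where "p \<in> I" "{e, e'} = {a p, b p}" "{h p, h (s p)} = {u, w}"
proof -
  obtain p where p: "p \<in> I" "e = a p \<or> e = b p" "ends G e = {h p, h (s p)}" using e(1) by (rule edge_cases)
  obtain q where q: "q \<in> I" "e' = a q \<or> e' = b q" "ends G e' = {h q, h (s q)}" using e(2) by (rule edge_cases)
  have "{h p, h (s p)} = {h q, h (s q)}" using p q assms by simp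
  then have "p = q \<or> p = s q \<and> s p = q" using p(1) q(1) h_eq_iff by (auto simp: doubleton_eq_iff)
  then have "p = q" using s_s_neq[OF p(1) assms(1)] by auto
  then have "{e, e'} = {a p, b p}" using p q e(3) by auto
  then show thesis using that p assms(5) by simp
qed

end

lemma doubled_cycle_cyclic_doubling:
  assumes "2 \<le> n"
  shows "cyclic_doubling {..<n} (\<lambda>k. Suc k mod n) (\<lambda>k. k) (\<lambda>k. (k, 0)) (\<lambda>k. (k, 1)) (doubled_cycle n)"
proof
  show cyc: "Z = {..<n}" if Z: "Z \<subseteq> {..<n}" "Z \<noteq> {}" "(\<lambda>k. Suc k mod n) ` Z \<subseteq> Z" for Z
  proof -
    obtain z where z: "z \<in> Z" using Z by blast
    have zj: "(z + j) mod n \<in> Z" for j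
    proof (induction j)
      case 0
      then show ?case using z Z(1) by auto
    next
      case (Suc j)
      then have "Suc ((z + j) mod n) mod n \<in> Z" using Z(3) by blast
      then show ?case by (simp add: mod_Suc_eq)
    qed
    have "m \<in> Z" if "m < n" for m
    proof -
      have "(z + (n - z + m)) mod n = m" using z Z(1) that by (auto simp: subset_iff)
      then show ?thesis using zj by metis
    qed
    then show ?thesis using Z(1) by blast
  qed
  have "inj_on (\<lambda>k. Suc k mod n) {..<n}"
    by (rule inj_onI) (auto simp: mod_Suc split: if_splits)
  moreover have "(\<lambda>k. Suc k mod n) ` {..<n} \<subseteq> {..<n}" using assms by auto
  ultimately show "bij_betw (\<lambda>k. Suc k mod n) {..<n} {..<n}"
    by (simp add: bij_betw_def endo_inj_surj)
  have "{..<2::nat} = {0, 1}" by auto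
  then show "edges (doubled_cycle n) = (\<lambda>k. (k, 0)) ` {..<n} \<union> (\<lambda>k. (k, 1)) ` {..<n}"
    by (auto simp: doubled_cycle_def)
qed (use assms in \<open>auto simp: doubled_cycle_def card_cartesian_product bij_betw_def\<close>)

lemma iso_doubled_cycle_iff:
  assumes "multigraph G"
  shows "(\<exists>n \<ge> 2. G \<cong>\<^sub>m doubled_cycle n) \<longleftrightarrow> (\<exists>(I :: nat set) s h a b. cyclic_doubling I s h a b G)"
proof
  assume "\<exists>n \<ge> 2. G \<cong>\<^sub>m doubled_cycle n"
  then obtain n where n: "2 \<le> n" "G \<cong>\<^sub>m doubled_cycle n" by blast
  interpret cyclic_doubling "{..<n}" "\<lambda>k. Suc k mod n" "\<lambda>k. k" "\<lambda>k. (k, 0)" "\<lambda>k. (k, 1)" "doubled_cycle n"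
    by (rule doubled_cycle_cyclic_doubling[OF n(1)])
  have "doubled_cycle n \<cong>\<^sub>m G"
    by (rule mgraph_iso_sym[OF _ n(2)]) (use assms in \<open>simp add: multigraph_def\<close>)
  from transport[OF this] show "\<exists>(I :: nat set) s h a b. cyclic_doubling I s h a b G" by blast
next
  assume "\<exists>(I :: nat set) s h a b. cyclic_doubling I s h a b G"
  then obtain I s h a b where "cyclic_doubling (I :: nat set) s h a b G" by blast
  then interpret cyclic_doubling I s h a b G .
  show "\<exists>n \<ge> 2. G \<cong>\<^sub>m doubled_cycle n" using iso_doubled_cycle' card_I by blast
qed

section \<open>Contraction and extension of doubled paths\<close>

lemma contract_swap_iso:
  assumes "u \<noteq> w"
  shows "contract G u w F \<cong>\<^sub>m contract G w u F"
proof -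
  let ?q = "\<lambda>x. if x = w then u else x" and ?q' = "\<lambda>x. if x = u then w else x"
  let ?f = "?q'"
  have fq: "?f (?q x) = ?q' x" for x using assms by auto
  have "?f ` ?q ` A = ?q' ` A" for A by (simp only: image_image fq)
  moreover have "inj_on ?f (?q ` verts G)" using assms by (auto simp: inj_on_def)
  ultimately show ?thesis unfolding mgraph_iso_def contract_def Let_def
    by (intro exI[of _ ?f] exI[of _ id]) (simp add: bij_betw_def)
qed

text \<open>The subdivision inverse to a doubled path contraction, at a vertex \<open>w\<close> of degree four.\<close>

lemma extend_doubled_cycle:
  assumes "\<exists>(I :: nat set) s h a b. cyclic_doubling I s h a b (contract H u w {e1, e2})"
    and u: "u \<in> verts H" "w \<in> verts H" "u \<noteq> w" "t \<noteq> u" "t \<noteq> w"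
    and e: "e1 \<in> edges H" "e2 \<in> edges H" "e1 \<noteq> e2" "ends H e1 = {u, w}" "ends H e2 = {u, w}"
    and f: "f1 \<in> edges H" "f2 \<in> edges H" "f1 \<noteq> f2" "ends H f1 = {w, t}" "ends H f2 = {w, t}"
    and w: "{e \<in> edges H. w \<in> ends H e} = {e1, e2, f1, f2}"
  shows "\<exists>(I :: nat set) s h a b. cyclic_doubling I s h a b H"
proof -
  define K where "K = contract H u w {e1, e2}"
  have vK: "verts K = verts H - {w}" using u by (auto simp: K_def contract_def)
  have eK: "edges K = edges H - {e1, e2}" by (simp add: K_def contract_def Let_def)
  have endsK: "ends K e = (\<lambda>x. if x = w then u else x) ` ends H e" for e
    by (simp add: K_def contract_def Let_def)
  have fK: "ends K f1 = {u, t}" "ends K f2 = {u, t}" using f u by (auto simp: endsK)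
  have ef: "f1 \<noteq> e1" "f1 \<noteq> e2" "f2 \<noteq> e1" "f2 \<noteq> e2" using e f u by (auto simp: doubleton_eq_iff)
  have fK': "f1 \<in> edges K" "f2 \<in> edges K" using f ef by (auto simp: eK)
  have oK: "ends K e = ends H e" if "e \<in> edges K" "e \<noteq> f1" "e \<noteq> f2" for e
  proof -
    have "e \<in> edges H" "e \<notin> {e1, e2, f1, f2}" using that by (auto simp: eK)
    then have "w \<notin> ends H e" using w by blast
    then show ?thesis by (auto simp: endsK)
  qed
  obtain I s h a b where "cyclic_doubling (I :: nat set) s h a b K" using assms(1) K_def by blast
  then interpret cyclic_doubling I s h a b K .
  have "\<exists>s a b p. cyclic_doubling I s h a b K \<and> p \<in> I \<and> {a p, b p} = {f1, f2} \<and> {h p, h (s p)} = {u, t}"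
  proof (cases "3 \<le> card I")
    case True
    obtain p where "p \<in> I" "{f1, f2} = {a p, b p}" "{h p, h (s p)} = {u, t}"
      using parallel_pair[OF True fK' f(3) fK] by blast
    then show ?thesis using cyclic_doubling_axioms by metis
  next
    \<comment> \<open>Length 2: all four edges are parallel, and \<open>f1\<close>,
      \<open>f2\<close> may belong to different pairs. The edges are paired anew.\<close>
    case False
    then have cI: "card I = 2" using card_I by simp
    obtain p where p: "p \<in> I" "f1 = a p \<or> f1 = b p" "ends K f1 = {h p, h (s p)}" using fK'(1) by (rule edge_cases)
    have I: "I = {p, s p}"
      using card_subset_eq[OF finite_I, of "{p, s p}"] p s_neq[OF p(1)] cI by (simp add: card_insert_if)
    have ssp: "s (s p) = p" using I s_mem[of "s p"] s_neq[of "s p"] p(1) by auto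
    have all: "ends K e = {h p, h (s p)}" if "e \<in> edges K" for e
      using edge_cases[OF that] I ssp by (metis insert_commute insert_iff empty_iff)
    have "card (edges K - {f1, f2}) = 2"
      using card_edges cI fK' f(3) finite_edges by (simp add: card_Diff_subset)
    then obtain g1 g2 where g: "edges K - {f1, f2} = {g1, g2}" "g1 \<noteq> g2" by (auto simp: card_2_iff)
    let ?a = "\<lambda>i. if i = p then f1 else g1" and ?b = "\<lambda>i. if i = p then f2 else g2"
    have "edges K = {f1, f2, g1, g2}" using g fK' by blast
    then have "cyclic_doubling I s h ?a ?b K"
    proof unfold_locales
      assume E: "edges K = {f1, f2, g1, g2}"
      show "edges K = ?a ` I \<union> ?b ` I" using E I s_neq[OF p(1)] by auto
      fix i assume "i \<in> I"
      then have "{h i, h (s i)} = {h p, h (s p)}" using I ssp by auto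
      moreover have "?a i \<in> edges K" "?b i \<in> edges K" using E by auto
      ultimately show "ends K (?a i) = {h i, h (s i)}" "ends K (?b i) = {h i, h (s i)}"
        using all by simp_all
    qed (use finite_I card_I bij_s cyclic bij_h card_edges in auto)
    moreover have "{h p, h (s p)} = {u, t}" using p fK by simp
    ultimately show ?thesis using p(1) by (intro exI[of _ s] exI[of _ ?a] exI[of _ ?b] exI[of _ p]) simp
  qed
  then obtain s1 a1 b1 p1 where c1: "cyclic_doubling I s1 h a1 b1 K" "p1 \<in> I" "{a1 p1, b1 p1} = {f1, f2}"
    "{h p1, h (s1 p1)} = {u, t}" by blast
  obtain s2 a2 b2 p where c2: "cyclic_doubling I s2 h a2 b2 K" "p \<in> I" "h p = u" "h (s2 p) = t"
    "a2 p = a1 p1" "b2 p = b1 p1"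
    using cyclic_doubling.orient[OF c1(1,2,4)] by blast
  then interpret c: cyclic_doubling I s2 h a2 b2 K by simp
  have f12: "{a2 p, b2 p} = {f1, f2}" using c1 c2 by simp
  \<comment> \<open>A fresh index for \<open>w\<close>, inserted between \<open>p\<close> and its
    successor: \<open>e1\<close>, \<open>e2\<close> lead from \<open>u\<close> to \<open>w\<close>
    and \<open>f1\<close>, \<open>f2\<close> on to \<open>t\<close>.\<close>
  obtain z :: nat where z: "z \<notin> I" using finite_I ex_new_if_finite infinite_UNIV_nat by blast
  have zp: "z \<noteq> p" using z c2(2) by auto
  let ?I = "insert z I" and ?s = "s2(p := z, z := s2 p)" and ?h = "h(z := w)"
    and ?a = "a2(p := e1, z := a2 p)" and ?b = "b2(p := e2, z := b2 p)"
  have old: "?h i = h i" if "i \<in> I" for i using that z by auto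
  have "cyclic_doubling ?I ?s ?h ?a ?b H"
  proof
    show "finite ?I" "2 \<le> card ?I" using finite_I card_I z by auto
    show "bij_betw ?s ?I ?I"
    proof -
      have "bij_betw (s2(z := z)) ?I ?I"
        using bij_betw_combine[of "s2(z := z)" I I "{z}" "{z}"] c.bij_s z
        by (metis (no_types, lifting) bij_betw_cong bij_betw_singletonI disjoint_insert(2) fun_upd_other
            fun_upd_same inf_bot_right insert_is_Un sup_commute)
      from bij_swap_at[OF this, of p z] c2(2) zp show ?thesis by (simp add: swap_at_def)
    qed
    have "bij_betw ?h I (verts K)" using bij_betw_cong[of I ?h h "verts K", OF old] bij_h by (rule iffD2)
    then show "bij_betw ?h ?I (verts H)"
      using bij_betw_combine[of ?h I "verts K" "{z}" "{w}"] vK u(2) by (simp add: insert_absorb)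
    have "a2 ` I = insert (a2 p) (a2 ` (I - {p}))" "b2 ` I = insert (b2 p) (b2 ` (I - {p}))" using c2(2) by auto
    moreover have "?a ` ?I = {e1, a2 p} \<union> a2 ` (I - {p})" "?b ` ?I = {e2, b2 p} \<union> b2 ` (I - {p})"
      using z zp c2(2) by auto
    moreover have "edges H = {e1, e2} \<union> edges K" using e eK by auto
    ultimately show "edges H = ?a ` ?I \<union> ?b ` ?I" using c.edges by auto
    have "finite (edges H)" using finite_edges eK by simp
    moreover from this have "card {e1, e2} \<le> card (edges H)" using e by (intro card_mono) auto
    ultimately have "card (edges K) = card (edges H) - 2" "2 \<le> card (edges H)"
      unfolding eK using e by (simp_all add: card_Diff_subset)
    then show "card (edges H) = 2 * card ?I" using card_edges z finite_I e(3) by simp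
    show "Z = ?I" if Z: "Z \<subseteq> ?I" "Z \<noteq> {}" "?s ` Z \<subseteq> Z" for Z
    proof -
      have st: "?s y \<in> Z" if "y \<in> Z" for y using that Z(3) by blast
      have "Z \<inter> I = I"
      proof (rule c.cyclic)
        show "Z \<inter> I \<noteq> {}"
        proof (cases "z \<in> Z")
          case True
          then have "s2 p \<in> Z" using st[of z] zp by simp
          then show ?thesis using c.s_mem[OF c2(2)] by blast
        qed (use Z in auto)
        show "s2 ` (Z \<inter> I) \<subseteq> Z \<inter> I"
        proof
          fix y assume "y \<in> s2 ` (Z \<inter> I)"
          then obtain x where x: "x \<in> Z" "x \<in> I" "y = s2 x" by blast
          have "y \<in> Z"
          proof (cases "x = p")
            case True
            then have "z \<in> Z" using st[OF x(1)] zp by simp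
            then show ?thesis using st[of z] zp True x by simp
          next
            case False
            then show ?thesis using st[OF x(1)] x z by (metis fun_upd_other)
          qed
          then show "y \<in> Z \<inter> I" using x by simp
        qed
      qed simp
      then have "p \<in> Z" using c2(2) by blast
      then have "z \<in> Z" using st[of p] zp by simp
      then show ?thesis using \<open>Z \<inter> I = I\<close> Z(1) by blast
    qed
    fix i assume i: "i \<in> ?I"
    consider "i = z" | "i = p" | "i \<in> I" "i \<noteq> p" "i \<noteq> z" using i z by blast
    then have "ends H (?a i) = {?h i, ?h (?s i)} \<and> ends H (?b i) = {?h i, ?h (?s i)}"
    proof cases
      case 1
      have "ends H (a2 p) = {w, t}" "ends H (b2 p) = {w, t}" using f12 f by (metis insert_iff singletonD)+
      then show ?thesis using 1 zp old[OF c.s_mem[OF c2(2)]] c2 by simp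
    next
      case 2
      then show ?thesis using zp e c2 by simp
    next
      case 3
      have "a2 i \<notin> {a2 p, b2 p}" "b2 i \<notin> {a2 p, b2 p}"
        using 3 c2(2) c.ab_eq_iff by (metis insert_iff singletonD)+
      then have "a2 i \<noteq> f1" "a2 i \<noteq> f2" "b2 i \<noteq> f1" "b2 i \<noteq> f2" unfolding f12 by auto
      moreover have "a2 i \<in> edges K" "b2 i \<in> edges K" using 3 c.edges by auto
      ultimately have "ends H (a2 i) = {h i, h (s2 i)}" "ends H (b2 i) = {h i, h (s2 i)}"
        using oK c.ends_a c.ends_b 3 by metis+
      then show ?thesis using 3 old[OF c.s_mem[OF 3(1)]] by simp
    qed
    then show "ends H (?a i) = {?h i, ?h (?s i)}" "ends H (?b i) = {?h i, ?h (?s i)}" by blast+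
  qed
  then show ?thesis by blast
qed

lemma (in cyclic_doubling) degree_4:
  assumes "3 \<le> card I" "p \<in> I"
  shows "degree G (h (s p)) = 4"
proof -
  have "{e \<in> edges G. h (s p) \<in> ends G e} = {a p, b p, a (s p), b (s p)}"
  proof
    show "{e \<in> edges G. h (s p) \<in> ends G e} \<subseteq> {a p, b p, a (s p), b (s p)}"
    proof
      fix e assume e: "e \<in> {e \<in> edges G. h (s p) \<in> ends G e}"
      then obtain i where i: "i \<in> I" "e = a i \<or> e = b i" "ends G e = {h i, h (s i)}"
        using edge_cases by blast
      then have "s p = i \<or> s p = s i" using e h_eq_iff assms(2) by auto
      then show "e \<in> {a p, b p, a (s p), b (s p)}" using i assms(2) s_eq_iff by auto
    qed
    show "{a p, b p, a (s p), b (s p)} \<subseteq> {e \<in> edges G. h (s p) \<in> ends G e}"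
      using assms(2) ends_a ends_b by (auto simp: edges)
  qed
  moreover have "card {a p, b p, a (s p), b (s p)} = 4"
  proof -
    have "s p \<in> I" "s p \<noteq> p" using assms s_neq by auto
    then have "distinct [a p, b p, a (s p), b (s p)]" using assms(2) ab_eq_iff by (auto dest: sym)
    from distinct_card[OF this] show ?thesis by simp
  qed
  moreover have no: "ends G e \<noteq> {h (s p)}" if "e \<in> edges G" for e
  proof
    assume eq: "ends G e = {h (s p)}"
    from edge_cases[OF that] obtain i where i: "i \<in> I" "ends G e = {h i, h (s i)}" by metis
    then have "h i = h (s i)" using eq by auto
    then show False using i(1) s_neq[OF i(1)] h_eq_iff[of i "s i"] by simp
  qed
  then have none: "{e \<in> edges G. ends G e = {h (s p)}} = {}" by blast
  ultimately show ?thesis unfolding degree_def none by simp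
qed

text \<open>Two consecutive pairs form a doubled path of length 2, with distinct vertices because
  the cycle has length at least 3.\<close>

lemma (in cyclic_doubling) contraction_exists:
  assumes "3 \<le> card I"
  shows "\<exists>I' s' h' a' b' H. cyclic_doubling I' s' h' a' b' H \<and> (I' :: 'i set) \<subseteq> I \<and> card I' = card I - 1 \<and>
    doubled_path_contraction G (H :: ('v, 'e) mgraph)"
proof -
  obtain p where p: "p \<in> I" using card_I by fastforce
  let ?H = "contract G (h p) (h (s p)) {a p, b p}"
  let ?vs = "[h p, h (s p), h (s (s p))]" and ?es = "[(a p, b p), (a (s p), b (s p))]"
  have "doubled_path G ?vs ?es"
    unfolding doubled_path_def
  proof (intro conjI allI impI)
    show "length ?vs = Suc (length ?es)" by simp
    show "distinct ?vs" using p h_eq_iff s_neq s_s_neq[OF p assms] s_neq[of "s p"] by (auto dest: sym)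
    show "set ?vs \<subseteq> verts G" using p h_mem by simp
    fix i assume "i < length ?es"
    then have "i = 0 \<or> i = 1" by auto
    then show "fst (?es ! i) \<in> edges G" "snd (?es ! i) \<in> edges G" "fst (?es ! i) \<noteq> snd (?es ! i)"
      "ends G (fst (?es ! i)) = {?vs ! i, ?vs ! Suc i}" "ends G (snd (?es ! i)) = {?vs ! i, ?vs ! Suc i}"
      using p ends_a ends_b ab_eq_iff(3) by (auto simp: edges)
  next
    fix i assume "0 < i \<and> i < length ?es"
    then have "i = 1" by auto
    then show "degree G (?vs ! i) = 4" using degree_4[OF assms p] by simp
  qed
  then have "doubled_path_contraction G ?H"
    unfolding doubled_path_contraction_def
    by (intro exI[of _ ?vs] exI[of _ ?es] exI[of _ 0]) (simp add: mgraph_iso_refl)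
  moreover have "card (I - {s p}) = card I - 1" using p finite_I by simp
  ultimately show ?thesis using contract_pair[OF assms p] by blast
qed

lemma (in cyclic_doubling) contraction_closed:
  assumes "doubled_path_contraction G H" "multigraph H"
  shows "\<exists>I' s' h' a' b'. cyclic_doubling (I' :: 'i set) s' h' a' b' H"
proof -
  obtain vs es i where dp: "doubled_path G vs es" "2 \<le> length es" "i < length es"
    "H \<cong>\<^sub>m contract G (vs ! i) (vs ! Suc i) {fst (es ! i), snd (es ! i)}"
    using assms(1) unfolding doubled_path_contraction_def by blast
  let ?u = "vs ! i" and ?w = "vs ! Suc i" and ?e1 = "fst (es ! i)" and ?e2 = "snd (es ! i)"
  have vs: "length vs = Suc (length es)" "distinct vs" "set vs \<subseteq> verts G"
    using dp(1) unfolding doubled_path_def by blast+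
  have e: "?e1 \<in> edges G" "?e2 \<in> edges G" "?e1 \<noteq> ?e2" "ends G ?e1 = {?u, ?w}" "ends G ?e2 = {?u, ?w}"
    using dp(1,3) unfolding doubled_path_def by blast+
  have "finite (verts G)" using is_multigraph by (simp add: multigraph_def)
  then have "length vs \<le> card (verts G)" using card_mono[OF _ vs(3)] distinct_card[OF vs(2)] by simp
  \<comment> \<open>A doubled path of length at least 2 has three distinct vertices.\<close>
  then have c3: "3 \<le> card I" using vs(1) dp(2) card_verts by simp
  obtain p where p: "p \<in> I" "{?e1, ?e2} = {a p, b p}" "{h p, h (s p)} = {?u, ?w}"
    using parallel_pair[OF c3 e] by blast
  obtain s' a' b' p' where c': "cyclic_doubling I s' h a' b' G" "p' \<in> I" "h p' = ?u" "h (s' p') = ?w"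
    "a' p' = a p" "b' p' = b p" using orient[OF p(1,3)] by blast
  have "cyclic_doubling (I - {s' p'}) (bypass (s' p') s') h (a'(p' := a' (s' p'))) (b'(p' := b' (s' p')))
     (contract G ?u ?w {?e1, ?e2})"
    using cyclic_doubling.contract_pair[OF c'(1) c3 c'(2)] c' p(2) by simp
  then interpret K: cyclic_doubling "I - {s' p'}" "bypass (s' p') s'" h "a'(p' := a' (s' p'))" "b'(p' := b' (s' p'))"
     "contract G ?u ?w {?e1, ?e2}" .
  have "contract G ?u ?w {?e1, ?e2} \<cong>\<^sub>m H"
    by (rule mgraph_iso_sym[OF _ dp(4)]) (use assms(2) in \<open>simp add: multigraph_def\<close>)
  then show ?thesis using K.transport by blast
qed

text \<open>As the path has length at least 2, one endpoint of the contracted pair is an inner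
  vertex, of degree 4. Its edges are that pair and the neighbouring one, so \<open>G\<close> arises
  from the contracted graph by subdividing the neighbouring pair.\<close>

lemma extension_closed:
  assumes "doubled_path_contraction G H" "multigraph G"
    and H: "\<exists>(I :: nat set) s h a b. cyclic_doubling I s h a b H"
  shows "\<exists>(I :: nat set) s h a b. cyclic_doubling I s h a b G"
proof -
  obtain vs es i where dp: "doubled_path G vs es" "2 \<le> length es" "i < length es"
    "H \<cong>\<^sub>m contract G (vs ! i) (vs ! Suc i) {fst (es ! i), snd (es ! i)}"
    using assms(1) unfolding doubled_path_contraction_def by blast
  have vs: "length vs = Suc (length es)" "distinct vs" "set vs \<subseteq> verts G"
    and deg: "\<And>j. 0 < j \<Longrightarrow> j < length es \<Longrightarrow> degree G (vs ! j) = 4"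
    using dp(1) unfolding doubled_path_def by blast+
  have ed: "fst (es ! j) \<in> edges G" "snd (es ! j) \<in> edges G" "fst (es ! j) \<noteq> snd (es ! j)"
     "ends G (fst (es ! j)) = {vs ! j, vs ! Suc j}" "ends G (snd (es ! j)) = {vs ! j, vs ! Suc j}"
    if "j < length es" for j
    using dp(1) that unfolding doubled_path_def by blast+
  have fin: "finite (edges G)" using assms(2) by (simp add: multigraph_def)
  have inV: "vs ! j \<in> verts G" if "j \<le> length es" for j using that vs by auto
  have neq: "vs ! j = vs ! k \<longleftrightarrow> j = k" if "j \<le> length es" "k \<le> length es" for j k
    using that vs by (simp add: nth_eq_iff_index_eq)
  let ?e1 = "fst (es ! i)" and ?e2 = "snd (es ! i)"
  let ?K = "contract G (vs ! i) (vs ! Suc i) {?e1, ?e2}"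
  have K: "\<exists>(I :: nat set) s h a b. cyclic_doubling I s h a b ?K"
    using H cyclic_doubling.transport[OF _ dp(4)] by blast
  have star: "{e \<in> edges G. w \<in> ends G e} = {e1, e2, f1, f2}"
    if "degree G w = 4" "{e1, e2, f1, f2} \<subseteq> edges G" "e1 \<noteq> e2" "f1 \<noteq> f2"
      "ends G e1 = {u, w}" "ends G e2 = {u, w}" "ends G f1 = {w, t}" "ends G f2 = {w, t}" "u \<noteq> t" "t \<noteq> w"
    for w e1 e2 f1 f2 u t
  proof -
    have "e1 \<noteq> f1" "e1 \<noteq> f2" "e2 \<noteq> f1" "e2 \<noteq> f2" using that(5-) by (auto simp: doubleton_eq_iff)
    then have "distinct [e1, e2, f1, f2]" using that by auto
    from distinct_card[OF this] have "card {e1, e2, f1, f2} = 4" by simp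
    moreover have "card {e \<in> edges G. w \<in> ends G e} \<le> 4" using that(1) unfolding degree_def by simp
    moreover have "{e1, e2, f1, f2} \<subseteq> {e \<in> edges G. w \<in> ends G e}" using that by auto
    ultimately show ?thesis using card_seteq[of "{e \<in> edges G. w \<in> ends G e}" "{e1, e2, f1, f2}"] fin by simp
  qed
  show ?thesis
  proof (cases "Suc i < length es")
    case True
    let ?f1 = "fst (es ! Suc i)" and ?f2 = "snd (es ! Suc i)" and ?t = "vs ! Suc (Suc i)"
    show ?thesis
    proof (rule extend_doubled_cycle[OF K, of ?t ?f1 ?f2])
      show "{e \<in> edges G. vs ! Suc i \<in> ends G e} = {?e1, ?e2, ?f1, ?f2}"
        by (rule star[of "vs ! Suc i" _ _ _ _ "vs ! i" ?t]) (use ed[OF dp(3)] ed[OF True] neq deg True in auto)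
    qed (use ed[OF dp(3)] ed[OF True] neq inV True in auto)
  next
    \<comment> \<open>The pair is the last one, so its inner vertex is the earlier endpoint and the
      two endpoints exchange roles.\<close>
    case False
    define k where "k = i - 1"
    have k: "i = Suc k" "k < length es" using False dp(2,3) by (auto simp: k_def)
    let ?f1 = "fst (es ! k)" and ?f2 = "snd (es ! k)" and ?t = "vs ! k"
    have ne: "vs ! i \<noteq> vs ! Suc i" using neq dp(3) by simp
    have K': "\<exists>(I :: nat set) s h a b. cyclic_doubling I s h a b (contract G (vs ! Suc i) (vs ! i) {?e1, ?e2})"
      using K cyclic_doubling.transport[OF _ contract_swap_iso[OF ne]] by blast
    have E: "ends G ?e1 = {vs ! Suc i, vs ! i}" "ends G ?e2 = {vs ! Suc i, vs ! i}"
      using ed[OF dp(3)] by (simp_all add: insert_commute)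
    have F: "ends G ?f1 = {vs ! i, ?t}" "ends G ?f2 = {vs ! i, ?t}"
      using ed[OF k(2)] k(1) by (simp_all add: insert_commute)
    have n: "vs ! i \<in> verts G" "vs ! Suc i \<in> verts G" "?t \<noteq> vs ! Suc i" "?t \<noteq> vs ! i"
      using neq inV dp(3) k by simp_all
    show ?thesis
    proof (rule extend_doubled_cycle[OF K', of ?t ?f1 ?f2])
      show "{e \<in> edges G. vs ! i \<in> ends G e} = {?e1, ?e2, ?f1, ?f2}"
        by (rule star[of "vs ! i" _ _ _ _ "vs ! Suc i" ?t])
          (use ed(1-3)[OF dp(3)] ed(1-3)[OF k(2)] E F n deg[of i] dp(3) k(1) in auto)
    qed (use ed(1-3)[OF dp(3)] ed(1-3)[OF k(2)] E F n ne in auto)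
  qed
qed

lemma doubled_path_step_closed:
  assumes "doubled_path_step G H" "\<exists>(I :: nat set) s h a b. cyclic_doubling I s h a b H"
  shows "\<exists>(I :: nat set) s h a b. cyclic_doubling I s h a b G"
proof -
  have m: "multigraph G" "multigraph H" "doubled_path_contraction G H \<or> doubled_path_contraction H G"
    using assms(1) by (auto simp: doubled_path_step_def)
  from m(3) show ?thesis
  proof
    assume "doubled_path_contraction H G"
    then show ?thesis using assms(2) cyclic_doubling.contraction_closed m(1) by blast
  qed (use extension_closed m(1) assms(2) in blast)
qed

lemma doubled_cycle_reduces:
  assumes "cyclic_doubling (I :: nat set) s h a b (G :: (nat, nat) mgraph)"
  shows "\<exists>H. doubled_path_step\<^sup>*\<^sup>* G H \<and> multigraph H \<and> H \<cong>\<^sub>m doubled_cycle 2"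
  using assms
proof (induction "card I" arbitrary: I s h a b G rule: less_induct)
  case less
  interpret cyclic_doubling I s h a b G by (rule less.prems)
  show ?case
  proof (cases "card I = 2")
    case True
    then show ?thesis using is_multigraph iso_doubled_cycle' by auto
  next
    case False
    then have c3: "3 \<le> card I" using card_I by simp
    obtain I' s' h' a' b' and H :: "(nat, nat) mgraph" where
      H: "cyclic_doubling (I' :: nat set) s' h' a' b' H" "card I' = card I - 1" "doubled_path_contraction G H"
      using contraction_exists[OF c3] by blast
    have "doubled_path_step G H"
      unfolding doubled_path_step_def using H(3) is_multigraph cyclic_doubling.is_multigraph[OF H(1)] by blast
    moreover obtain H' where "doubled_path_step\<^sup>*\<^sup>* H H'" "multigraph H'" "H' \<cong>\<^sub>m doubled_cycle 2"
      using less.hyps[OF _ H(1)] H(2) c3 by auto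
    ultimately show ?thesis by (meson converse_rtranclp_into_rtranclp)
  qed
qed

lemma nat_doubled_cycle:
  assumes "2 \<le> n"
  shows "\<exists>(I :: nat set) s h a b (G :: (nat, nat) mgraph). cyclic_doubling I s h a b G \<and> card I = n"
proof -
  interpret c: cyclic_doubling "{..<n}" "\<lambda>k. Suc k mod n" "\<lambda>k. k" "\<lambda>k. (k, 0)" "\<lambda>k. (k, 1)" "doubled_cycle n"
    by (rule doubled_cycle_cyclic_doubling[OF assms])
  let ?G = "\<lparr>verts = {..<n}, edges = {..<2 * n}, ends = \<lambda>e. {e div 2, Suc (e div 2) mod n}\<rparr>"
  have "cyclic_doubling {..<n} (\<lambda>k. Suc k mod n) (\<lambda>k. k) (\<lambda>k. 2 * k) (\<lambda>k. 2 * k + 1) ?G"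
  proof
    show "edges ?G = (\<lambda>k. 2 * k) ` {..<n} \<union> (\<lambda>k. 2 * k + 1) ` {..<n}"
    proof
      show "edges ?G \<subseteq> (\<lambda>k. 2 * k) ` {..<n} \<union> (\<lambda>k. 2 * k + 1) ` {..<n}"
      proof
        fix e assume "e \<in> edges ?G"
        then have "e div 2 \<in> {..<n}" "e = 2 * (e div 2) \<or> e = 2 * (e div 2) + 1" by auto
        then show "e \<in> (\<lambda>k. 2 * k) ` {..<n} \<union> (\<lambda>k. 2 * k + 1) ` {..<n}" by blast
      qed
    qed auto
    show "Z = {..<n}" if "Z \<subseteq> {..<n}" "Z \<noteq> {}" "(\<lambda>k. Suc k mod n) ` Z \<subseteq> Z" for Z
      using that by (rule c.cyclic)
    show "bij_betw (\<lambda>k. Suc k mod n) {..<n} {..<n}" by (rule c.bij_s)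
  qed (use assms in \<open>simp_all add: bij_betw_def\<close>)
  then show ?thesis using card_lessThan[of n] by blast
qed

text \<open>Being a doubled cycle of some length is preserved by steps in both directions, and every
  such cycle shrinks to length 2. Odd lengths occur here; parity is settled by the genus.\<close>

lemma doubled_path_equivalent_iff:
  assumes "multigraph G"
  shows "doubled_path_equivalent G (doubled_cycle 2) \<longleftrightarrow> (\<exists>n \<ge> 2. G \<cong>\<^sub>m doubled_cycle n)"
proof
  assume "doubled_path_equivalent G (doubled_cycle 2)"
  then obtain G' H' where GH: "multigraph G'" "G \<cong>\<^sub>m G'" "doubled_path_step\<^sup>*\<^sup>* G' H'"
    "multigraph H'" "H' \<cong>\<^sub>m doubled_cycle 2" unfolding doubled_path_equivalent_def by blast
  from GH(3) have "\<exists>(I :: nat set) s h a b. cyclic_doubling I s h a b G'"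
  proof (induction rule: converse_rtranclp_induct)
    case base
    then show ?case using iso_doubled_cycle_iff[OF GH(4)] GH(5) by blast
  next
    case (step G H)
    then show ?case using doubled_path_step_closed by blast
  qed
  then have "\<exists>n \<ge> 2. G' \<cong>\<^sub>m doubled_cycle n" using iso_doubled_cycle_iff[OF GH(1)] by blast
  then show "\<exists>n \<ge> 2. G \<cong>\<^sub>m doubled_cycle n" using GH(2) mgraph_iso_trans by blast
next
  assume "\<exists>n \<ge> 2. G \<cong>\<^sub>m doubled_cycle n"
  then obtain n where n: "2 \<le> n" "G \<cong>\<^sub>m doubled_cycle n" by blast
  obtain I s h a b and G' :: "(nat, nat) mgraph" where c: "cyclic_doubling (I :: nat set) s h a b G'" "card I = n"
    using nat_doubled_cycle[OF n(1)] by blast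
  have "G \<cong>\<^sub>m G'"
    using mgraph_iso_trans[OF n(2)] cyclic_doubling.iso_doubled_cycle[OF c(1)] c(2) by simp
  then show "doubled_path_equivalent G (doubled_cycle 2)"
    unfolding doubled_path_equivalent_def
    using doubled_cycle_reduces[OF c(1)] cyclic_doubling.is_multigraph[OF c(1)] by blast
qed

section \<open>Maps whose graph is a doubled cycle\<close>

text \<open>With four parallel edges any pairing of them will do.\<close>

lemma two_vertices_four_edges:
  assumes "card (verts G) = 2" "card (edges G) = 4" "\<And>e. e \<in> edges G \<Longrightarrow> ends G e = verts G"
  shows "G \<cong>\<^sub>m doubled_cycle 2"
proof -
  obtain p q where V: "verts G = {p, q}" "p \<noteq> q" using assms(1) by (auto simp: card_2_iff)
  have "finite (edges G)" using assms(2) card.infinite by fastforce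
  then obtain es where es: "set es = edges G" "distinct es" using finite_distinct_list by blast
  then have "length es = 4" using assms(2) distinct_card by fastforce
  then obtain g1 g2 g3 g4 where "es = [g1, g2, g3, g4]"
    by (auto simp: numeral_eq_Suc length_Suc_conv)
  then have E: "edges G = {g1, g2, g3, g4}" using es by auto
  let ?a = "\<lambda>i. if i = p then g1 else g3" and ?b = "\<lambda>i. if i = p then g2 else g4"
  let ?s = "\<lambda>i. if i = p then q else p"
  have "cyclic_doubling {p, q} ?s (\<lambda>i. i) ?a ?b G"
  proof
    show "bij_betw ?s {p, q} {p, q}" using V by (auto simp: bij_betw_def)
    show "bij_betw (\<lambda>i. i) {p, q} (verts G)" using V by (auto simp: bij_betw_def)
    show "edges G = ?a ` {p, q} \<union> ?b ` {p, q}" using E V by auto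
    fix i assume "i \<in> {p, q}"
    then have "{i, ?s i} = verts G" "?a i \<in> edges G" "?b i \<in> edges G" using E V by auto
    then show "ends G (?a i) = {i, ?s i}" "ends G (?b i) = {i, ?s i}" using assms(3) by metis+
  next
    show "2 \<le> card {p, q}" "card (edges G) = 2 * card {p, q}" using V assms(2) by simp_all
  next
    fix Z assume Z: "Z \<subseteq> {p, q}" "Z \<noteq> {}" "?s ` Z \<subseteq> Z"
    have "?s i \<in> Z" if "i \<in> Z" for i using Z(3) that by blast
    from this[of p] this[of q] have "p \<in> Z \<longleftrightarrow> q \<in> Z" using V(2) by auto
    then show "Z = {p, q}" using Z by blast
  qed simp
  from cyclic_doubling.iso_doubled_cycle'[OF this] show ?thesis using V by (simp add: numeral_2_eq_2)
qed

lemma perm_class_bij: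
  assumes "finite S" "bij_betw f S S" "C \<in> classes S (graph_on S f)"
  shows "bij_betw f C C"
proof -
  have CS: "C \<subseteq> S" using assms(3) by (rule classes_subset)
  from classes_rep[OF assms(3)] obtain x where x: "C = class_of S (graph_on S f) x" by blast
  have "f y \<in> C" if "y \<in> C" for y
    unfolding x by (rule class_of_step[of y]) (use that x CS bij_betw_apply[OF assms(2)] in auto)
  then have "f ` C \<subseteq> C" by blast
  moreover have "inj_on f C" using assms(2) CS by (meson bij_betw_imp_inj_on inj_on_subset)
  ultimately show ?thesis using endo_inj_surj[OF finite_subset[OF CS assms(1)]] by (simp add: bij_betw_def)
qed

context reduced_map
begin

lemma face_mem: "x \<in> S \<Longrightarrow> face x \<in> S"
  by simp

lemma col_face: "x \<in> S \<Longrightarrow> col (face x) = (\<not> col x)"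
  by simp

lemma connected_closed:
  assumes "ncomp = 1" "Z \<subseteq> S" "Z \<noteq> {}" "N ` Z \<subseteq> Z" "\<tau> ` Z \<subseteq> Z"
  shows "Z = S"
proof -
  let ?r = "graph_on S N \<union> graph_on S \<tau>"
  obtain x where x: "x \<in> Z" using assms(3) by blast
  have "class_of S ?r x \<subseteq> Z"
    by (rule class_of_subset_closed[OF x])
      (use bij_closed[OF finite_S bij_N assms(2,4)] bij_closed[OF finite_S bij_tau assms(2,5)] in auto)
  moreover obtain C where C: "classes S ?r = {C}" using assms(1) card_1_singletonE by blast
  moreover have "class_of S ?r x \<in> classes S ?r" using x assms(2) by (auto simp: classes_def)
  moreover have "S = C" using classes_Union[of S ?r] C by simp
  ultimately show ?thesis using assms(2) by auto
qed

text \<open>Colours give every face at least two sides, so the count leaves only bigons.\<close>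

lemma faces_all_bigons:
  assumes "card S \<le> 2 * ncyc S face" "x \<in> S"
  shows "face (face x) = x"
proof -
  have sub: "{y, face y} \<subseteq> class_of S (graph_on S face) y" if "y \<in> S" for y
    using that by (auto simp: mem_class_of intro!: eqc_edge)
  have c2: "card {y, face y} = 2" if "y \<in> S" for y
    using col_face[OF that] by (metis card_2_iff)
  have fin: "finite (class_of S (graph_on S face) y)" for y
    using class_of_subset finite_S by (rule finite_subset)
  have "2 \<le> card C" if "C \<in> classes S (graph_on S face)" for C
    using classes_rep[OF that] card_mono[OF fin sub] c2 by force
  moreover have C: "class_of S (graph_on S face) x \<in> classes S (graph_on S face)"
    using assms(2) by (simp add: classes_def)
  ultimately have "card (class_of S (graph_on S face) x) = 2"
    using card_classes_eq[OF finite_S _ assms(1)] by blast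
  then have eq: "class_of S (graph_on S face) x = {x, face x}"
    using card_subset_eq[OF fin sub[OF assms(2)]] c2[OF assms(2)] by simp
  have "face (face x) \<in> class_of S (graph_on S face) x"
    using perm_class_bij[OF finite_S bij_face C] eq bij_betw_apply by fastforce
  moreover have "face (face x) \<noteq> face x"
    using col_face[OF face_mem[OF assms(2)]] by metis
  ultimately show ?thesis unfolding eq by simp
qed

text \<open>If opposite pairs of corners at every vertex are corners of bigons, then every state curve runs through
  at most eight darts: it turns around the two bigons at a vertex and at its two neighbours.\<close>

lemma nstates_ge_aux:
  assumes N4: "\<And>x. x \<in> S \<Longrightarrow> N (N (N (N x))) = x"
    and q1: "\<And>x. x \<in> S \<Longrightarrow> Q x \<Longrightarrow> face (face x) = x"
    and q2: "\<And>x. x \<in> S \<Longrightarrow> Q x \<Longrightarrow> Q (face x)"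
    and q3: "\<And>x. x \<in> S \<Longrightarrow> Q x \<Longrightarrow> Q (N (N x))"
    and q4: "\<And>x. x \<in> S \<Longrightarrow> Q x \<or> Q (N x)"
  shows "card S \<le> 8 * nstates S N \<tau> col"
  unfolding nstates_def
proof (rule card_classes_ge[OF finite_S])
  let ?r = "graph_on S \<tau> \<union> graph_on S zz"
  fix C assume C: "C \<in> classes S ?r"
  have Ninv3: "Ninv x = N (N (N x))" if "x \<in> S" for x
    using that N4[OF that] Ninv_N[of "N (N (N x))"] by simp
  have bigon: "\<tau> (face x) = Ninv x" "face x = \<tau> (Ninv x)" if "x \<in> S" "Q x" for x
  proof -
    have "N (\<tau> (face x)) = x" using q1 that by simp
    then show 1: "\<tau> (face x) = Ninv x" using that Ninv_N[of "\<tau> (face x)"] by simp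
    show "face x = \<tau> (Ninv x)" unfolding 1[symmetric] using that by simp
  qed
  have CS: "C \<subseteq> S" using C by (rule classes_subset)
  from classes_rep[OF C] obtain y where y: "y \<in> S" "C = class_of S ?r y" by blast
  have st: "\<tau> z \<in> C" "zz z \<in> C" if "z \<in> C" for z
    unfolding y(2) by (rule class_of_step[of z]; use that y(2) CS in auto)+
  have "y \<in> C" using y class_of_self by simp
  \<comment> \<open>A dart of the curve with colour true: if \<open>y\<close> has the other colour,
    its partner under the smoothing qualifies.\<close>
  define e where "e = (if col y then y else zz y)"
  have e: "e \<in> C" "e \<in> S" "col e" using \<open>y \<in> C\<close> st(2) y(1) by (auto simp: e_def)
  have "\<exists>x \<in> C. col x \<and> Q x"
  proof (cases "Q e")
    case False
    then have Q: "Q (N e)" using q4 e(2) by blast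
    then have "face (N e) = \<tau> e" using bigon(2)[of "N e"] e(2) by simp
    then have "Q (\<tau> e)" using q2[of "N e"] Q e(2) by simp
    then show ?thesis using st(1)[OF e(1)] e by (intro bexI[of _ "\<tau> e"]) simp_all
  qed (use e in blast)
  then obtain x where x: "x \<in> C" "x \<in> S" "col x" "Q x" using CS by blast
  define a where "a = N x"
  define b where "b = N a"
  have ab: "a \<in> S" "b \<in> S" "\<not> col a" "col b" "Q b" using x q3 by (auto simp: a_def b_def)
  have Nb: "N b = Ninv x" "Ninv b = a"
    using Ninv3[OF x(2)] Ninv_N[OF ab(1)] by (simp_all add: a_def b_def)
  let ?T = "{x, \<tau> x, face x, Ninv x, b, \<tau> b, \<tau> a, a}"
  have tT: "\<tau> z \<in> ?T" if "z \<in> ?T" for z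
    using that bigon[OF x(2,4)] x ab by auto
  have zT: "zz z \<in> ?T" if "z \<in> ?T" for z
  proof -
    have "zz x = a" "zz (\<tau> x) = face x" "zz b = Ninv x" using x ab Nb by (simp_all add: zigzag_def a_def)
    moreover from this have "zz a = x" "zz (face x) = \<tau> x" "zz (Ninv x) = b"
      using zigzag_zigzag[of x] zigzag_zigzag[of "\<tau> x"] zigzag_zigzag[of b] x ab by simp_all
    moreover have "zz (\<tau> b) = \<tau> a" using ab bigon(2)[OF ab(2,5)] Nb(2) by (simp add: zigzag_def)
    moreover from this have "zz (\<tau> a) = \<tau> b" using zigzag_zigzag[of "\<tau> b"] ab by simp
    ultimately show ?thesis using that by auto
  qed
  have "class_of S ?r x \<subseteq> ?T"
  proof (rule class_of_subset_closed)
    fix u w assume "(u, w) \<in> ?r"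
    then have u: "u \<in> S" and "w = \<tau> u \<or> w = zz u" by auto
    moreover have "\<tau> u \<in> ?T \<longleftrightarrow> u \<in> ?T" using tT[of u] tT[of "\<tau> u"] u by (metis tau_tau)
    moreover have "zz u \<in> ?T \<longleftrightarrow> u \<in> ?T" using zT[of u] zT[of "zz u"] u by (metis zigzag_zigzag)
    ultimately show "u \<in> ?T \<longleftrightarrow> w \<in> ?T" by metis
  qed simp
  moreover have "C = class_of S ?r x" using C x(1) by (rule class_eq_of_mem)
  ultimately have "card C \<le> card ?T" by (simp add: card_mono)
  also have "card ?T \<le> card (set [x, \<tau> x, face x, Ninv x, b, \<tau> b, \<tau> a, a])" by simp
  also have "\<dots> \<le> 8" using card_length[of "[x, \<tau> x, face x, Ninv x, b, \<tau> b, \<tau> a, a]"] by simp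
  finally show "card C \<le> 8" .
qed

lemma nstates_ge:
  assumes "\<And>x. x \<in> S \<Longrightarrow> N (N (N (N x))) = x"
    and "\<And>x. x \<in> S \<Longrightarrow> Q x \<Longrightarrow> face (face x) = x"
    and "\<And>x. x \<in> S \<Longrightarrow> Q x \<Longrightarrow> Q (face x)"
    and "\<And>x. x \<in> S \<Longrightarrow> Q x \<Longrightarrow> Q (N (N x))"
    and "\<And>x. x \<in> S \<Longrightarrow> Q x \<or> Q (N x)"
  shows "card S = 8 * nstates S N \<tau> col" "card S = 8 * nstates S N \<tau> (\<lambda>x. \<not> col x)"
proof -
  interpret neg: reduced_map S N \<tau> "\<lambda>x. \<not> col x" by (rule negate_reduced)
  show "card S = 8 * nstates S N \<tau> col"
    using nstates_ge_aux[of Q, OF assms] nstates_le by simp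
  show "card S = 8 * nstates S N \<tau> (\<lambda>x. \<not> col x)"
    using neg.nstates_ge_aux[of Q, OF assms] neg.nstates_le by simp
qed

end

section \<open>The graph of a map of genus one\<close>

locale map_graph = reduced_map S N \<tau> col
  for S :: "'a set" and N \<tau> :: "'a \<Rightarrow> 'a" and col :: "'a \<Rightarrow> bool" +
  fixes v :: "'a \<Rightarrow> 'v" and G :: "('v, 'a set) mgraph"
  assumes v_eq_iff: "x \<in> S \<Longrightarrow> y \<in> S \<Longrightarrow> v x = v y \<longleftrightarrow> (x, y) \<in> eqc (graph_on S N)"
    and verts: "verts G = v ` S"
    and edges: "edges G = (\<lambda>x. {x, \<tau> x}) ` S"
    and ends: "x \<in> S \<Longrightarrow> ends G {x, \<tau> x} = {v x, v (\<tau> x)}"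
begin

lemma v_N [simp]: "x \<in> S \<Longrightarrow> v (N x) = v x"
  by (subst v_eq_iff) (auto intro!: eqc_edge_rev)

lemma v_Ninv [simp]: "x \<in> S \<Longrightarrow> v (Ninv x) = v x"
  using v_N[of "Ninv x"] by simp

lemma card_verts: "card (verts G) = ncyc S N"
  unfolding verts classes_def
  by (rule card_image_eq_kernel) (simp add: v_eq_iff class_of_eq_iff)

lemma card_edges: "2 * card (edges G) = card S"
proof -
  have "edges G = classes S (graph_on S \<tau>)"
    unfolding edges classes_def by (rule image_cong) (simp_all add: class_tau)
  then show ?thesis using ncyc_tau by simp
qed

lemma v_class:
  assumes "card S \<le> 4 * ncyc S N" "x \<in> S" "y \<in> S" "v y = v x"
  shows "y = x \<or> y = N x \<or> y = N (N x) \<or> y = N (N (N x))"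
proof -
  have "y \<in> class_of S (graph_on S N) x" using assms(2-4) v_eq_iff[of x y] by (simp add: mem_class_of)
  then show ?thesis unfolding vertex_cycle(2)[OF assms(1,2)] by simp
qed

text \<open>Crossing a bigon and taking the opposite corner leads to the next bigon. For at least
  three vertices an orbit of this move is the cyclic index set.\<close>

lemma forward:
  assumes sd: "state_defect S N \<tau> col = 2"
  shows "\<exists>n \<ge> 2. even n \<and> G \<cong>\<^sub>m doubled_cycle n"
proof -
  note K1 = state_defect_2(1)[OF sd]
  let ?V = "ncyc S N"
  have SV: "card S = 4 * ?V" "card S \<le> 4 * ?V" using state_defect_2[OF sd] by simp_all
  have S0: "S \<noteq> {}"
  proof
    assume "S = {}"
    then show False using K1 by (simp add: classes_def)
  qed
  have "4 * ?V = 8 * nstates S N \<tau> col" using state_defect_2[OF sd] by simp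
  \<comment> \<open>Every state curve has 8 darts and every vertex 4; this makes the length of the
    cycle even.\<close>
  then have V: "?V = 2 * nstates S N \<tau> col" by simp
  have "card S > 0" using S0 finite_S by (simp add: card_gt_0_iff)
  then have V2: "2 \<le> ?V" using V SV by simp
  have N4: "N (N (N (N x))) = x" if "x \<in> S" for x using vertex_cycle(3)[OF SV(2) that] .
  have Ninv3: "Ninv x = N (N (N x))" if "x \<in> S" for x
    using that N4[OF that] Ninv_N[of "N (N (N x))"] by simp
  have bigon: "\<tau> (face x) = Ninv x" "face x = \<tau> (Ninv x)" if "x \<in> S" "face (face x) = x" for x
  proof -
    show 1: "\<tau> (face x) = Ninv x" using that Ninv_N[of "\<tau> (face x)"] by simp
    show "face x = \<tau> (Ninv x)" unfolding 1[symmetric] using that by simp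
  qed
  have "G \<cong>\<^sub>m doubled_cycle ?V"
  proof (cases "?V = 2")
    case True
    \<comment> \<open>Two vertices have 8 darts, so Euler's formula gives 4 faces and all of them
      are bigons.\<close>
    have "card S \<le> 2 * ncyc S face" using euler K1 SV True by simp
    note W = faces_all_bigons[OF this]
    have vt: "v (\<tau> (N x)) = v (\<tau> x)" if "x \<in> S" for x
      using bigon(2)[of "N x"] W[of "N x"] that v_N[of "\<tau> (N x)"] by simp
    have ne: "v (\<tau> x) \<noteq> v x" if x: "x \<in> S" for x
    proof
      assume eq: "v (\<tau> x) = v x"
      let ?Z = "{y \<in> S. v y = v x \<and> v (\<tau> y) = v x}"
      have "?Z = S" by (rule connected_closed[OF K1]) (use x eq vt in auto)
      then have "verts G = {v x}" unfolding verts using x by auto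
      then show False using card_verts True by simp
    qed
    have "G \<cong>\<^sub>m doubled_cycle 2"
    proof (rule two_vertices_four_edges)
      show cV: "card (verts G) = 2" using card_verts True by simp
      show "card (edges G) = 4" using card_edges SV True by simp
      fix e assume "e \<in> edges G"
      then obtain x where x: "x \<in> S" "e = {x, \<tau> x}" unfolding edges by blast
      have "card {v x, v (\<tau> x)} = 2" using ne[OF x(1)] by (metis card_2_iff)
      moreover have "{v x, v (\<tau> x)} \<subseteq> verts G" using x by (simp add: verts)
      ultimately have "{v x, v (\<tau> x)} = verts G"
        using card_subset_eq[of "verts G" "{v x, v (\<tau> x)}"] cV finite_S by (simp add: verts)
      then show "ends G e = verts G" using x ends by simp
    qed
    then show ?thesis using True by simp
  next
    case False
    then have V3: "3 \<le> ?V" using V2 by simp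
    \<comment> \<open>As \<open>Ninv\<close> is the third power of \<open>N\<close>, this crosses
      from \<open>x\<close> to \<open>face x\<close> and takes the opposite corner there.\<close>
    define \<rho> where "\<rho> = (\<lambda>y. Ninv (\<tau> y))"
    have br: "bij_betw \<rho> S S"
      using bij_betw_trans[OF bij_tau bij_betw_inv_into[OF bij_N]] by (simp add: \<rho>_def comp_def)
    have rmem: "\<rho> y \<in> S" if "y \<in> S" for y using that by (simp add: \<rho>_def)
    define W where "W = {x \<in> S. face (face x) = x}"
    have WS: "x \<in> S" if "x \<in> W" for x using that by (simp add: W_def)
    have Wb: "\<tau> (face x) = Ninv x" "face x = \<tau> (Ninv x)" if "x \<in> W" for x
      using bigon that by (auto simp: W_def)
    have Wf: "face x \<in> W" if "x \<in> W" for x using that by (simp add: W_def)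
    have WN: "N (N x) \<in> W" if "x \<in> W" for x using that bigon_opposite[OF sd] by (simp add: W_def)
    have rNN: "\<rho> x = N (N (face x))" if "x \<in> S" for x using that Ninv3 by (simp add: \<rho>_def)
    have Wr: "\<rho> x \<in> W" if "x \<in> W" for x using that WN[OF Wf[OF that]] rNN WS by simp
    have rface: "\<rho> (face x) = N (N x)" if "x \<in> W" for x
    proof -
      have "\<rho> (face x) = Ninv (Ninv x)" using Wb(1)[OF that] by (simp add: \<rho>_def)
      also have "\<dots> = N (N x)" using Ninv3[of x] Ninv3[of "Ninv x"] WS[OF that] by simp
      finally show ?thesis .
    qed
    \<comment> \<open>Two adjacent bigon corners make all four corners at the vertex bigons. Then
      the vertex and a single neighbour form a whole component, with too few vertices.\<close>
    have not_both: "N x \<notin> W" if x: "x \<in> W" for x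
    proof
      assume "N x \<in> W"
      then have x4: "x \<in> W" "N x \<in> W" "N (N x) \<in> W" "N (N (N x)) \<in> W" using x WN by auto
      have xS: "x \<in> S" using x WS by simp
      have t: "N (\<tau> x) = \<tau> (N (N (N x)))" "N (\<tau> (N (N (N x)))) = \<tau> (N (N x))" "N (\<tau> (N (N x))) = \<tau> (N x)"
        using Wb(2)[OF x4(1)] Ninv3[OF xS] Wb(2)[OF x4(4)] Wb(2)[OF x4(3)] xS by simp_all
      have vt: "v (\<tau> (N x)) = v (\<tau> x)" "v (\<tau> (N (N x))) = v (\<tau> x)" "v (\<tau> (N (N (N x)))) = v (\<tau> x)"
        using t xS v_N[of "\<tau> x"] v_N[of "\<tau> (N (N (N x)))"] v_N[of "\<tau> (N (N x))"] by auto
      let ?U = "{y \<in> S. v y = v x \<or> v y = v (\<tau> x)}"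
      have "\<tau> y \<in> ?U" if y: "y \<in> ?U" for y
      proof (cases "v y = v x")
        case True
        then have "y = x \<or> y = N x \<or> y = N (N x) \<or> y = N (N (N x))"
          using v_class[OF SV(2) xS] y by blast
        then have "v (\<tau> y) = v (\<tau> x)" using vt by auto
        then show ?thesis using y by simp
      next
        case False
        then have "y = \<tau> x \<or> y = N (\<tau> x) \<or> y = N (N (\<tau> x)) \<or> y = N (N (N (\<tau> x)))"
          using v_class[OF SV(2), of "\<tau> x" y] y xS by auto
        then have "y = \<tau> x \<or> y = \<tau> (N (N (N x))) \<or> y = \<tau> (N (N x)) \<or> y = \<tau> (N x)" using t by auto
        then have "v (\<tau> y) = v x" using xS by auto
        then show ?thesis using y by simp
      qed
      then have "?U = S" by (intro connected_closed[OF K1]) (use xS in auto)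
      then have "verts G \<subseteq> {v x, v (\<tau> x)}" unfolding verts by auto
      then have "card (verts G) \<le> card {v x, v (\<tau> x)}" by (rule card_mono[rotated]) simp
      also have "\<dots> \<le> 2" by (simp add: card_insert_if)
      finally show False using card_verts V3 by simp
    qed
    obtain x0 where x0: "x0 \<in> W" using bigon_exists[OF sd] by (auto simp: W_def)
    define X where "X = class_of S (graph_on S \<rho>) x0"
    have XC: "X \<in> classes S (graph_on S \<rho>)" using WS[OF x0] by (simp add: X_def classes_def)
    have XW: "X \<subseteq> W"
      unfolding X_def by (rule class_of_perm_subset[OF finite_S br]) (use WS Wr x0 in auto)
    then have XS: "X \<subseteq> S" using WS by blast
    have bX: "bij_betw \<rho> X X" by (rule perm_class_bij[OF finite_S br XC])
    have Xr: "\<rho> x \<in> X \<longleftrightarrow> x \<in> X" if "x \<in> S" for x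
      by (rule bij_closed[OF finite_S br XS _ that]) (use bX in \<open>simp add: bij_betw_def\<close>)
    have Xpre: "\<exists>y \<in> X. x = \<rho> y" if "x \<in> X" for x using bX that by (auto simp: bij_betw_def)
    \<comment> \<open>The orbit never turns round inside a bigon. Since \<rho> sends
      \<open>face (\<rho> x)\<close> to \<open>face x\<close>, reaching \<open>face x\<close> after
      \<open>k\<close> steps means reaching \<open>face (\<rho> x)\<close> from
      \<open>\<rho> x\<close> after \<open>k - 2\<close>. Colours exclude 0 steps and vertex degrees
      exclude 1.\<close>
    have no_turn: "face x \<noteq> (\<rho> ^^ k) x" if "x \<in> W" for k x
      using that
    proof (induction k arbitrary: x rule: less_induct)
      case (less k)
      have x: "x \<in> S" using less.prems WS by blast
      consider "k = 0" | "k = 1" | j where "k = Suc (Suc j)" by (metis One_nat_def not0_implies_Suc)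
      then show ?case
      proof cases
        case 1
        then show ?thesis using col_face[OF x] by auto
      next
        case 2
        show ?thesis
        proof
          assume "face x = (\<rho> ^^ k) x"
          then have "N (N (\<tau> x)) = \<tau> x" using 2 x by (simp add: \<rho>_def)
          then show False using N_N_neq[of "\<tau> x"] x by simp
        qed
      next
        case 3
        have rx: "\<rho> x \<in> W" "\<rho> x \<in> S" using less.prems Wr WS by blast+
        have "\<rho> (face (\<rho> x)) = N (N (\<rho> x))" by (rule rface[OF rx(1)])
        also have "\<dots> = face x" using rNN[OF x] N4[of "face x"] x by simp
        finally have 1: "\<rho> (face (\<rho> x)) = face x" .
        have "(\<rho> ^^ k) x = \<rho> ((\<rho> ^^ j) (\<rho> x))" using 3 by (simp add: funpow_swap1)
        moreover have "(\<rho> ^^ j) (\<rho> x) \<in> S" "face (\<rho> x) \<in> S" using funpow_mem[OF br rx(2)] rx(2) by simp_all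
        moreover have "face (\<rho> x) \<noteq> (\<rho> ^^ j) (\<rho> x)" using less.IH[of j "\<rho> x"] 3 rx by simp
        ultimately show ?thesis using 1 br by (metis bij_betw_imp_inj_on inj_on_eq_iff)
      qed
    qed
    have fX: "face x \<notin> X" if "x \<in> X" for x
    proof
      assume "face x \<in> X"
      moreover have "X = class_of S (graph_on S \<rho>) x" using XC that by (rule class_eq_of_mem)
      ultimately have "face x \<in> {(\<rho> ^^ k) x |k. True}" using class_of_perm[OF finite_S br, of x] that XS by blast
      then show False using no_turn[of x] that XW by blast
    qed
    \<comment> \<open>Of the other three darts at the vertex, two are no bigon corners, and the
      opposite one is \<open>\<rho> (face x)\<close>, which belongs to the orbit in the reverse
      direction.\<close>
    have inj: "inj_on v X"
    proof (rule inj_onI)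
      fix x y assume xy: "x \<in> X" "y \<in> X" "v x = v y"
      have xW: "x \<in> W" "y \<in> W" "x \<in> S" using xy XW WS by blast+
      have "y = x \<or> y = N x \<or> y = N (N x) \<or> y = N (N (N x))"
        using v_class[OF SV(2), of x y] xy XS by auto
      moreover have "y \<noteq> N x" using not_both xW by blast
      moreover have "y \<noteq> N (N (N x))" using not_both[OF xW(2)] N4[OF xW(3)] xW(1) by auto
      moreover have "y \<noteq> N (N x)" using rface[OF xW(1)] Xr[of "face x"] fX[OF xy(1)] xW(3) xy(2) by auto
      ultimately show "x = y" by blast
    qed
    have vr: "v (\<rho> x) = v (\<tau> x)" "v (\<tau> (face x)) = v x" if "x \<in> W" for x
      using that WS Wb(1) by (simp_all add: \<rho>_def)
    let ?a = "\<lambda>x. {x, \<tau> x}" and ?b = "\<lambda>x. {face x, \<tau> (face x)}"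
    \<comment> \<open>The four darts at a vertex of the orbit are those of the two bigons meeting
      there, so all its edges and neighbours belong to the cycle.\<close>
    have star: "v (\<tau> y) \<in> v ` X \<and> {y, \<tau> y} \<in> ?a ` X \<union> ?b ` X" if y: "y \<in> S" "x \<in> X" "v y = v x" for x y
    proof -
      have x: "x \<in> S" "x \<in> W" using y XW WS by blast+
      obtain z where z: "z \<in> X" "x = \<rho> z" using Xpre[OF y(2)] by blast
      have zW: "z \<in> W" "z \<in> S" using z XW WS by blast+
      have rx: "\<rho> x \<in> X" using Xr[OF x(1)] y(2) by simp
      have Nx: "N x = \<tau> z" "N (N x) = face z" using z zW by (simp_all add: \<rho>_def)
      have N3: "N (N (N x)) = \<tau> (face x)" using Ninv3[OF x(1)] Wb(1)[OF x(2)] by simp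
      consider "y = x" | "y = N x" | "y = N (N x)" | "y = N (N (N x))"
        using v_class[OF SV(2) x(1) y(1,3)] by blast
      then show ?thesis
      proof cases
        case 1
        have "v (\<rho> x) \<in> v ` X" using rx by (rule imageI)
        moreover have "?a x \<in> ?a ` X" using y(2) by (rule imageI)
        ultimately show ?thesis using vr(1)[OF x(2)] 1 by simp
      next
        case 2
        then have "\<tau> y = z" "{y, \<tau> y} = ?a z" using Nx zW by auto
        then show ?thesis using z(1) by blast
      next
        case 3
        then have "v (\<tau> y) = v z" "{y, \<tau> y} = ?b z" using Nx vr(2)[OF zW(1)] by auto
        then show ?thesis using z(1) by blast
      next
        case 4
        then have "\<tau> y = face x" "{y, \<tau> y} = ?b x" using N3 x by auto
        moreover from this have "v (\<tau> y) = v (\<rho> x)" using vr(1)[OF x(2)] x(1) by simp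
        ultimately show ?thesis using rx y(2) by blast
      qed
    qed
    have "{y \<in> S. v y \<in> v ` X} = S"
    proof (rule connected_closed[OF K1])
      show "{y \<in> S. v y \<in> v ` X} \<noteq> {}" using XS classes_nonempty[OF XC] by blast
      show "N ` {y \<in> S. v y \<in> v ` X} \<subseteq> {y \<in> S. v y \<in> v ` X}" by auto
      show "\<tau> ` {y \<in> S. v y \<in> v ` X} \<subseteq> {y \<in> S. v y \<in> v ` X}"
      proof
        fix z assume "z \<in> \<tau> ` {y \<in> S. v y \<in> v ` X}"
        then obtain y x where "y \<in> S" "z = \<tau> y" "x \<in> X" "v y = v x" by blast
        then show "z \<in> {y \<in> S. v y \<in> v ` X}" using star[of y x] by simp
      qed
    qed simp
    then have all: "\<exists>x \<in> X. v y = v x" if "y \<in> S" for y using that by blast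
    have vX: "verts G = v ` X" unfolding verts using all XS by (auto simp: image_iff)
    have cX: "card X = ?V" using card_image[OF inj] vX card_verts by simp
    have "cyclic_doubling X \<rho> v ?a ?b G"
    proof
      show "finite X" using XS finite_S by (rule finite_subset)
      show "2 \<le> card X" using cX V2 by simp
      show "bij_betw \<rho> X X" by (rule bX)
      show "bij_betw v X (verts G)" using inj vX by (simp add: bij_betw_def)
      show "card (edges G) = 2 * card X" using card_edges SV(1) cX by simp
      show "edges G = ?a ` X \<union> ?b ` X"
      proof
        show "edges G \<subseteq> ?a ` X \<union> ?b ` X"
        proof
          fix e assume "e \<in> edges G"
          then obtain y where y: "y \<in> S" "e = {y, \<tau> y}" unfolding edges by blast
          obtain x where "x \<in> X" "v y = v x" using all[OF y(1)] by blast
          then show "e \<in> ?a ` X \<union> ?b ` X" using star[OF y(1)] y(2) by blast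
        qed
        show "?a ` X \<union> ?b ` X \<subseteq> edges G" unfolding edges using XS face_mem by blast
      qed
      show "Z = X" if Z: "Z \<subseteq> X" "Z \<noteq> {}" "\<rho> ` Z \<subseteq> Z" for Z
      proof -
        obtain z where z: "z \<in> Z" using Z(2) by blast
        have "class_of S (graph_on S \<rho>) z \<subseteq> Z"
          by (rule class_of_perm_subset[OF finite_S br _ Z(3) z]) (use Z(1) XS in blast)
        moreover have "X = class_of S (graph_on S \<rho>) z" by (rule class_eq_of_mem[OF XC]) (use z Z(1) in blast)
        ultimately show ?thesis using Z(1) by blast
      qed
      fix x assume "x \<in> X"
      then have x: "x \<in> S" "x \<in> W" using XW WS by blast+
      show "ends G (?a x) = {v x, v (\<rho> x)}" using ends[OF x(1)] vr(1)[OF x(2)] by simp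
      show "ends G (?b x) = {v x, v (\<rho> x)}"
        using ends[of "face x"] vr[OF x(2)] x(1) by (simp add: insert_commute)
    qed
    from cyclic_doubling.iso_doubled_cycle'[OF this] show ?thesis using cX by simp
  qed
  then show ?thesis using V V2 by (intro exI[of _ ?V]) simp
qed

end

section \<open>Discharging on planar maps of doubled cycles\<close>

locale doubled_cycle_map = map_graph +
  fixes n :: nat and f g
  assumes n2: "2 \<le> n"
    and bij_f: "bij_betw f (verts G) (verts (doubled_cycle n))"
    and bij_g: "bij_betw g (edges G) (edges (doubled_cycle n))"
    and ends_g: "e \<in> edges G \<Longrightarrow> ends (doubled_cycle n) (g e) = f ` ends G e"
begin

definition pos :: "'a \<Rightarrow> nat" where "pos x = f (v x)"
text \<open>The direction of a dart is read off from this edge index, since for \<open>n = 2\<close>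
  the successor of a vertex is also its predecessor.\<close>

definition idx :: "'a \<Rightarrow> nat" where "idx x = fst (g {x, \<tau> x})"

text \<open>The darts pointing from a vertex to its successor on the cycle.\<close>

definition dir :: "'a \<Rightarrow> bool" where "dir x \<longleftrightarrow> pos x = idx x"

lemma pos_less: "x \<in> S \<Longrightarrow> pos x < n"
  using bij_betw_apply[OF bij_f] by (force simp: pos_def verts doubled_cycle_def)

lemma pos_N: "x \<in> S \<Longrightarrow> pos (N x) = pos x"
  by (simp add: pos_def)

lemma idx_tau: "x \<in> S \<Longrightarrow> idx (\<tau> x) = idx x"
  by (simp add: idx_def insert_commute)

lemma idx_less: "x \<in> S \<Longrightarrow> idx x < n"
  using bij_betw_apply[OF bij_g, of "{x, \<tau> x}"] by (auto simp: idx_def edges doubled_cycle_def)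

lemma pos_ends: "x \<in> S \<Longrightarrow> {pos x, pos (\<tau> x)} = {idx x, Suc (idx x) mod n}"
  using ends_g[of "{x, \<tau> x}"] ends[of x]
  by (auto simp: edges idx_def pos_def doubled_cycle_def case_prod_beta)

lemma Suc_mod_neq: "k < n \<Longrightarrow> Suc k mod n \<noteq> k"
  using n2 by (auto simp: mod_Suc)

lemma Suc_mod_inj: "k < n \<Longrightarrow> l < n \<Longrightarrow> Suc k mod n = Suc l mod n \<Longrightarrow> k = l"
  by (auto simp: mod_Suc split: if_splits)

lemma pos_dir: "x \<in> S \<Longrightarrow> dir x \<Longrightarrow> pos (\<tau> x) = Suc (pos x) mod n"
  "x \<in> S \<Longrightarrow> \<not> dir x \<Longrightarrow> pos x = Suc (pos (\<tau> x)) mod n"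
  using pos_ends[of x] Suc_mod_neq[OF idx_less[of x]] by (auto simp: dir_def doubleton_eq_iff)

lemma dir_tau: "x \<in> S \<Longrightarrow> dir (\<tau> x) = (\<not> dir x)"
  using pos_ends[of x] Suc_mod_neq[OF idx_less[of x]] idx_tau[of x] by (auto simp: dir_def doubleton_eq_iff)

lemma card_S: "card S = 4 * n" "ncyc S N = n"
proof -
  have "card (verts G) = n" using bij_betw_same_card[OF bij_f] by (simp add: doubled_cycle_def)
  then show "ncyc S N = n" using card_verts by simp
  have "card (edges G) = 2 * n" using bij_betw_same_card[OF bij_g] by (simp add: doubled_cycle_def card_cartesian_product)
  then show "card S = 4 * n" using card_edges by simp
qed

lemma N4: "x \<in> S \<Longrightarrow> N (N (N (N x))) = x"
  using vertex_cycle(3) card_S by simp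

lemma card_faces: "ncyc S face = 2 * ncomp + n"
  using euler card_S by simp

lemma S_nonempty: "S \<noteq> {}"
  using card_S n2 by auto

text \<open>Equal vertex and equal direction determine the edge index, and only two edges have this
  index.\<close>

lemma same_vertex_dir:
  assumes "A \<subseteq> S" "\<And>x. x \<in> A \<Longrightarrow> pos x = k" "\<And>x y. x \<in> A \<Longrightarrow> y \<in> A \<Longrightarrow> dir x = dir y"
  shows "card A \<le> 2"
proof (cases "A = {}")
  case False
  then obtain x0 where x0: "x0 \<in> A" by blast
  have idx: "idx x = idx x0" if x: "x \<in> A" for x
  proof (cases "dir x")
    case True
    then show ?thesis using assms(2)[OF x] assms(2)[OF x0] assms(3)[OF x x0] by (simp add: dir_def)
  next
    case False
    then have "\<not> dir x0" using assms(3)[OF x x0] by simp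
    have "pos y = Suc (idx y) mod n" if "y \<in> A" "\<not> dir y" for y
      using pos_ends[of y] that assms(1) by (auto simp: dir_def doubleton_eq_iff)
    then have "Suc (idx x) mod n = Suc (idx x0) mod n"
      using assms(2)[OF x] assms(2)[OF x0] x x0 False \<open>\<not> dir x0\<close> by metis
    then show ?thesis by (rule Suc_mod_inj[rotated 2]) (use idx_less assms(1) x x0 in auto)
  qed
  let ?e = "\<lambda>x. g {x, \<tau> x}"
  have "inj_on ?e A"
  proof (rule inj_onI)
    fix x y assume xy: "x \<in> A" "y \<in> A" "?e x = ?e y"
    have "{x, \<tau> x} \<in> edges G" "{y, \<tau> y} \<in> edges G" using xy assms(1) by (auto simp: edges)
    then have "{x, \<tau> x} = {y, \<tau> y}" using xy(3) bij_g by (meson bij_betw_imp_inj_on inj_onD)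
    moreover have "x \<noteq> \<tau> y" using dir_tau[of y] assms(3)[OF xy(1,2)] xy(2) assms(1) by auto
    ultimately show "x = y" by (auto simp: doubleton_eq_iff)
  qed
  moreover have "?e ` A \<subseteq> {idx x0} \<times> {..<2}"
  proof
    fix p assume "p \<in> ?e ` A"
    then obtain x where x: "x \<in> A" "p = ?e x" by blast
    have "?e x \<in> edges (doubled_cycle n)" by (rule bij_betw_apply[OF bij_g]) (use x assms(1) edges in auto)
    then show "p \<in> {idx x0} \<times> {..<2}" using idx[OF x(1)] x(2) by (auto simp: idx_def doubled_cycle_def mem_Times_iff)
  qed
  ultimately have "card A \<le> card ({idx x0} \<times> {..<2::nat})" by (intro card_inj_on_le) auto
  then show ?thesis by (simp add: card_cartesian_product)
qed simp

lemma distinct_vertex: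
  assumes "x \<in> S"
  shows "distinct [x, N x, N (N x), N (N (N x))]"
proof -
  have "col (N x) = (\<not> col x)" "col (N (N x)) = col x" "col (N (N (N x))) = (\<not> col x)" using assms by simp_all
  then have "N x \<noteq> x" "N (N (N x)) \<noteq> x" "N (N x) \<noteq> N x" "N (N (N x)) \<noteq> N (N x)" by auto
  then show ?thesis using N_N_neq[OF assms] N_N_neq[of "N x"] assms by (auto dest: sym)
qed

lemma not_three:
  assumes "x \<in> S" "y \<in> S" "z \<in> S" "distinct [x, y, z]" "pos y = pos x" "pos z = pos x"
  shows "\<not> (dir x = dir y \<and> dir y = dir z)"
proof
  assume "dir x = dir y \<and> dir y = dir z"
  then have "card {x, y, z} \<le> 2" using assms by (intro same_vertex_dir[where k = "pos x"]) auto
  moreover have "card {x, y, z} = 3" using assms(4) by simp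
  ultimately show False by simp
qed

text \<open>Of the four darts at a vertex two point each way; in cyclic order the directions either
  alternate or come in two adjacent pairs.\<close>

lemma vertex_dirs:
  assumes "x \<in> S"
  shows "\<not> (dir x = dir (N x) \<and> dir (N x) = dir (N (N x)))"
    and "dir (N (N (N x))) = dir x \<longleftrightarrow> dir (N (N x)) = dir (N x)"
proof -
  have d: "distinct [x, N x, N (N x), N (N (N x))]" by (rule distinct_vertex[OF assms])
  have S: "N x \<in> S" "N (N x) \<in> S" "N (N (N x)) \<in> S" using assms by simp_all
  have p: "pos (N x) = pos x" "pos (N (N x)) = pos x" "pos (N (N (N x))) = pos x" using assms S pos_N by simp_all
  have 1: "\<not> (dir x = dir (N x) \<and> dir (N x) = dir (N (N x)))"
    by (rule not_three) (use assms S d p in auto)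
  moreover have "\<not> (dir x = dir (N x) \<and> dir (N x) = dir (N (N (N x))))"
    by (rule not_three) (use assms S d p in auto)
  moreover have "\<not> (dir x = dir (N (N x)) \<and> dir (N (N x)) = dir (N (N (N x))))"
    by (rule not_three) (use assms S d p in auto)
  moreover have "\<not> (dir (N x) = dir (N (N x)) \<and> dir (N (N x)) = dir (N (N (N x))))"
    by (rule not_three) (use assms S d p in auto)
  ultimately show "\<not> (dir x = dir (N x) \<and> dir (N x) = dir (N (N x)))"
    "dir (N (N (N x))) = dir x \<longleftrightarrow> dir (N (N x)) = dir (N x)" by blast+
qed

text \<open>Discharging. The corner of a face where it turns back gets weight \<open>1/2\<close>, every other corner gets
  \<open>1/n\<close>. Then every face has weight at least 1, because it either turns twice or winds around the cycle,
  and every vertex has weight at most \<open>1 + 2/n\<close>.\<close>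

definition weight :: "'a \<Rightarrow> real" where
  "weight x = (if dir (face x) = dir x then 1 / real n else 1 / 2)"

lemma weight_pos: "0 < weight x"
  using n2 by (simp add: weight_def)

text \<open>\<open>\<tau> x\<close> is followed on its face by \<open>N x\<close>, so it represents
  the corner between \<open>x\<close> and \<open>N x\<close>; the face turns back there if both
  point the same way.\<close>

lemma weight_tau: "x \<in> S \<Longrightarrow> weight (\<tau> x) = (if dir (N x) = dir x then 1 / 2 else 1 / real n)"
  using dir_tau[of x] by (auto simp: weight_def)

text \<open>Adjacent pairs of directions give two turning corners and two others; alternating
  directions give no turn at all.\<close>

lemma vertex_weight:
  assumes "x \<in> S"
  shows "(\<Sum>y \<in> class_of S (graph_on S N) x. weight (\<tau> y)) =
    (if dir (N x) = dir x \<or> dir (N (N x)) = dir (N x) then 1 + 2 / real n else 4 / real n)"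
proof -
  have S: "N x \<in> S" "N (N x) \<in> S" "N (N (N x)) \<in> S" using assms by simp_all
  have cl: "class_of S (graph_on S N) x = {x, N x, N (N x), N (N (N x))}"
    by (rule vertex_cycle(2)) (use assms card_S in auto)
  have "(\<Sum>y \<in> class_of S (graph_on S N) x. weight (\<tau> y)) =
      weight (\<tau> x) + weight (\<tau> (N x)) + weight (\<tau> (N (N x))) + weight (\<tau> (N (N (N x))))"
    unfolding cl using distinct_vertex[OF assms] by simp
  also have "\<dots> = (if dir (N x) = dir x then 1 / 2 else 1 / real n)
     + (if dir (N (N x)) = dir (N x) then 1 / 2 else 1 / real n)
     + (if dir (N (N (N x))) = dir (N (N x)) then 1 / 2 else 1 / real n)
     + (if dir x = dir (N (N (N x))) then 1 / 2 else 1 / real n)"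
    using weight_tau[OF assms] weight_tau[OF S(1)] weight_tau[OF S(2)] weight_tau[OF S(3)] N4[OF assms] by simp
  finally show ?thesis using vertex_dirs[OF assms] by auto
qed

text \<open>Around a face there are as many changes from forward to backward as from backward to
  forward.\<close>

lemma face_turn_once_more:
  assumes C: "C \<in> classes S (graph_on S face)" and x: "x \<in> C" "dir (face x) \<noteq> dir x"
  obtains y where "y \<in> C" "y \<noteq> x" "dir (face y) \<noteq> dir y"
proof -
  have bC: "bij_betw face C C" by (rule perm_class_bij[OF finite_S bij_face C])
  have fC: "finite C" using classes_subset[OF C] finite_S by (rule finite_subset)
  let ?B = "{y \<in> C. dir y \<and> dir (face y)}"
  let ?U = "{y \<in> C. dir y \<and> \<not> dir (face y)}" and ?D = "{y \<in> C. \<not> dir y \<and> dir (face y)}"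
  have "face ` {y \<in> C. dir (face y)} = {y \<in> C. dir y}" using bC by (auto simp: bij_betw_def)
  moreover have "inj_on face {y \<in> C. dir (face y)}"
    using bC by (auto simp: bij_betw_def intro: inj_on_subset)
  then have "card (face ` {y \<in> C. dir (face y)}) = card {y \<in> C. dir (face y)}" by (rule card_image)
  ultimately have "card {y \<in> C. dir (face y)} = card {y \<in> C. dir y}" by simp
  moreover have "{y \<in> C. dir (face y)} = ?B \<union> ?D" "{y \<in> C. dir y} = ?B \<union> ?U" by auto
  moreover have "card (?B \<union> ?D) = card ?B + card ?D" "card (?B \<union> ?U) = card ?B + card ?U"
    by (rule card_Un_disjoint; use fC in auto)+
  ultimately have eq: "card ?U = card ?D" by simp
  show thesis
  proof (cases "dir x")
    case True
    then have "x \<in> ?U" using x by simp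
    moreover have "finite ?U" using fC by simp
    ultimately have "card ?U \<noteq> 0" unfolding card_0_eq[OF \<open>finite ?U\<close>] by blast
    then have "?D \<noteq> {}" unfolding eq by (metis card.empty)
    then obtain y where "y \<in> ?D" by blast
    then show thesis using that[of y] True by auto
  next
    case False
    then have "x \<in> ?D" using x by simp
    moreover have "finite ?D" using fC by simp
    ultimately have "card ?D \<noteq> 0" unfolding card_0_eq[OF \<open>finite ?D\<close>] by blast
    then have "?U \<noteq> {}" unfolding eq[symmetric] by (metis card.empty)
    then obtain y where "y \<in> ?U" by blast
    then show thesis using that[of y] False by auto
  qed
qed

text \<open>Without a turn the direction is constant, so the positions on the face are closed under
  a step around the cycle and exhaust it.\<close>

lemma winding_face:
  assumes C: "C \<in> classes S (graph_on S face)" and pass: "\<And>x. x \<in> C \<Longrightarrow> dir (face x) = dir x"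
  shows "n \<le> card C"
proof -
  have CS: "C \<subseteq> S" using C by (rule classes_subset)
  have bC: "bij_betw face C C" by (rule perm_class_bij[OF finite_S bij_face C])
  then have fm: "face x \<in> C" if "x \<in> C" for x using that by (rule bij_betw_apply)
  have fC: "finite C" using CS finite_S by (rule finite_subset)
  obtain x0 where x0: "x0 \<in> C" using classes_nonempty[OF C] by blast
  have "C = class_of S (graph_on S face) x0" using C x0 by (rule class_eq_of_mem)
  moreover have "class_of S (graph_on S face) x0 \<subseteq> {x \<in> C. dir x = dir x0}"
    by (rule class_of_perm_subset[OF finite_S bij_face]) (use CS x0 pass fm in auto)
  ultimately have const: "dir x = dir x0" if "x \<in> C" for x using that by blast
  have pf: "pos (face x) = pos (\<tau> x)" if "x \<in> C" for x using that CS pos_N by auto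
  let ?P = "pos ` C"
  interpret c: cyclic_doubling "{..<n}" "\<lambda>k. Suc k mod n" "\<lambda>k. k" "\<lambda>k. (k, 0)" "\<lambda>k. (k, 1)" "doubled_cycle n"
    by (rule doubled_cycle_cyclic_doubling[OF n2])
  have Pn: "?P \<subseteq> {..<n}" using CS pos_less by auto
  have "?P = {..<n}"
  proof (cases "dir x0")
    case True
    show ?thesis
    proof (rule c.cyclic[OF Pn])
      show "(\<lambda>k. Suc k mod n) ` ?P \<subseteq> ?P"
      proof
        fix k assume "k \<in> (\<lambda>k. Suc k mod n) ` ?P"
        then obtain x where x: "x \<in> C" "k = Suc (pos x) mod n" by blast
        then have "k = pos (face x)" using pos_dir(1)[of x] const[OF x(1)] True CS pf by auto
        then show "k \<in> ?P" using fm x(1) by blast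
      qed
    qed (use x0 in blast)
  next
    case False
    \<comment> \<open>For a face running backwards the complement of its positions is closed under
      successors, hence empty.\<close>
    let ?Q = "{..<n} - ?P"
    have "(\<lambda>k. Suc k mod n) ` ?Q \<subseteq> ?Q"
    proof
      fix l assume "l \<in> (\<lambda>k. Suc k mod n) ` ?Q"
      then obtain k where k: "k < n" "k \<notin> ?P" "l = Suc k mod n" by blast
      have "l \<notin> ?P"
      proof
        assume "l \<in> ?P"
        then obtain x where x: "x \<in> C" "l = pos x" by blast
        then have "l = Suc (pos (face x)) mod n" using pos_dir(2)[of x] const[OF x(1)] False CS pf by auto
        then have "k = pos (face x)"
          using Suc_mod_inj[OF k(1), of "pos (face x)"] k(3) pos_less fm[OF x(1)] CS by auto
        then show False using k(2) fm x(1) by blast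
      qed
      then show "l \<in> ?Q" using k n2 by simp
    qed
    then have "?Q = {} \<or> ?Q = {..<n}" using c.cyclic[of ?Q] by blast
    moreover have "pos x0 \<in> {..<n}" "pos x0 \<notin> ?Q" using x0 Pn by blast+
    ultimately show ?thesis using Pn by blast
  qed
  then show ?thesis using card_image_le[OF fC, of pos] by simp
qed

lemma face_weight:
  assumes C: "C \<in> classes S (graph_on S face)"
  shows "1 \<le> (\<Sum>x \<in> C. weight x)"
    and "(\<Sum>x \<in> C. weight x) = 1 \<Longrightarrow> x \<in> C \<Longrightarrow> dir (face x) \<noteq> dir x \<Longrightarrow> card C = 2"
proof -
  have fC: "finite C" using classes_subset[OF C] finite_S by (rule finite_subset)
  have turn: "\<exists>y. y \<in> C \<and> y \<noteq> x \<and> weight x + weight y = 1" if x: "x \<in> C" "dir (face x) \<noteq> dir x" for x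
  proof -
    obtain y where "y \<in> C" "y \<noteq> x" "dir (face y) \<noteq> dir y" using face_turn_once_more[OF C x] .
    then show ?thesis using x(2) by (intro exI[of _ y]) (simp add: weight_def)
  qed
  have split: "(\<Sum>z \<in> C. weight z) = weight x + weight y + (\<Sum>z \<in> C - {x, y}. weight z)"
    if "x \<in> C" "y \<in> C" "y \<noteq> x" for x y
    using sum.subset_diff[of "{x, y}" C weight] that fC by simp
  show "1 \<le> (\<Sum>x \<in> C. weight x)"
  proof (cases "\<exists>x \<in> C. dir (face x) \<noteq> dir x")
    case True
    then obtain x y where "x \<in> C" "y \<in> C" "y \<noteq> x" "weight x + weight y = 1" using turn by metis
    moreover have "0 \<le> (\<Sum>z \<in> C - {x, y}. weight z)" by (rule sum_nonneg) (simp add: less_imp_le weight_pos)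
    ultimately show ?thesis using split by simp
  next
    case False
    then have "(\<Sum>x \<in> C. weight x) = (\<Sum>x \<in> C. 1 / real n)" by (intro sum.cong) (auto simp: weight_def)
    moreover have "1 \<le> real (card C) / real n" using winding_face[OF C] False n2 by simp
    ultimately show ?thesis by simp
  qed
  assume one: "(\<Sum>x \<in> C. weight x) = 1" and x: "x \<in> C" "dir (face x) \<noteq> dir x"
  obtain y where y: "y \<in> C" "y \<noteq> x" "weight x + weight y = 1" using turn[OF x] by blast
  \<comment> \<open>Two turning corners already carry weight 1 and all weights are positive, so
    there is no further corner.\<close>
  have "C - {x, y} = {}"
  proof (rule ccontr)
    assume "C - {x, y} \<noteq> {}"
    then have "0 < (\<Sum>z \<in> C - {x, y}. weight z)" using fC weight_pos by (intro sum_pos) auto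
    then show False using split[OF x(1) y(1,2)] y(3) one by simp
  qed
  then have "C = {x, y}" using x y by blast
  then show "card C = 2" using y(2) by simp
qed

text \<open>Every corner is counted once at its face and once at its vertex.\<close>

lemma total_weight: "(\<Sum>C \<in> classes S (graph_on S face). \<Sum>x \<in> C. weight x)
    = (\<Sum>C \<in> classes S (graph_on S N). \<Sum>x \<in> C. weight (\<tau> x))"
  unfolding sum_classes[OF finite_S] using sum.reindex_bij_betw[OF bij_tau, of weight] by simp

lemma vertex_weight_le:
  assumes "C \<in> classes S (graph_on S N)"
  shows "(\<Sum>x \<in> C. weight (\<tau> x)) \<le> 1 + 2 / real n"
proof -
  obtain x where "x \<in> S" "C = class_of S (graph_on S N) x" using classes_rep[OF assms] by blast
  moreover have "4 / real n \<le> 1 + 2 / real n" using n2 by (simp add: field_simps)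
  ultimately show ?thesis using vertex_weight[of x] by simp
qed

text \<open>Once the totals over faces and over vertices agree with their bounds, equality is
  inherited by each face and each vertex.\<close>

lemma weights_tight:
  shows "ncomp = 1"
    and "C \<in> classes S (graph_on S face) \<Longrightarrow> (\<Sum>x \<in> C. weight x) = 1"
    and "C' \<in> classes S (graph_on S N) \<Longrightarrow> (\<Sum>x \<in> C'. weight (\<tau> x)) = 1 + 2 / real n"
proof -
  let ?F = "classes S (graph_on S face)" and ?V = "classes S (graph_on S N)"
  have fin: "finite ?F" "finite ?V" using finite_S by (simp_all add: classes_finite)
  have cV: "card ?V = n" by (rule card_S(2))
  have 1: "real (card ?F) = (\<Sum>C \<in> ?F. 1)" by simp
  have 2: "(\<Sum>C \<in> ?F. 1) \<le> (\<Sum>C \<in> ?F. \<Sum>x \<in> C. weight x)"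
    by (rule sum_mono) (rule face_weight(1))
  have 3: "(\<Sum>C \<in> ?V. \<Sum>x \<in> C. weight (\<tau> x)) \<le> (\<Sum>C \<in> ?V. 1 + 2 / real n)"
    by (rule sum_mono) (rule vertex_weight_le)
  have "(\<Sum>C \<in> ?V. 1 + 2 / real n) = real n * (1 + 2 / real n)" using cV by simp
  then have 4: "(\<Sum>C \<in> ?V. 1 + 2 / real n) = real n + 2" using n2 by (simp add: field_simps)
  have 5: "real (card ?F) = 2 * real ncomp + real n" using card_faces by simp
  have "0 < ncomp" by (rule ncomp_pos[OF S_nonempty])
  moreover have "2 * real ncomp + real n \<le> real n + 2" using 1 2 3 4 5 total_weight by linarith
  ultimately show K: "ncomp = 1" by simp
  then have 6: "(\<Sum>C \<in> ?F. 1) = real n + 2" using 1 5 by simp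
  then have F: "(\<Sum>C \<in> ?F. 1) = (\<Sum>C \<in> ?F. \<Sum>x \<in> C. weight x)"
    and V: "(\<Sum>C \<in> ?V. \<Sum>x \<in> C. weight (\<tau> x)) = (\<Sum>C \<in> ?V. 1 + 2 / real n)"
    using 2 3 4 total_weight by linarith+
  show "(\<Sum>x \<in> C. weight x) = 1" if "C \<in> ?F" for C
    using sum_mono_inv[OF F face_weight(1) that fin(1)] by simp
  show "(\<Sum>x \<in> C. weight (\<tau> x)) = 1 + 2 / real n" if "C \<in> ?V" for C
    using sum_mono_inv[OF V vertex_weight_le that fin(2)] .
qed

lemma bigon_at_turn:
  assumes "x \<in> S" "dir (face x) \<noteq> dir x"
  shows "face (face x) = x"
proof -
  let ?C = "class_of S (graph_on S face) x"
  have C: "?C \<in> classes S (graph_on S face)" using assms(1) by (simp add: classes_def)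
  have xC: "x \<in> ?C" using assms(1) by (rule class_of_self)
  have "card ?C = 2" by (rule face_weight(2)[OF C weights_tight(2)[OF C] xC assms(2)])
  have bC: "bij_betw face ?C ?C" by (rule perm_class_bij[OF finite_S bij_face C])
  have f: "face x \<in> ?C" "face (face x) \<in> ?C" using bij_betw_apply[OF bC] xC by blast+
  have ne: "face x \<noteq> x" "face (face x) \<noteq> face x"
    using col_face[OF assms(1)] col_face[OF face_mem[OF assms(1)]] by auto
  have "card {x, face x} = 2" using ne(1) by (metis card_2_iff)
  moreover have "finite ?C" using class_of_subset finite_S by (rule finite_subset)
  ultimately have "?C = {x, face x}"
    using card_subset_eq[of ?C "{x, face x}"] \<open>card ?C = 2\<close> xC f(1) by simp
  then show ?thesis using f(2) ne(2) by blast
qed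

text \<open>For \<open>n\<close> \<ge> 3 the vertex weights 1 + 2/n and 4/n differ, so directions
  alternate at no vertex and \<open>Q\<close> can mark the corners between darts of equal direction.
  For \<open>n = 2\<close> the weights coincide, but 8 darts on 4 faces leave only bigons.\<close>

lemma opposite_corners:
  shows "\<exists>Q. (\<forall>x \<in> S. Q x \<longrightarrow> face (face x) = x \<and> Q (face x) \<and> Q (N (N x))) \<and> (\<forall>x \<in> S. Q x \<or> Q (N x))"
proof (cases "n = 2")
  case True
  have "card S \<le> 2 * ncyc S face" using card_S card_faces weights_tight(1) True by simp
  then have "face (face x) = x" if "x \<in> S" for x using faces_all_bigons that by blast
  then show ?thesis by (intro exI[of _ "\<lambda>_. True"]) blast
next
  case False
  then have n3: "3 \<le> n" using n2 by simp
  define Q where "Q x \<longleftrightarrow> dir (Ninv x) = dir x" for x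
  have adj: "dir (N x) = dir x \<or> dir (N (N x)) = dir (N x)" if "x \<in> S" for x
  proof -
    have "class_of S (graph_on S N) x \<in> classes S (graph_on S N)" using that by (simp add: classes_def)
    from weights_tight(3)[OF this] vertex_weight[OF that] show ?thesis
      using n3 by (auto simp: field_simps split: if_splits)
  qed
  have Ninv3: "Ninv x = N (N (N x))" if "x \<in> S" for x
    using that N4[OF that] Ninv_N[of "N (N (N x))"] by simp
  have "face (face x) = x \<and> Q (face x) \<and> Q (N (N x))" if x: "x \<in> S" "Q x" for x
  proof -
    define y where "y = \<tau> (Ninv x)"
    have y: "y \<in> S" "face y = x" "\<tau> y = Ninv x" using x by (simp_all add: y_def)
    have dy: "dir y = (\<not> dir x)" using dir_tau[of "Ninv x"] x by (simp add: y_def Q_def)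
    then have ffy: "face (face y) = y" using bigon_at_turn[OF y(1)] y(2) by auto
    then have fx: "face x = y" using y(2) by simp
    have "Q y"
    proof -
      have "Ninv y = \<tau> x" using fx x Ninv_N[of "\<tau> x"] by simp
      then show ?thesis using dir_tau[OF x(1)] dy by (simp add: Q_def)
    qed
    moreover have "Q (N (N x))"
    proof -
      have "dir (N (N (N x))) = dir x" using x Ninv3[OF x(1)] by (simp add: Q_def)
      then have "dir (N (N x)) = dir (N x)" using vertex_dirs(2)[OF x(1)] by simp
      then show ?thesis using x by (simp add: Q_def)
    qed
    ultimately show ?thesis using fx y(2) by simp
  qed
  moreover have "Q x \<or> Q (N x)" if "x \<in> S" for x
  proof -
    have "dir (N (Ninv x)) = dir (Ninv x) \<or> dir (N (N (Ninv x))) = dir (N (Ninv x))"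
      using adj[of "Ninv x"] that by simp
    then show ?thesis using that by (auto simp: Q_def)
  qed
  ultimately show ?thesis by blast
qed

text \<open>With 8 darts each, there are n/2 state curves of either kind, so n is even and the state
  defect is (n + 2) - n.\<close>

lemma state_defect_eq: "state_defect S N \<tau> col = 2" "even n"
proof -
  obtain Q where "\<forall>x \<in> S. Q x \<longrightarrow> face (face x) = x \<and> Q (face x) \<and> Q (N (N x))" "\<forall>x \<in> S. Q x \<or> Q (N x)"
    using opposite_corners by blast
  then have ns: "card S = 8 * nstates S N \<tau> col" "card S = 8 * nstates S N \<tau> (\<lambda>x. \<not> col x)"
    using nstates_ge[of Q, OF N4] by blast+
  then show "even n" using card_S by presburger
  show "state_defect S N \<tau> col = 2"
    using ns card_S card_faces weights_tight(1) unfolding state_defect_def by linarith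
qed

end

lemma (in map_graph) state_defect_doubled_cycle:
  assumes "G \<cong>\<^sub>m doubled_cycle n" "2 \<le> n"
  shows "state_defect S N \<tau> col = 2" "even n"
proof -
  obtain f g where "bij_betw f (verts G) (verts (doubled_cycle n))"
    "bij_betw g (edges G) (edges (doubled_cycle n))"
    "\<forall>e \<in> edges G. ends (doubled_cycle n) (g e) = f ` ends G e"
    using assms(1) unfolding mgraph_iso_def by blast
  then interpret doubled_cycle_map S N \<tau> col v G n f g
    by unfold_locales (use assms(2) in auto)
  show "state_defect S N \<tau> col = 2" "even n" by (rule state_defect_eq)+
qed

section \<open>Reduced alternating decomposition graphs\<close>

lemma multigraph_iso:
  assumes "multigraph H" "H \<cong>\<^sub>m G"
  shows "multigraph G"
proof -
  obtain f g where fg: "bij_betw f (verts H) (verts G)" "bij_betw g (edges H) (edges G)"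
    "\<forall>e \<in> edges H. ends G (g e) = f ` ends H e" using assms(2) unfolding mgraph_iso_def by blast
  have "ends G e \<subseteq> verts G \<and> card (ends G e) \<in> {1, 2}" if "e \<in> edges G" for e
  proof -
    from that have "e \<in> g ` edges H" using fg(2) by (simp add: bij_betw_def)
    then obtain e' where e': "e' \<in> edges H" "e = g e'" by blast
    have E: "ends H e' \<subseteq> verts H" "card (ends H e') \<in> {1, 2}"
      using assms(1) e'(1) by (simp_all add: multigraph_def)
    have "inj_on f (ends H e')" using fg(1) E(1) by (meson bij_betw_imp_inj_on inj_on_subset)
    then have "card (f ` ends H e') = card (ends H e')" by (rule card_image)
    moreover have "f ` ends H e' \<subseteq> verts G" using E(1) fg(1) by (auto simp: bij_betw_def)
    moreover have "ends G e = f ` ends H e'" using e' fg(3) by simp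
    ultimately show ?thesis using E(2) by simp
  qed
  then show ?thesis
    using assms(1) bij_betw_finite[OF fg(1)] bij_betw_finite[OF fg(2)] by (simp add: multigraph_def)
qed

lemma component_containing:
  assumes "u \<in> verts G"
  defines "A \<equiv> class_of (verts G) (adjacency G) u"
  shows "G\<lparr>verts := A, edges := {e \<in> edges G. ends G e \<subseteq> A}\<rparr> \<in> components G"
  using assms(1) unfolding components_def A_def classes_def by blast

text \<open>If the boundary of \<open>X\<close> had one or two edges, 3-edge connectedness would
  leave a path between the ends of one of them that avoids the boundary, yet such a path cannot
  leave \<open>X\<close>.\<close>

lemma reduced_cut:
  assumes "multigraph G" "reduced G" "\<not> single_vertex G"
  shows "card {e \<in> edges G. ends G e \<inter> X \<noteq> {} \<and> \<not> ends G e \<subseteq> X} \<notin> {1, 2}"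
proof
  let ?\<delta> = "{e \<in> edges G. ends G e \<inter> X \<noteq> {} \<and> \<not> ends G e \<subseteq> X}"
  assume small: "card ?\<delta> \<in> {1, 2}"
  then have "?\<delta> \<noteq> {}" by (metis card.empty insert_iff singletonD zero_neq_numeral zero_neq_one)
  then obtain e0 u w where e0: "e0 \<in> edges G" "u \<in> ends G e0" "u \<in> X" "w \<in> ends G e0" "w \<notin> X" by blast
  have E: "ends G e0 \<subseteq> verts G" "card (ends G e0) \<le> 2" "finite (verts G)" "finite (edges G)"
    using assms(1) e0(1) unfolding multigraph_def by auto
  have uw: "u \<noteq> w" using e0 by blast
  have "{u, w} = ends G e0"
    using card_seteq[of "ends G e0" "{u, w}"] E e0 uw finite_subset[OF E(1,3)] by simp
  then have adj: "(u, w) \<in> adjacency G" using e0(1) by (auto simp: adjacency_def)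
  have uwV: "u \<in> verts G" "w \<in> verts G" using E(1) e0 by blast+
  define A where "A = class_of (verts G) (adjacency G) u"
  define C where "C = G\<lparr>verts := A, edges := {e \<in> edges G. ends G e \<subseteq> A}\<rparr>"
  have uA: "u \<in> A" "w \<in> A"
    using uwV adj by (simp_all add: A_def mem_class_of eqc_edge)
  have "C \<in> components G" unfolding C_def A_def by (rule component_containing[OF uwV(1)])
  then have "k_edge_connected 3 C" using assms(2,3) by (auto simp: reduced_def)
  moreover have "card (?\<delta> \<inter> edges C) < 3"
    using card_mono[of ?\<delta> "?\<delta> \<inter> edges C"] small E(4) by auto
  ultimately have "connected_mgraph (C\<lparr>edges := edges C - (?\<delta> \<inter> edges C)\<rparr>)"
    unfolding k_edge_connected_def by simp
  then have "(u, w) \<in> (adjacency (C\<lparr>edges := edges C - (?\<delta> \<inter> edges C)\<rparr>))\<^sup>*"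
    using uA by (simp add: connected_mgraph_def C_def)
  then have "w \<in> X"
  proof (induction rule: rtrancl_induct)
    case (step y z)
    then obtain e where e: "e \<in> edges C" "e \<notin> ?\<delta>" "ends C e = {y, z}" unfolding adjacency_def by auto
    then have "e \<in> edges G" "ends G e = {y, z}" by (simp_all add: C_def)
    then show ?case using e(2) step.IH by auto
  qed (rule e0)
  then show False using e0 by simp
qed

text \<open>Here an isolated vertex must not count as 3-edge connected. It guarantees that every
  vertex of the graph comes from a curve through marked points.\<close>

lemma reduced_no_isolated:
  assumes "multigraph G" "reduced G" "\<not> single_vertex G" "u \<in> verts G"
  shows "\<exists>e \<in> edges G. u \<in> ends G e"
proof (rule ccontr)
  assume iso: "\<not> ?thesis"
  define A where "A = class_of (verts G) (adjacency G) u"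
  define C where "C = G\<lparr>verts := A, edges := {e \<in> edges G. ends G e \<subseteq> A}\<rparr>"
  have "C \<in> components G" unfolding C_def A_def by (rule component_containing[OF assms(4)])
  then have "\<not> single_vertex C" using assms(2,3) by (auto simp: reduced_def)
  moreover have "A = {u}"
  proof
    show "A \<subseteq> {u}" unfolding A_def
      by (rule class_of_subset_closed) (use iso in \<open>auto simp: adjacency_def\<close>)
    show "{u} \<subseteq> A" using assms(4) by (simp add: A_def class_of_self)
  qed
  moreover have "\<not> ends G e \<subseteq> {u}" if "e \<in> edges G" for e
  proof
    assume "ends G e \<subseteq> {u}"
    moreover have "ends G e \<noteq> {}" using assms(1) that unfolding multigraph_def by force
    ultimately show False using iso that by blast
  qed
  ultimately show False by (simp add: C_def single_vertex_def)
qed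

text \<open>The diagram picked by \<open>SOME\<close> has the graph \<open>G\<close>, so the genus
  can be computed on it.\<close>

lemma adg_diagram:
  assumes "is_alt_decomp_graph G"
  obtains D :: "nat diagram" where "link_diagram D" "alt_decomp_graph D \<cong>\<^sub>m G" "adg_turaev_genus G = turaev_genus D"
proof -
  have "is_alt_decomp_graph_of G (SOME D. is_alt_decomp_graph_of G D)"
    using assms someI_ex[of "is_alt_decomp_graph_of G"] by (simp add: is_alt_decomp_graph_def)
  then show thesis
    by (intro that[of "SOME D. is_alt_decomp_graph_of G D"])
      (simp_all only: is_alt_decomp_graph_of_def adg_turaev_genus_def)
qed

section \<open>Reduced graphs as reduced maps\<close>

context diagram
begin

lemma finite_marked: "finite (marked_points D)"
  using finite_S by (rule finite_subset[rotated]) (auto simp: marked_points_def)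

lemma glue_marked: "d \<in> marked_points D \<Longrightarrow> glue D d \<in> marked_points D"
  by (auto simp: marked_points_eq)

lemma multigraph_alt_decomp_graph: "multigraph (alt_decomp_graph D)"
proof -
  let ?H = "alt_decomp_graph D"
  have "finite {C \<in> crossing_components D. C \<inter> marked_points D = {}}"
    by (simp add: crossing_components_def classes_finite finite_S)
  then have "finite (verts ?H)" "finite (edges ?H)" using finite_marked by (simp_all add: alt_decomp_graph_def)
  moreover have "ends ?H e \<subseteq> verts ?H \<and> card (ends ?H e) \<in> {1, 2}" if "e \<in> edges ?H" for e
  proof -
    from that obtain d where d: "d \<in> marked_points D" "e = edge_of D d"
      unfolding alt_decomp_graph_def by auto
    then have E: "ends ?H e = {Inl (curve_through D d), Inl (curve_through D (glue D d))}"
      by (simp add: alt_decomp_graph_def edge_of_def)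
    have "card {a, b} \<in> {1, 2}" for a b :: "'c dart set + nat" by (cases "a = b") simp_all
    moreover have "ends ?H e \<subseteq> verts ?H" using d(1) glue_marked[OF d(1)] unfolding E by (simp add: alt_decomp_graph_def)
    ultimately show ?thesis unfolding E by blast
  qed
  ultimately show ?thesis unfolding multigraph_def by blast
qed

lemma reduced_map_graph:
  assumes iso: "alt_decomp_graph D \<cong>\<^sub>m G" and red: "reduced G" "\<not> single_vertex G"
  obtains \<sigma> where "map_graph (marked_points D) \<sigma> (glue D) over (\<lambda>d. Inl (curve_through D d)) (alt_decomp_graph D)"
    and "turaev_genus D = of_int (state_defect (marked_points D) \<sigma> (glue D) over) / 2"
proof -
  let ?M = "marked_points D" and ?H = "alt_decomp_graph D"
  let ?v = "\<lambda>d. Inl (curve_through D d) :: 'c dart set + nat"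
  obtain \<sigma> where \<sigma>: "colored_map ?M \<sigma> (glue D) over"
    "\<And>d. d \<in> ?M \<Longrightarrow> over (glue D d) = over d"
    "defect ?M (\<lambda>d. \<sigma> (glue D d)) (glue D) = 0"
    "turaev_genus D = of_int (state_defect ?M \<sigma> (glue D) over) / 2"
    "\<And>d. curve_through D d = class_of ?M (graph_on ?M \<sigma>) d" by (rule marked_map) blast
  interpret M: colored_map ?M \<sigma> "glue D" over by (rule \<sigma>(1))
  have mH: "multigraph ?H" by (rule multigraph_alt_decomp_graph)
  have mG: "multigraph G" using mH iso by (rule multigraph_iso)
  obtain f g where fg: "bij_betw f (verts ?H) (verts G)" "bij_betw g (edges ?H) (edges G)"
    "\<forall>e \<in> edges ?H. ends G (g e) = f ` ends ?H e" using iso unfolding mgraph_iso_def by blast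
  have v_eq: "?v x = ?v y \<longleftrightarrow> (x, y) \<in> eqc (graph_on ?M \<sigma>)" if "x \<in> ?M" "y \<in> ?M" for x y
    using that by (simp add: \<sigma>(5) class_of_eq_iff)
  have eH: "edges ?H = (\<lambda>x. {x, glue D x}) ` ?M" by (simp add: alt_decomp_graph_def edge_of_def)
  have endsH: "ends ?H {x, glue D x} = {?v x, ?v (glue D x)}" if "x \<in> ?M" for x
    by (simp add: alt_decomp_graph_def)
  have vH: "?v x \<in> verts ?H" if "x \<in> ?M" for x using that by (simp add: alt_decomp_graph_def)
  have f_eq: "f a = f b \<longleftrightarrow> a = b" if "a \<in> verts ?H" "b \<in> verts ?H" for a b
    using that fg(1) by (meson bij_betw_imp_inj_on inj_on_eq_iff)
  have verts: "verts ?H = ?v ` ?M"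
  proof
    show "verts ?H \<subseteq> ?v ` ?M"
    proof
      fix a assume a: "a \<in> verts ?H"
      then have "f a \<in> verts G" using fg(1) bij_betw_apply by fastforce
      then obtain e where "e \<in> edges G" "f a \<in> ends G e" using reduced_no_isolated[OF mG red] by blast
      then obtain e' where e': "e' \<in> edges ?H" "f a \<in> f ` ends ?H e'"
        using fg(2,3) by (metis bij_betw_imp_surj_on imageE)
      then obtain x where x: "x \<in> ?M" "e' = {x, glue D x}" unfolding eH by blast
      have "f a \<in> {f (?v x), f (?v (glue D x))}" using e'(2) endsH[OF x(1)] x(2) by simp
      then have "a = ?v x \<or> a = ?v (glue D x)" using f_eq a vH x(1) glue_marked[OF x(1)] by auto
      then show "a \<in> ?v ` ?M" using x(1) glue_marked[OF x(1)] by blast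
    qed
  qed (use vH in blast)
  \<comment> \<open>A set closed under \<sigma> is a union of curves, that is, a set of vertices of
    the graph; its outgoing darts correspond to the edges that leave this set.\<close>
  have cut: "card {x \<in> X. glue D x \<notin> X} \<notin> {1, 2}" if X: "X \<subseteq> ?M" "\<sigma> ` X \<subseteq> X" for X
  proof -
    let ?X = "(\<lambda>x. f (?v x)) ` X" and ?e = "\<lambda>x. g {x, glue D x}"
    let ?\<delta> = "{e \<in> edges G. ends G e \<inter> ?X \<noteq> {} \<and> \<not> ends G e \<subseteq> ?X}"
    have mem: "f (?v y) \<in> ?X \<longleftrightarrow> y \<in> X" if y: "y \<in> ?M" for y
    proof
      assume "f (?v y) \<in> ?X"
      then obtain x where x: "x \<in> X" "f (?v y) = f (?v x)" by blast
      then have "x \<in> ?M" using X(1) by blast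
      then have "?v y = ?v x" using f_eq[OF vH[OF y] vH] x(2) by blast
      then have "(y, x) \<in> eqc (graph_on ?M \<sigma>)" using v_eq[OF y \<open>x \<in> ?M\<close>] by blast
      then have "y \<in> X \<longleftrightarrow> x \<in> X"
        by (rule eqc_closed) (use bij_closed[OF M.finite_S M.bij_N X] in auto)
      then show "y \<in> X" using x(1) by blast
    qed blast
    have endsG: "ends G (?e x) = {f (?v x), f (?v (glue D x))}" and eG: "?e x \<in> edges G" if "x \<in> ?M" for x
    proof -
      have "{x, glue D x} \<in> edges ?H" using that eH by blast
      then show "ends G (?e x) = {f (?v x), f (?v (glue D x))}" "?e x \<in> edges G"
        using fg(3) endsH[OF that] bij_betw_apply[OF fg(2)] by simp_all
    qed
    have "?e ` {x \<in> X. glue D x \<notin> X} = ?\<delta>"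
    proof
      show "?e ` {x \<in> X. glue D x \<notin> X} \<subseteq> ?\<delta>"
      proof
        fix e assume "e \<in> ?e ` {x \<in> X. glue D x \<notin> X}"
        then obtain x where x: "x \<in> X" "glue D x \<notin> X" "e = ?e x" by blast
        then have "x \<in> ?M" using X(1) by blast
        then show "e \<in> ?\<delta>" using endsG eG mem x glue_marked by simp
      qed
      show "?\<delta> \<subseteq> ?e ` {x \<in> X. glue D x \<notin> X}"
      proof
        fix e assume e: "e \<in> ?\<delta>"
        then have "e \<in> g ` edges ?H" using fg(2) by (simp add: bij_betw_def)
        then obtain x where x: "x \<in> ?M" "e = ?e x" unfolding eH by blast
        then have gx: "glue D x \<in> ?M" by (simp add: glue_marked)
        have "ends G e = {f (?v x), f (?v (glue D x))}" using endsG x by simp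
        then have "x \<in> X \<and> glue D x \<notin> X \<or> x \<notin> X \<and> glue D x \<in> X"
          using e mem[OF x(1)] mem[OF gx] by auto
        then show "e \<in> ?e ` {x \<in> X. glue D x \<notin> X}"
        proof
          assume "x \<notin> X \<and> glue D x \<in> X"
          moreover have "e = ?e (glue D x)" using x by (simp add: insert_commute)
          ultimately show ?thesis using x(1) by force
        qed (use x in blast)
      qed
    qed
    \<comment> \<open>An edge leaving \<open>X\<close> has just one of its darts in
      \<open>X\<close>.\<close>
    moreover have "inj_on ?e {x \<in> X. glue D x \<notin> X}"
    proof (rule inj_onI)
      fix x y assume xy: "x \<in> {x \<in> X. glue D x \<notin> X}" "y \<in> {x \<in> X. glue D x \<notin> X}" "?e x = ?e y"
      then have "{x, glue D x} \<in> edges ?H" "{y, glue D y} \<in> edges ?H" using eH X(1) by blast+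
      then have "{x, glue D x} = {y, glue D y}" using xy(3) fg(2) by (meson bij_betw_imp_inj_on inj_onD)
      then show "x = y" using xy(1,2) by (auto simp: doubleton_eq_iff)
    qed
    then have "card (?e ` {x \<in> X. glue D x \<notin> X}) = card {x \<in> X. glue D x \<notin> X}" by (rule card_image)
    ultimately have "card {x \<in> X. glue D x \<notin> X} = card ?\<delta>" by simp
    then show ?thesis using reduced_cut[OF mG red, of ?X] by simp
  qed
  have "map_graph ?M \<sigma> (glue D) over ?v ?H"
    by unfold_locales (use \<sigma>(2,3) cut v_eq verts eH endsH in auto)
  then show thesis using that \<sigma>(4) by blast
qed

text \<open>If all edges are alternating, contraction leaves the empty map.\<close>

lemma turaev_genus_unmarked:
  assumes "marked_points D = {}"
  shows "turaev_genus D = 0"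
proof -
  obtain \<sigma> where "turaev_genus D = of_int (state_defect (marked_points D) \<sigma> (glue D) over) / 2"
    by (rule marked_map)
  then show ?thesis using assms by (simp add: state_defect_def nstates_def classes_def)
qed

end

theorem theorem1p2:
  fixes G :: "('v, 'e) mgraph"
  assumes "is_alt_decomp_graph G" and "reduced G"
  shows "(adg_turaev_genus G = 1 \<longleftrightarrow> doubled_path_equivalent G (doubled_cycle 2)) \<and>
         (adg_turaev_genus G = 1 \<longleftrightarrow> (\<exists>i \<ge> 2. even i \<and> G \<cong>\<^sub>m doubled_cycle i))"
proof -
  obtain D :: "nat diagram" where d: "link_diagram D" "alt_decomp_graph D \<cong>\<^sub>m G" "adg_turaev_genus G = turaev_genus D"
    using adg_diagram[OF assms(1)] .
  interpret diagram D by unfold_locales (rule d(1))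
  let ?H = "alt_decomp_graph D"
  have mG: "multigraph G" using multigraph_alt_decomp_graph d(2) by (rule multigraph_iso)
  have GH: "G \<cong>\<^sub>m ?H"
    by (rule mgraph_iso_sym[OF _ d(2)]) (use multigraph_alt_decomp_graph in \<open>simp add: multigraph_def\<close>)
  \<comment> \<open>The second half takes any length and yields evenness; this is what links the
    even cycles to doubled path equivalence, which is characterised by cycles of any length.\<close>
  have "(adg_turaev_genus G = 1 \<longrightarrow> (\<exists>n \<ge> 2. even n \<and> G \<cong>\<^sub>m doubled_cycle n)) \<and>
      (\<forall>n \<ge> 2. G \<cong>\<^sub>m doubled_cycle n \<longrightarrow> adg_turaev_genus G = 1 \<and> even n)"
  proof (cases "single_vertex G")
    case True
    then obtain u where u: "verts G = {u}" "edges G = {}" by (auto simp: single_vertex_def)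
    have "edges ?H = {}" using d(2) u(2) by (auto simp: mgraph_iso_def bij_betw_def)
    then have "turaev_genus D = 0" by (intro turaev_genus_unmarked) (simp add: alt_decomp_graph_def)
    moreover have "\<not> G \<cong>\<^sub>m doubled_cycle n" if "n \<ge> 2" for n
    proof
      assume "G \<cong>\<^sub>m doubled_cycle n"
      then obtain f where "bij_betw f (verts G) (verts (doubled_cycle n))" by (auto simp: mgraph_iso_def)
      from bij_betw_same_card[OF this] show False using u that by (simp add: doubled_cycle_def)
    qed
    ultimately show ?thesis using d(3) by simp
  next
    case False
    obtain \<sigma> where \<sigma>: "map_graph (marked_points D) \<sigma> (glue D) over (\<lambda>d. Inl (curve_through D d)) ?H"
      "turaev_genus D = of_int (state_defect (marked_points D) \<sigma> (glue D) over) / 2"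
      using reduced_map_graph[OF d(2) assms(2) False] .
    interpret M: map_graph "marked_points D" \<sigma> "glue D" over "\<lambda>d. Inl (curve_through D d)" ?H by (rule \<sigma>(1))
    have g: "adg_turaev_genus G = 1 \<longleftrightarrow> state_defect (marked_points D) \<sigma> (glue D) over = 2"
      unfolding d(3) \<sigma>(2) by linarith
    show ?thesis
      using g M.forward M.state_defect_doubled_cycle mgraph_iso_trans[OF GH] mgraph_iso_trans[OF d(2)] by blast
  qed
  then show ?thesis using doubled_path_equivalent_iff[OF mG] by blast
qed

end
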